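(* Let $A$ be a finite abelian group and let $G$ be a polysurface group of length $n$ with filtration $1=G_0\unlhd G_1\unlhd G_2\unlhd\dots\unlhd G_n=G$. For any central extension $$1\to A\to\Gamma\xrightarrow{\phi}G\to1,$$ there is a finite index (normal) subgroup $G_1'$ of $G_1\subset G$ such that $G_1/G_1'$ is cyclic of order $e(A)$ and the induced extension $$1\to A\to\Gamma_1'\to G_1'\to1,\qquad \Gamma_1'=\phi^{-1}(G_1'),$$ is trivial. Moreover, if $i:G_1'\hookrightarrow A\oplus G_1'\cong\Gamma_1'\subset\Gamma$ denotes the resulting inclusion, then the index of the subgroup $\Gamma':=N_\Gamma(i(G_1'))$ of $\Gamma$ is less than $$|A|^{2e(A) g_1(G)}\cdot e(A)\,(e(A)!)^{2g_1(G)+|r(A)|}.$$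
   Context: A surface group is the fundamental group of a closed orientable surface of genus at least $2$. A group $G$ is a polysurface group of length $n$ with filtration $1=G_0<G_1<\dots<G_n=G$ if each $G_i$ is normal in $G$ and each $G_i/G_{i-1}$ ($1\le i\le n$) is a surface group; $g_1(G)$ is the genus of the surface group $G_1$. For a finite abelian group $A$, $e(A)$ is its exponent and $r(A)$ is a generating set of $A$ of minimal size. A central extension is trivial if it is isomorphic as an extension to the product extension. $N_\Gamma(\cdot)$ denotes the normalizer in $\Gamma$.
   Formalization: For trivial A the strict bound fails (the bound and the index of Γ' are both 1), so the index is shown to be at most the bound for every finite abelian A and strictly less whenever A is nontrivial. *)

theory Defs
  imports "HOL-Analysis.Analysis" "HOL-Algebra.Algebra"
begin

definition path_class :: "'a::topological_space set \<Rightarrow> (real \<Rightarrow> 'a) \<Rightarrow> (real \<Rightarrow> 'a) set" where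
  "path_class S p = {q. homotopic_paths S p q}"

definition loops_at :: "'a::topological_space set \<Rightarrow> 'a \<Rightarrow> (real \<Rightarrow> 'a) set" where
  "loops_at S x = {p. path p \<and> path_image p \<subseteq> S \<and> pathstart p = x \<and> pathfinish p = x}"

definition fundamental_group ::
    "'a::topological_space set \<Rightarrow> 'a \<Rightarrow> (real \<Rightarrow> 'a) set monoid" where
  "fundamental_group S x =
     \<lparr> carrier = path_class S ` loops_at S x,
       mult = (\<lambda>C D. {r. \<exists>p\<in>C. \<exists>q\<in>D. homotopic_paths S (p +++ q) r}),
       one = path_class S (\<lambda>_. x) \<rparr>"

lemma mem_path_class: "q \<in> path_class S p \<longleftrightarrow> homotopic_paths S p q"
  by (simp add: path_class_def)

lemma path_class_eq_iff:
  assumes "p \<in> loops_at S x"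
  shows "path_class S p = path_class S q \<longleftrightarrow> homotopic_paths S p q"
proof
  assume eq: "path_class S p = path_class S q"
  have "p \<in> path_class S p"
    using assms by (simp add: mem_path_class loops_at_def)
  then show "homotopic_paths S p q"
    unfolding eq mem_path_class by (rule homotopic_paths_sym)
next
  assume pq: "homotopic_paths S p q"
  show "path_class S p = path_class S q"
  proof (rule Set.set_eqI)
    fix r
    show "r \<in> path_class S p \<longleftrightarrow> r \<in> path_class S q"
      unfolding mem_path_class
      using homotopic_paths_trans[OF pq] homotopic_paths_trans[OF homotopic_paths_sym[OF pq]]
      by blast
  qed
qed

lemma fundamental_group_mult:
  assumes "p \<in> loops_at S x" "q \<in> loops_at S x"
  shows "path_class S p \<otimes>\<^bsub>fundamental_group S x\<^esub> path_class S q = path_class S (p +++ q)"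
proof (rule Set.set_eqI)
  fix r
  have fin: "pathfinish p = pathstart q"
    and refl: "homotopic_paths S p p" "homotopic_paths S q q"
    using assms by (auto simp: loops_at_def)
  have "homotopic_paths S (p +++ q) r"
    if "homotopic_paths S p p'" "homotopic_paths S q q'" "homotopic_paths S (p' +++ q') r" for p' q'
    by (rule homotopic_paths_trans[OF homotopic_paths_join[OF that(1,2) fin] that(3)])
  then show "r \<in> path_class S p \<otimes>\<^bsub>fundamental_group S x\<^esub> path_class S q \<longleftrightarrow>
      r \<in> path_class S (p +++ q)"
    unfolding fundamental_group_def path_class_def monoid.simps mem_Collect_eq Bex_def
    using refl by blast
qed

lemma loops_at_join:
  assumes "p \<in> loops_at S x" "q \<in> loops_at S x"
  shows "p +++ q \<in> loops_at S x"
  using assms by (auto simp: loops_at_def path_image_join)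

lemma group_fundamental_group:
  fixes x :: "'a::real_normed_vector"
  assumes "x \<in> S"
  shows "group (fundamental_group S x)"
proof (rule groupI)
  let ?P = "fundamental_group S x"
  have car: "carrier ?P = path_class S ` loops_at S x"
    and one: "\<one>\<^bsub>?P\<^esub> = path_class S (linepath x x)"
    by (simp_all add: fundamental_group_def linepath_refl)
  have c: "linepath x x \<in> loops_at S x"
    using assms by (simp add: loops_at_def)
  show "\<one>\<^bsub>?P\<^esub> \<in> carrier ?P"
    using c one car by blast
  show "a \<otimes>\<^bsub>?P\<^esub> b \<in> carrier ?P" if ab: "a \<in> carrier ?P" "b \<in> carrier ?P" for a b
  proof -
    obtain p q where "p \<in> loops_at S x" "q \<in> loops_at S x" "a = path_class S p" "b = path_class S q"
      using ab unfolding car by blast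
    then show ?thesis
      by (simp add: fundamental_group_mult loops_at_join car)
  qed
  show "a \<otimes>\<^bsub>?P\<^esub> b \<otimes>\<^bsub>?P\<^esub> d = a \<otimes>\<^bsub>?P\<^esub> (b \<otimes>\<^bsub>?P\<^esub> d)"
    if abd: "a \<in> carrier ?P" "b \<in> carrier ?P" "d \<in> carrier ?P" for a b d
  proof -
    obtain p q r where pqr: "p \<in> loops_at S x" "q \<in> loops_at S x" "r \<in> loops_at S x"
      and eq: "a = path_class S p" "b = path_class S q" "d = path_class S r"
      using abd unfolding car by blast
    have "homotopic_paths S ((p +++ q) +++ r) (p +++ (q +++ r))"
      by (rule homotopic_paths_sym, rule homotopic_paths_assoc) (use pqr in \<open>auto simp: loops_at_def\<close>)
    then show ?thesis
      using pqr by (simp add: eq fundamental_group_mult loops_at_join path_class_eq_iff[where x=x])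
  qed
  show "\<one>\<^bsub>?P\<^esub> \<otimes>\<^bsub>?P\<^esub> a = a" if a: "a \<in> carrier ?P" for a
  proof -
    obtain p where p: "p \<in> loops_at S x" "a = path_class S p"
      using a unfolding car by blast
    have "homotopic_paths S (linepath x x +++ p) p"
      by (rule homotopic_paths_lid') (use p in \<open>auto simp: loops_at_def\<close>)
    then show ?thesis
      using p c by (simp add: one fundamental_group_mult loops_at_join path_class_eq_iff[where x=x])
  qed
  show "\<exists>b\<in>carrier ?P. b \<otimes>\<^bsub>?P\<^esub> a = \<one>\<^bsub>?P\<^esub>" if a: "a \<in> carrier ?P" for a
  proof -
    obtain p where p: "p \<in> loops_at S x" "a = path_class S p"
      using a unfolding car by blast
    have r: "reversepath p \<in> loops_at S x"
      using p by (auto simp: loops_at_def)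
    have "homotopic_paths S (reversepath p +++ p) (linepath x x)"
      using homotopic_paths_linv[of p S] p by (simp add: loops_at_def)
    then show ?thesis
      using p r c car
      by (intro bexI[of _ "path_class S (reversepath p)"])
        (auto simp: one fundamental_group_mult loops_at_join path_class_eq_iff[where x=x])
  qed
qed

text \<open>
  The closed orientable surface of genus \<open>g \<ge> 1\<close> is the regular \<open>4g\<close>-gon whose sides, read
  counterclockwise, are glued according to the word
  \<open>a\<^sub>1 b\<^sub>1 a\<^sub>1\<inverse> b\<^sub>1\<inverse> \<dots> a\<^sub>g b\<^sub>g a\<^sub>g\<inverse> b\<^sub>g\<inverse>\<close>.
  Sides are numbered from \<open>0\<close>, so the sides \<open>i\<close> with \<open>i mod 4 < 2\<close> carry the letters
  \<open>a\<^sub>j, b\<^sub>j\<close>, and side \<open>i + 2\<close> carries the inverse letter; whence the parameter \<open>1 - t\<close>.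
\<close>

definition polygon_vertex :: "nat \<Rightarrow> nat \<Rightarrow> complex" where
  "polygon_vertex g k = cis (2 * pi * real k / real (4 * g))"

definition surface_polygon :: "nat \<Rightarrow> complex set" where
  "surface_polygon g = convex hull (polygon_vertex g ` {..<4 * g})"

definition polygon_side :: "nat \<Rightarrow> nat \<Rightarrow> real \<Rightarrow> complex" where
  "polygon_side g k = linepath (polygon_vertex g k) (polygon_vertex g (Suc k))"

inductive side_gluing :: "nat \<Rightarrow> complex \<Rightarrow> complex \<Rightarrow> bool" for g where
  "\<lbrakk>i < 4 * g; i mod 4 < 2; t \<in> {0..1}\<rbrakk>
     \<Longrightarrow> side_gluing g (polygon_side g i t) (polygon_side g (i + 2) (1 - t))"

definition closed_orientable_surface :: "nat \<Rightarrow> 'a::topological_space set \<Rightarrow> bool" where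
  "closed_orientable_surface g S \<longleftrightarrow> 1 \<le> g \<and>
     (\<exists>q. quotient_map (top_of_set (surface_polygon g)) (top_of_set S) q \<and>
          (\<forall>x\<in>surface_polygon g. \<forall>y\<in>surface_polygon g.
              q x = q y \<longleftrightarrow> equivclp (side_gluing g) x y))"

text \<open>
  Every closed orientable surface embeds in \<open>\<real>\<^sup>3\<close>, so restricting to subspaces of \<open>\<real>\<^sup>3\<close> loses
  nothing up to homeomorphism; it serves to fix the type of the surface. The basepoint is
  immaterial since surfaces are path-connected.
\<close>

definition surface_group :: "nat \<Rightarrow> ('a, 'b) monoid_scheme \<Rightarrow> bool" where
  "surface_group g G \<longleftrightarrow> 2 \<le> g \<and> group G \<and>
     (\<exists>(S :: (real ^ 3) set) x. closed_orientable_surface g S \<and> x \<in> S \<and>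
        G \<cong> fundamental_group S x)"

definition polysurface_filtration ::
    "('a, 'b) monoid_scheme \<Rightarrow> nat \<Rightarrow> (nat \<Rightarrow> 'a set) \<Rightarrow> bool" where
  "polysurface_filtration G n F \<longleftrightarrow>
     group G \<and> F 0 = {\<one>\<^bsub>G\<^esub>} \<and> F n = carrier G \<and>
     (\<forall>i\<le>n. F i \<lhd> G) \<and> (\<forall>i<n. F i \<subset> F (Suc i)) \<and>
     (\<forall>i<n. \<exists>g. surface_group g (G\<lparr>carrier := F (Suc i)\<rparr> Mod F i))"

definition group_exponent :: "('a, 'b) monoid_scheme \<Rightarrow> nat" where
  "group_exponent A = (LEAST m::nat. 0 < m \<and> (\<forall>x\<in>carrier A. x [^]\<^bsub>A\<^esub> m = \<one>\<^bsub>A\<^esub>))"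

definition minimal_generating_set :: "('a, 'b) monoid_scheme \<Rightarrow> 'a set \<Rightarrow> bool" where
  "minimal_generating_set A R \<longleftrightarrow>
     finite R \<and> R \<subseteq> carrier A \<and> generate A R = carrier A \<and>
     (\<forall>R'. finite R' \<and> R' \<subseteq> carrier A \<and> generate A R' = carrier A \<longrightarrow> card R \<le> card R')"

definition central_extension ::
    "('a, 'x) monoid_scheme \<Rightarrow> ('b, 'y) monoid_scheme \<Rightarrow> ('c, 'z) monoid_scheme \<Rightarrow>
     ('a \<Rightarrow> 'b) \<Rightarrow> ('b \<Rightarrow> 'c) \<Rightarrow> bool" where
  "central_extension A \<Gamma> G \<iota> \<phi> \<longleftrightarrow>
     group A \<and> group \<Gamma> \<and> group G \<and>
     \<iota> \<in> hom A \<Gamma> \<and> inj_on \<iota> (carrier A) \<and>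
     \<phi> \<in> hom \<Gamma> G \<and> \<phi> ` carrier \<Gamma> = carrier G \<and>
     kernel \<Gamma> G \<phi> = \<iota> ` carrier A \<and>
     (\<forall>a\<in>carrier A. \<forall>x\<in>carrier \<Gamma>. \<iota> a \<otimes>\<^bsub>\<Gamma>\<^esub> x = x \<otimes>\<^bsub>\<Gamma>\<^esub> \<iota> a)"

definition preimage_subgroup ::
    "('b, 'y) monoid_scheme \<Rightarrow> ('b \<Rightarrow> 'c) \<Rightarrow> 'c set \<Rightarrow> 'b set" where
  "preimage_subgroup \<Gamma> \<phi> H = {x \<in> carrier \<Gamma>. \<phi> x \<in> H}"

text \<open>
  An isomorphism of extensions from the product extension \<open>1 \<rightarrow> A \<rightarrow> A \<times> G \<rightarrow> G \<rightarrow> 1\<close> to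
  \<open>1 \<rightarrow> A \<rightarrow> \<Gamma> \<rightarrow> G \<rightarrow> 1\<close>, inducing the identity on \<open>A\<close> and on \<open>G\<close>.
\<close>

definition trivialization ::
    "('a, 'x) monoid_scheme \<Rightarrow> ('b, 'y) monoid_scheme \<Rightarrow> ('c, 'z) monoid_scheme \<Rightarrow>
     ('a \<Rightarrow> 'b) \<Rightarrow> ('b \<Rightarrow> 'c) \<Rightarrow> ('a \<times> 'c \<Rightarrow> 'b) \<Rightarrow> bool" where
  "trivialization A \<Gamma> G \<iota> \<phi> \<theta> \<longleftrightarrow>
     \<theta> \<in> iso (A \<times>\<times> G) \<Gamma> \<and>
     (\<forall>a\<in>carrier A. \<theta> (a, \<one>\<^bsub>G\<^esub>) = \<iota> a) \<and>
     (\<forall>a\<in>carrier A. \<forall>x\<in>carrier G. \<phi> (\<theta> (a, x)) = x)"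

definition trivial_extension ::
    "('a, 'x) monoid_scheme \<Rightarrow> ('b, 'y) monoid_scheme \<Rightarrow> ('c, 'z) monoid_scheme \<Rightarrow>
     ('a \<Rightarrow> 'b) \<Rightarrow> ('b \<Rightarrow> 'c) \<Rightarrow> bool" where
  "trivial_extension A \<Gamma> G \<iota> \<phi> \<longleftrightarrow> (\<exists>\<theta>. trivialization A \<Gamma> G \<iota> \<phi> \<theta>)"

end

theory Submission
  imports Defs
begin

text \<open>
  The fundamental group of the \<open>4g\<close>-gon with glued sides is generated by the \<open>2g\<close> loops that cross one
  pair of glued sides, because a small piece of a path can be pulled to the centre of a star neighbourhood.
  Going around the vertex gives the word \<open>\<Prod> u v\<inverse> u\<inverse> v = 1\<close>. Conversely, elements of a group satisfying
  this relation label the points of the polygon compatibly with the gluing, and the holonomy of these labels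
  is a homomorphism; so this is the only relation.

  Let \<open>z \<in> A\<close> be the value of the word on lifts of the generators to \<open>\<Gamma>\<close>. Twisting \<open>\<Gamma> \<times> \<int> \<times> \<int>\<close> by the
  cocycle \<open>((x, m, n), (x', m', n')) \<mapsto> z\<^bsup>m n'\<^esup>\<close> kills the word, which gives a section \<open>f\<close> with \<open>f (x y) = f x f y z\<^bsup>\<alpha>(x) \<beta>(y)\<^esup>\<close>, where
  \<open>\<alpha>\<close> and \<open>\<beta>\<close> are homomorphisms to \<open>\<int>\<close>. It is multiplicative on the kernel of \<open>\<alpha>\<close> modulo \<open>e(A)\<close>.

  The index of the normalizer is the number of conjugates of \<open>i(G\<^sub>1')\<close>. Each lies over one of at most
  \<open>e\<^sup>2\<^sup>g\<close> kernels, and over each kernel, generated by \<open>2 g e\<close> Schreier generators, there are at most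
  \<open>|A|\<^bsup>2 g e\<^esup>\<close> sections.
\<close>

section \<open>Cells with sides glued in pairs\<close>

inductive glue :: "'k set \<Rightarrow> ('k \<Rightarrow> real \<Rightarrow> 'p) \<Rightarrow> ('k \<Rightarrow> real \<Rightarrow> 'p) \<Rightarrow> 'p \<Rightarrow> 'p \<Rightarrow> bool"
  for K a b where
  "k \<in> K \<Longrightarrow> t \<in> {0..1} \<Longrightarrow> glue K a b (a k t) (b k t)"

inductive glue_pair ::
    "'k set \<Rightarrow> ('k \<Rightarrow> real \<Rightarrow> 'p) \<Rightarrow> ('k \<Rightarrow> real \<Rightarrow> 'p) \<Rightarrow> 'p \<times> 'p \<Rightarrow> 'p \<times> 'p \<Rightarrow> bool"
  for K a b where
  "k \<in> K \<Longrightarrow> t \<in> {0..1} \<Longrightarrow> t' \<in> {0..1} \<Longrightarrow> glue_pair K a b (a k t, a k t') (b k t, b k t')"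

lemma continuous_on_quotient_compact:
  fixes f :: "'a::metric_space \<Rightarrow> 'b::topological_space" and q :: "'c::metric_space \<Rightarrow> 'a"
  assumes "compact D" "continuous_on D q" "N \<subseteq> D"
    and sat: "\<And>w. w \<in> D \<Longrightarrow> q w \<in> q ` N \<Longrightarrow> w \<in> N"
    and cont: "continuous_on N (f \<circ> q)"
  shows "continuous_on (q ` N) f"
proof (rule ccontr)
  assume "\<not> continuous_on (q ` N) f"
  then obtain y u where y: "y \<in> q ` N" and u: "\<forall>n. u n \<in> q ` N" "u \<longlonglongrightarrow> y"
    and nf: "\<not> (f \<circ> u) \<longlonglongrightarrow> f y"
    unfolding continuous_on_sequentially by blast
  from nf obtain V where V: "open V" "f y \<in> V" and nev: "\<not> eventually (\<lambda>n. (f \<circ> u) n \<in> V) sequentially"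
    by (auto simp: tendsto_def)
  then have "\<exists>\<^sub>F n in sequentially. f (u n) \<notin> V"
    by (simp add: frequently_def)
  then obtain r :: "nat \<Rightarrow> nat" where r: "strict_mono r" "\<And>n. f (u (r n)) \<notin> V"
    using not_eventually_sequentiallyD[of "\<lambda>n. f (u n) \<in> V"] nev by (auto simp: o_def)
  have "\<forall>n. \<exists>w\<in>N. u (r n) = q w"
    using u by blast
  then obtain w where w: "\<And>n. w n \<in> N" "\<And>n. u (r n) = q (w n)"
    by metis
  obtain l r' where l: "l \<in> D" "strict_mono r'" "(w \<circ> r') \<longlonglongrightarrow> l"
    using \<open>compact D\<close> w(1) \<open>N \<subseteq> D\<close> unfolding compact_def by (meson subsetD)
  have "(q \<circ> (w \<circ> r')) \<longlonglongrightarrow> q l"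
  proof -
    have "\<forall>n. (w \<circ> r') n \<in> D" using w(1) \<open>N \<subseteq> D\<close> by auto
    with l(3) show ?thesis
      using assms(2)[unfolded continuous_on_sequentially, THEN spec, THEN bspec, OF l(1)] by simp
  qed
  moreover have "(q \<circ> (w \<circ> r')) \<longlonglongrightarrow> y"
  proof -
    have "(u \<circ> (r \<circ> r')) \<longlonglongrightarrow> y"
      using u(2) r(1) l(2) by (intro LIMSEQ_subseq_LIMSEQ strict_mono_o)
    then show ?thesis by (simp add: o_def w(2))
  qed
  ultimately have ql: "q l = y" by (rule LIMSEQ_unique)
  have "l \<in> N" by (rule sat[OF l(1)]) (simp add: ql y)
  have "((f \<circ> q) \<circ> (w \<circ> r')) \<longlonglongrightarrow> (f \<circ> q) l"
    using cont[unfolded continuous_on_sequentially, THEN spec, THEN bspec, OF \<open>l \<in> N\<close>, of "w \<circ> r'"] l(3) w(1)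
    by simp
  then have "eventually (\<lambda>n. ((f \<circ> q) \<circ> (w \<circ> r')) n \<in> V) sequentially"
    by (rule topological_tendstoD) (use V ql in simp_all)
  moreover have "((f \<circ> q) \<circ> (w \<circ> r')) n \<notin> V" for n
    using r(2)[of "r' n"] w(2)[of "r' n"] by simp
  ultimately show False by (simp add: eventually_False_sequentially)
qed

locale glued_cell =
  fixes P :: "'p::euclidean_space set" and q :: "'p \<Rightarrow> 'm::real_normed_vector" and S :: "'m set"
    and K :: "'k set" and a0 a1 b0 b1 :: "'k \<Rightarrow> 'p"
  assumes compact_P: "compact P" and convex_P: "convex P" and finite_K: "finite K"
    and ends: "\<And>k. k \<in> K \<Longrightarrow> a0 k \<in> P \<and> a1 k \<in> P \<and> b0 k \<in> P \<and> b1 k \<in> P"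
    and len: "\<And>k. k \<in> K \<Longrightarrow> dist (a0 k) (a1 k) = dist (b0 k) (b1 k)"
    and quot: "quotient_map (top_of_set P) (top_of_set S) q"
    and q_eq_iff: "\<And>w w'. w \<in> P \<Longrightarrow> w' \<in> P \<Longrightarrow> q w = q w' \<longleftrightarrow>
      equivclp (glue K (\<lambda>k. linepath (a0 k) (a1 k)) (\<lambda>k. linepath (b0 k) (b1 k))) w w'"
    and finite_fibre: "\<And>x. finite {w \<in> P. q w = x}"
begin

abbreviation "al k \<equiv> linepath (a0 k) (a1 k)"
abbreviation "be k \<equiv> linepath (b0 k) (b1 k)"
abbreviation "gl \<equiv> glue K al be"
abbreviation "glp \<equiv> glue_pair K al be"

lemma linepath_in_P: "x \<in> P \<Longrightarrow> y \<in> P \<Longrightarrow> t \<in> {0..1} \<Longrightarrow> linepath x y t \<in> P"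
  using convex_P by (auto intro: convexD_alt simp: linepath_def)

lemma al_be_in_P: "k \<in> K \<Longrightarrow> t \<in> {0..1} \<Longrightarrow> al k t \<in> P \<and> be k t \<in> P"
  using ends linepath_in_P by blast

lemma continuous_q: "continuous_on P q" and q_image: "q ` P = S"
  using quot quotient_imp_continuous_map[of "top_of_set P" "top_of_set S" q] quotient_imp_surjective_map[OF quot]
  by (auto simp: )

lemma compact_S: "compact S"
  using compact_continuous_image[OF continuous_q compact_P] q_image by simp

lemma dist_linepath: "dist (linepath x y t) (linepath x y t') = \<bar>t - t'\<bar> * dist x (y::'p)"
proof -
  have "linepath x y t - linepath x y t' = (t - t') *\<^sub>R (y - x)"
    by (simp add: linepath_def algebra_simps)
  then show ?thesis by (simp add: dist_norm norm_minus_commute)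
qed

lemma glI: "k \<in> K \<Longrightarrow> t \<in> {0..1} \<Longrightarrow> gl (al k t) (be k t)"
  using glue.intros[of k K t al be] .

lemma glpI: "k \<in> K \<Longrightarrow> t \<in> {0..1} \<Longrightarrow> t' \<in> {0..1} \<Longrightarrow> glp (al k t, al k t') (be k t, be k t')"
  using glue_pair.intros[of k K t t' al be] .

lemma glp_dist: "glp v v' \<Longrightarrow> dist (fst v) (snd v) = dist (fst v') (snd v')"
  by (induction rule: glue_pair.induct) (simp add: dist_linepath len)

lemma equivclp_glp_dist: "equivclp glp v v' \<Longrightarrow> dist (fst v) (snd v) = dist (fst v') (snd v')"
  by (induction rule: equivclp_induct) (auto dest: glp_dist)

lemma glp_interpolate: "glp v v' \<Longrightarrow> t \<in> {0..1} \<Longrightarrow> gl (linepath (fst v) (snd v) t) (linepath (fst v') (snd v') t)"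
proof (induction rule: glue_pair.induct)
  case (1 k r r')
  have *: "linepath (linepath x y r) (linepath x y r') t = linepath x y (linepath r r' t)" for x y :: 'p
    by (simp add: linepath_def algebra_simps)
  have "linepath r r' t \<in> {0..1}"
    using 1 convexD_alt[OF convex_real_interval(5)[of 0 "1::real"], of r r' t] by (simp add: linepath_def)
  then show ?case using 1 glI[of k "linepath r r' t"] by (simp add: *)
qed

lemma equivclp_interpolate:
  "equivclp glp v v' \<Longrightarrow> t \<in> {0..1} \<Longrightarrow> equivclp gl (linepath (fst v) (snd v) t) (linepath (fst v') (snd v') t)"
proof (induction rule: equivclp_induct)
  case (step y z)
  then show ?case using glp_interpolate[of y z t] glp_interpolate[of z y t]
    by (meson equivclp_into_equivclp)
qed simp

lemma gl_in_P: "gl w w' \<Longrightarrow> w \<in> P \<and> w' \<in> P"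
  by (induction rule: glue.induct) (simp add: al_be_in_P)

definition fibre :: "'m \<Rightarrow> 'p set" where "fibre x = {w \<in> P. q w = x}"

lemma finite_fibres: "finite (fibre x)" using finite_fibre by (simp add: fibre_def)

definition good_radius :: "'m \<Rightarrow> real \<Rightarrow> bool" where
  "good_radius x e \<longleftrightarrow> e > 0 \<and> (\<forall>v\<in>fibre x. \<forall>v'\<in>fibre x. v \<noteq> v' \<longrightarrow> 2 * e \<le> dist v v') \<and>
     (\<forall>v\<in>fibre x. \<forall>k\<in>K. \<forall>t\<in>{0..1}. (dist (al k t) v < e \<longrightarrow> v \<in> al k ` {0..1}) \<and>
        (dist (be k t) v < e \<longrightarrow> v \<in> be k ` {0..1}))"

lemma finite_positive_bound:
  assumes "finite I" and "\<And>i. i \<in> I \<Longrightarrow> \<exists>e>0. \<forall>d. 0 < d \<and> d \<le> e \<longrightarrow> R i d"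
  shows "\<exists>e>0::real. \<forall>d. 0 < d \<and> d \<le> e \<longrightarrow> (\<forall>i\<in>I. R i d)"
  using assms
proof (induction rule: finite_induct)
  case empty
  then show ?case by (auto intro: exI[of _ 1])
next
  case (insert i I)
  then obtain e where "e > 0" "\<forall>d. 0 < d \<and> d \<le> e \<longrightarrow> (\<forall>i\<in>I. R i d)" by auto
  moreover obtain e' where "e' > 0" "\<forall>d. 0 < d \<and> d \<le> e' \<longrightarrow> R i d" using insert.prems by blast
  ultimately show ?case by (intro exI[of _ "min e e'"]) auto
qed

lemma near_segment:
  fixes x y v :: 'p
  shows "\<exists>e>0. \<forall>d. 0 < d \<and> d \<le> e \<longrightarrow> (\<forall>t\<in>{0..1}. dist (linepath x y t) v < d \<longrightarrow> v \<in> linepath x y ` {0..1})"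
proof (cases "v \<in> linepath x y ` {0..1}")
  case False
  have clo: "closed (linepath x y ` {0..1})"
    using closed_path_image[of "linepath x y"] by (simp add: path_image_def)
  with False obtain e where "e > 0" "\<forall>z\<in>linepath x y ` {0..1}. e \<le> dist v z"
    using separate_point_closed[OF clo False] by blast
  then have "\<not> dist (linepath x y t) v < d" if "d \<le> e" "t \<in> {0..1}" for t d
    using that by (metis dist_commute imageI order.trans not_less)
  then show ?thesis using \<open>e > 0\<close> by blast
qed (auto intro: exI[of _ 1])

lemma good_radius_exists: "\<exists>e. good_radius x e"
proof -
  have "\<exists>e>0. \<forall>d. 0 < d \<and> d \<le> e \<longrightarrow> (\<forall>z \<in> fibre x \<times> fibre x. fst z \<noteq> snd z \<longrightarrow> 2 * d \<le> dist (fst z) (snd z))"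
  proof (rule finite_positive_bound)
    show "finite (fibre x \<times> fibre x)" using finite_fibres by simp
    show "\<exists>e>0. \<forall>d. 0 < d \<and> d \<le> e \<longrightarrow> fst z \<noteq> snd z \<longrightarrow> 2 * d \<le> dist (fst z) (snd z)" for z :: "'p \<times> 'p"
    proof (cases "fst z = snd z")
      case False
      then show ?thesis by (intro exI[of _ "dist (fst z) (snd z) / 2"]) auto
    qed (auto intro: exI[of _ 1])
  qed
  then obtain e1 where e1: "e1 > 0" "\<forall>d. 0 < d \<and> d \<le> e1 \<longrightarrow> (\<forall>z \<in> fibre x \<times> fibre x. fst z \<noteq> snd z \<longrightarrow> 2 * d \<le> dist (fst z) (snd z))"
    by blast
  have "\<exists>e>0. \<forall>d. 0 < d \<and> d \<le> e \<longrightarrow> (\<forall>z \<in> fibre x \<times> K. \<forall>t\<in>{0..1}. dist (al (snd z) t) (fst z) < d \<longrightarrow> fst z \<in> al (snd z) ` {0..1})"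
  proof (rule finite_positive_bound)
    show "finite (fibre x \<times> K)" using finite_fibres finite_K by simp
  qed (rule near_segment)
  then obtain e2 where e2: "e2 > 0" "\<forall>d. 0 < d \<and> d \<le> e2 \<longrightarrow> (\<forall>z \<in> fibre x \<times> K. \<forall>t\<in>{0..1}. dist (al (snd z) t) (fst z) < d \<longrightarrow> fst z \<in> al (snd z) ` {0..1})"
    by blast
  have "\<exists>e>0. \<forall>d. 0 < d \<and> d \<le> e \<longrightarrow> (\<forall>z \<in> fibre x \<times> K. \<forall>t\<in>{0..1}. dist (be (snd z) t) (fst z) < d \<longrightarrow> fst z \<in> be (snd z) ` {0..1})"
  proof (rule finite_positive_bound)
    show "finite (fibre x \<times> K)" using finite_fibres finite_K by simp
  qed (rule near_segment)
  then obtain e3 where e3: "e3 > 0" "\<forall>d. 0 < d \<and> d \<le> e3 \<longrightarrow> (\<forall>z \<in> fibre x \<times> K. \<forall>t\<in>{0..1}. dist (be (snd z) t) (fst z) < d \<longrightarrow> fst z \<in> be (snd z) ` {0..1})"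
    by blast
  define e where "e = Min {e1,e2,e3}"
  have e: "e > 0" "e \<le> e1" "e \<le> e2" "e \<le> e3" using e1 e2 e3 by (auto simp: e_def)
  have "2 * e \<le> dist v v'" if "v \<in> fibre x" "v' \<in> fibre x" "v \<noteq> v'" for v v'
    using e1(2)[rule_format, of e "(v, v')"] e that by simp
  moreover have "v \<in> al k ` {0..1}" if "v \<in> fibre x" "k \<in> K" "t \<in> {0..1}" "dist (al k t) v < e" for v k t
    using e2(2)[rule_format, of e "(v, k)" t] e that by simp
  moreover have "v \<in> be k ` {0..1}" if "v \<in> fibre x" "k \<in> K" "t \<in> {0..1}" "dist (be k t) v < e" for v k t
    using e3(2)[rule_format, of e "(v, k)" t] e that by simp
  ultimately have "good_radius x e"
    unfolding good_radius_def using e(1) by blast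
  then show ?thesis ..
qed

definition radius :: "'m \<Rightarrow> real" where "radius x = (SOME e. good_radius x e)"

lemma good_radius_radius: "good_radius x (radius x)"
  unfolding radius_def by (rule someI_ex[OF good_radius_exists])

lemma radius_pos: "radius x > 0" using good_radius_radius good_radius_def by blast

lemma lift_pair_step:
  assumes "v \<in> fibre x" "dist w v < radius x" "gl w w' \<or> gl w' w"
  shows "\<exists>v'\<in>fibre x. glp (w, v) (w', v') \<or> glp (w', v') (w, v)"
  using assms(3)
proof
  assume "gl w w'"
  then obtain k t where kt: "k \<in> K" "t \<in> {0..1}" "w = al k t" "w' = be k t"
    by (auto elim: glue.cases)
  then obtain t' where t': "t' \<in> {0..1}" "v = al k t'"
    using good_radius_radius[of x] assms unfolding good_radius_def by blast
  have "q (be k t') = q v"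
    using t' kt al_be_in_P[of k t'] q_eq_iff[of v "be k t'"] glI[of k t']
    by (auto intro: r_into_equivclp)
  then have "be k t' \<in> fibre x" using assms(1) al_be_in_P[of k t'] kt t' by (auto simp: fibre_def)
  then show ?thesis using kt t' glpI[of k t t'] by blast
next
  assume "gl w' w"
  then obtain k t where kt: "k \<in> K" "t \<in> {0..1}" "w' = al k t" "w = be k t"
    by (auto elim: glue.cases)
  then obtain t' where t': "t' \<in> {0..1}" "v = be k t'"
    using good_radius_radius[of x] assms unfolding good_radius_def by blast
  have "q (al k t') = q v"
    using t' kt al_be_in_P[of k t'] q_eq_iff[of "al k t'" v] glI[of k t']
    by (auto intro: r_into_equivclp)
  then have "al k t' \<in> fibre x" using assms(1) al_be_in_P[of k t'] kt t' by (auto simp: fibre_def)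
  then show ?thesis using kt t' glpI[of k t t'] by blast
qed

lemma lift_pair:
  assumes "equivclp gl w w'" "v \<in> fibre x" "dist w v < radius x"
  shows "\<exists>v'\<in>fibre x. equivclp glp (w, v) (w', v')"
  using assms(1)
proof (induction rule: equivclp_induct)
  case base
  show ?case using assms(2) by (intro bexI[of _ v]) auto
next
  case (step y z)
  then obtain v' where v': "v' \<in> fibre x" "equivclp glp (w, v) (y, v')" by auto
  then have "dist y v' < radius x" using equivclp_glp_dist[OF v'(2)] assms by simp
  then obtain v'' where "v'' \<in> fibre x" "glp (y, v') (z, v'') \<or> glp (z, v'') (y, v')"
    using lift_pair_step v' step(2) by blast
  then show ?case using v' by (meson equivclp_into_equivclp)
qed

definition centre :: "'m \<Rightarrow> 'p \<Rightarrow> 'p" where "centre x w = (SOME v. v \<in> fibre x \<and> dist w v < radius x)"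

lemma centre_eq: "v \<in> fibre x \<Longrightarrow> dist w v < radius x \<Longrightarrow> centre x w = v"
proof -
  assume v: "v \<in> fibre x" "dist w v < radius x"
  then have c: "centre x w \<in> fibre x \<and> dist w (centre x w) < radius x"
    unfolding centre_def by (metis (mono_tags, lifting) someI)
  have "dist (centre x w) v < 2 * radius x"
    using c v dist_triangle3[of "centre x w" v w] by auto
  then show ?thesis using c v good_radius_radius[of x] unfolding good_radius_def by force
qed

definition nbhd :: "'m \<Rightarrow> real \<Rightarrow> 'p set" where "nbhd x r = {w \<in> P. \<exists>v\<in>fibre x. dist w v < r}"

lemma nbhd_iff: "r \<le> radius x \<Longrightarrow> w \<in> nbhd x r \<longleftrightarrow> w \<in> P \<and> centre x w \<in> fibre x \<and> dist w (centre x w) < r"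
  unfolding nbhd_def mem_Collect_eq using centre_eq[of _ x w] by (metis order.strict_trans2)

lemma pair_of_eq:
  assumes "w \<in> nbhd x r" "r \<le> radius x" "w' \<in> P" "q w = q w'"
  shows "w' \<in> nbhd x r \<and> equivclp glp (w, centre x w) (w', centre x w')"
proof -
  have c: "w \<in> P" "centre x w \<in> fibre x" "dist w (centre x w) < r" using assms nbhd_iff by auto
  have "equivclp gl w w'" using q_eq_iff assms c by blast
  then obtain v' where v': "v' \<in> fibre x" "equivclp glp (w, centre x w) (w', v')"
    using lift_pair[of w w' "centre x w" x] c assms by auto
  then have "dist w' v' < r" using equivclp_glp_dist[OF v'(2)] c by simp
  then show ?thesis using centre_eq[of v' x w'] v' assms by (auto simp: nbhd_def)
qed

lemma nbhd_saturated: "r \<le> radius x \<Longrightarrow> w' \<in> P \<Longrightarrow> q w' \<in> q ` nbhd x r \<Longrightarrow> w' \<in> nbhd x r"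
  by (elim imageE, drule pair_of_eq[of _ x r w']) auto

lemma openin_nbhd: "openin (top_of_set P) (nbhd x r)"
proof -
  have "nbhd x r = P \<inter> (\<Union>v\<in>fibre x. ball v r)" by (force simp: nbhd_def dist_commute)
  then show ?thesis using openin_open_Int[of "\<Union>v\<in>fibre x. ball v r" P] by (simp add: open_UN)
qed

definition star :: "'m \<Rightarrow> real \<Rightarrow> 'm set" where "star x r = q ` nbhd x r"

lemma openin_star: "r \<le> radius x \<Longrightarrow> openin (top_of_set S) (star x r)"
proof -
  assume r: "r \<le> radius x"
  have "{w \<in> P. q w \<in> star x r} = nbhd x r"
    using nbhd_saturated[OF r] by (auto simp: star_def nbhd_def)
  moreover have "star x r \<subseteq> S" using q_image by (auto simp: star_def nbhd_def)
  ultimately show ?thesis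
    using quot openin_nbhd[of x r] unfolding quotient_map_def by auto
qed

lemma centre_in_star: "x \<in> S \<Longrightarrow> 0 < r \<Longrightarrow> x \<in> star x r"
  using q_image by (force simp: star_def nbhd_def fibre_def)

end

section \<open>Generators of the fundamental group\<close>

context glued_cell begin

lemma q_in_S: "w \<in> P \<Longrightarrow> q w \<in> S" using q_image by blast

lemma path_q_linepath:
  assumes "w \<in> P" "w' \<in> P"
  shows "path (q \<circ> linepath w w')" "path_image (q \<circ> linepath w w') \<subseteq> S"
    "pathstart (q \<circ> linepath w w') = q w" "pathfinish (q \<circ> linepath w w') = q w'"
proof -
  have sub: "path_image (linepath w w') \<subseteq> P"
    using assms convex_P by (simp add: closed_segment_subset)
  show "path (q \<circ> linepath w w')"
    using continuous_on_subset[OF continuous_q sub] by (intro path_continuous_image) auto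
  show "path_image (q \<circ> linepath w w') \<subseteq> S"
    using sub q_image by (auto simp: path_image_compose simp del: path_image_linepath)
qed (simp_all add: pathstart_compose pathfinish_compose)

definition contr :: "'m \<Rightarrow> 'm \<times> real \<Rightarrow> 'm" where
  "contr x z = (let w = (SOME w. w \<in> nbhd x (radius x) \<and> q w = fst z) in q (linepath w (centre x w) (snd z)))"

lemma contr_eq:
  assumes "w \<in> nbhd x (radius x)" "t \<in> {0..1}"
  shows "contr x (q w, t) = q (linepath w (centre x w) t)"
proof -
  define w' where "w' = (SOME w'. w' \<in> nbhd x (radius x) \<and> q w' = q w)"
  have w': "w' \<in> nbhd x (radius x) \<and> q w' = q w"
    unfolding w'_def by (rule someI[of _ w]) (use assms in auto)
  have P: "w \<in> P" "w' \<in> P" "centre x w \<in> P" "centre x w' \<in> P"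
    using assms(1) w' nbhd_iff[of "radius x" x] by (auto simp: fibre_def)
  have "equivclp glp (w, centre x w) (w', centre x w')"
    using pair_of_eq[of w x "radius x" w'] assms w' P by auto
  then have "equivclp gl (linepath w (centre x w) t) (linepath w' (centre x w') t)"
    using equivclp_interpolate assms(2) by fastforce
  then have "q (linepath w (centre x w) t) = q (linepath w' (centre x w') t)"
    using q_eq_iff P linepath_in_P assms(2) by blast
  then show ?thesis by (simp add: contr_def w'_def Let_def)
qed

lemma continuous_centre: "continuous_on (nbhd x (radius x)) (centre x)"
  unfolding continuous_on_iff
proof (intro ballI allI impI)
  fix w and e :: real assume w: "w \<in> nbhd x (radius x)" and e: "e > 0"
  then have c: "centre x w \<in> fibre x" "dist w (centre x w) < radius x" using nbhd_iff by auto
  have "dist (centre x w') (centre x w) < e" if "dist w' w < radius x - dist w (centre x w)" for w'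
  proof -
    have "dist w' (centre x w) < radius x" using dist_triangle[of w' "centre x w" w] that by linarith
    then show ?thesis using centre_eq[OF c(1)] e by simp
  qed
  then show "\<exists>d>0. \<forall>w'\<in>nbhd x (radius x). dist w' w < d \<longrightarrow> dist (centre x w') (centre x w) < e"
    using c by (intro exI[of _ "radius x - dist w (centre x w)"]) auto
qed

lemma continuous_contr: "continuous_on (star x (radius x) \<times> {0..1}) (contr x)"
proof -
  let ?q = "\<lambda>z. (q (fst z), snd z :: real)"
  have "continuous_on (?q ` (nbhd x (radius x) \<times> {0..1})) (contr x)"
  proof (rule continuous_on_quotient_compact[where D = "P \<times> {0..1}"])
    show "compact (P \<times> {0..1::real})" using compact_P by (intro compact_Times) auto
    show "continuous_on (P \<times> {0..1}) ?q"
      by (intro continuous_on_Pair continuous_on_snd continuous_on_id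
          continuous_on_compose2[OF continuous_q continuous_on_fst[OF continuous_on_id]]) auto
    show "nbhd x (radius x) \<times> {0..1::real} \<subseteq> P \<times> {0..1}" by (auto simp: nbhd_def)
    show "z \<in> nbhd x (radius x) \<times> {0..1}"
      if "z \<in> P \<times> {0..1}" "?q z \<in> ?q ` (nbhd x (radius x) \<times> {0..1})" for z
      using that nbhd_saturated[of "radius x" x "fst z"] by auto
    have "continuous_on (nbhd x (radius x) \<times> {0..1}) (\<lambda>z. q (linepath (fst z) (centre x (fst z)) (snd z)))"
    proof (rule continuous_on_compose2[OF continuous_q])
      have "continuous_on (nbhd x (radius x) \<times> {0..1::real}) (\<lambda>z. centre x (fst z))"
        by (rule continuous_on_compose2[OF continuous_centre continuous_on_fst[OF continuous_on_id]]) auto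
      then show "continuous_on (nbhd x (radius x) \<times> {0..1}) (\<lambda>z. linepath (fst z) (centre x (fst z)) (snd z))"
        unfolding linepath_def by (intro continuous_intros)
      show "(\<lambda>z. linepath (fst z) (centre x (fst z)) (snd z)) ` (nbhd x (radius x) \<times> {0..1}) \<subseteq> P"
      proof (intro image_subsetI)
        fix z :: "'p \<times> real" assume "z \<in> nbhd x (radius x) \<times> {0..1}"
        then have "fst z \<in> P" "centre x (fst z) \<in> P" "snd z \<in> {0..1}"
          using nbhd_iff[of "radius x" x "fst z"] by (auto simp: fibre_def)
        then show "linepath (fst z) (centre x (fst z)) (snd z) \<in> P" by (rule linepath_in_P)
      qed
    qed
    then show "continuous_on (nbhd x (radius x) \<times> {0..1}) (contr x \<circ> ?q)"
      by (rule continuous_on_eq) (use contr_eq in force)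
  qed
  moreover have "?q ` (nbhd x (radius x) \<times> {0..1}) = star x (radius x) \<times> {0..1}"
    by (force simp: star_def)
  ultimately show ?thesis by simp
qed

lemma contr_in_S: "z \<in> star x (radius x) \<times> {0..1} \<Longrightarrow> contr x z \<in> S"
proof -
  assume z: "z \<in> star x (radius x) \<times> {0..1}"
  then obtain w where w: "w \<in> nbhd x (radius x)" "fst z = q w" by (auto simp: star_def)
  then have "w \<in> P" "centre x w \<in> P" using nbhd_iff[of "radius x" x w] by (auto simp: fibre_def)
  then show ?thesis
    using contr_eq[OF w(1), of "snd z"] z w(2) linepath_in_P[of w "centre x w" "snd z"] q_in_S
    by (metis mem_Times_iff prod.collapse)
qed

lemma homotopic_paths_via_centre:
  assumes p: "path p" "path_image p \<subseteq> star x (radius x)"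
    and w: "w \<in> P" "q w = pathstart p" and w': "w' \<in> P" "q w' = pathfinish p"
  shows "homotopic_paths S p
    ((q \<circ> linepath w (centre x w)) +++ (linepath x x +++ (q \<circ> linepath (centre x w') w')))"
proof -
  define Q where "Q = {0..1::real} \<times> {0..1::real}"
  define D where "D z = contr x (p (snd z), fst z)" for z
  have pU: "p t \<in> star x (radius x)" if "t \<in> {0..1}" for t using p that by (auto simp: path_image_def)
  have cont: "continuous_on Q D"
    unfolding D_def
  proof (rule continuous_on_compose2[OF continuous_contr])
    have "continuous_on Q (\<lambda>z. p (snd z))"
      using p(1) unfolding path_def
      by (rule continuous_on_compose2[OF _ continuous_on_snd[OF continuous_on_id]]) (auto simp: Q_def)
    then show "continuous_on Q (\<lambda>z. (p (snd z), fst z))" by (intro continuous_intros)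
  qed (use pU in \<open>auto simp: Q_def\<close>)
  have DS: "D \<in> Q \<rightarrow> S" using contr_in_S pU by (auto simp: D_def Q_def)
  have convQ: "convex Q" unfolding Q_def by (intro convex_Times convex_real_interval)
  have corners: "(0,0) \<in> Q" "(0,1) \<in> Q" "(1,0) \<in> Q" "(1,1) \<in> Q" by (auto simp: Q_def)
  have seg: "path_image (linepath u v) \<subseteq> Q" if "u \<in> Q" "v \<in> Q" for u v
    using convQ that by (simp add: closed_segment_subset)
  have "homotopic_paths Q (linepath (0,0) (0,1))
     (linepath (0,0) (1,0) +++ (linepath (1,0) (1,1) +++ linepath (1,1) (0,1)))"
  proof -
    have "simply_connected Q" using convQ by (rule convex_imp_simply_connected)
    then show ?thesis
      unfolding simply_connected_eq_homotopic_paths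
      using seg[OF corners(1,2)] seg[OF corners(1,3)] seg[OF corners(3,4)] seg[OF corners(4,2)]
      by (simp add: path_image_join del: path_image_linepath)
  qed
  from homotopic_paths_continuous_image[OF this cont DS]
  have *: "homotopic_paths S (D \<circ> linepath (0,0) (0,1)) ((D \<circ> linepath (0,0) (1,0)) +++
     ((D \<circ> linepath (1,0) (1,1)) +++ (D \<circ> linepath (1,1) (0,1))))"
    by (simp add: path_compose_join)
  have path_D: "path (D \<circ> linepath u v)" "path_image (D \<circ> linepath u v) \<subseteq> S" if "u \<in> Q" "v \<in> Q" for u v
    using seg[OF that] cont DS
    by (auto intro!: path_continuous_image continuous_on_subset[OF cont]
        simp: path_image_compose Pi_iff simp del: path_image_linepath)
  have inN: "w \<in> nbhd x (radius x)" "w' \<in> nbhd x (radius x)"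
    using w w' p pathstart_in_path_image[of p] pathfinish_in_path_image[of p]
    by (auto intro!: nbhd_saturated simp: star_def)
  have lin: "linepath a b t = (1 - t) *\<^sub>R a + t *\<^sub>R b" for a b :: "real \<times> real" and t
    by (simp add: linepath_def)
  have "homotopic_paths S p (D \<circ> linepath (0,0) (0,1))"
  proof (rule homotopic_paths_eq)
    show "path_image p \<subseteq> S" using p(2) q_in_S by (auto simp: star_def nbhd_def)
    show "p t = (D \<circ> linepath (0, 0) (0, 1)) t" if t: "t \<in> {0..1}" for t
    proof -
      obtain v where v: "v \<in> nbhd x (radius x)" "p t = q v" using pU[OF t] by (auto simp: star_def)
      then show ?thesis using contr_eq[OF v(1), of 0] by (simp add: D_def lin linepath_def)
    qed
  qed (rule p(1))
  moreover have "homotopic_paths S (D \<circ> linepath (0,0) (1,0)) (q \<circ> linepath w (centre x w))"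
  proof (rule homotopic_paths_eq)
    show "(D \<circ> linepath (0,0) (1,0)) t = (q \<circ> linepath w (centre x w)) t" if "t \<in> {0..1}" for t
      using contr_eq[OF inN(1), of t] that w(2) by (simp add: D_def lin pathstart_def)
  qed (use path_D corners in auto)
  moreover have "homotopic_paths S (D \<circ> linepath (1,0) (1,1)) (linepath x x)"
  proof (rule homotopic_paths_eq)
    show "(D \<circ> linepath (1,0) (1,1)) t = linepath x x t" if t: "t \<in> {0..1}" for t
    proof -
      obtain v where v: "v \<in> nbhd x (radius x)" "p t = q v" using pU[OF t] by (auto simp: star_def)
      moreover have "q (centre x v) = x" using v nbhd_iff[of "radius x" x v] by (simp add: fibre_def)
      ultimately show ?thesis using contr_eq[OF v(1), of 1] by (simp add: D_def lin linepath_def flip: scaleR_left_distrib)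
    qed
  qed (use path_D corners in auto)
  moreover have "homotopic_paths S (D \<circ> linepath (1,1) (0,1)) (q \<circ> linepath (centre x w') w')"
  proof (rule homotopic_paths_eq)
    show "(D \<circ> linepath (1,1) (0,1)) t = (q \<circ> linepath (centre x w') w') t" if "t \<in> {0..1}" for t
      using contr_eq[OF inN(2), of "1 - t"] that w'(2)
      by (simp add: D_def lin pathfinish_def linepath_def add.commute)
  qed (use path_D corners in auto)
  ultimately have "homotopic_paths S ((D \<circ> linepath (0,0) (1,0)) +++
     ((D \<circ> linepath (1,0) (1,1)) +++ (D \<circ> linepath (1,1) (0,1))))
     ((q \<circ> linepath w (centre x w)) +++ (linepath x x +++ (q \<circ> linepath (centre x w') w')))"
    by (intro homotopic_paths_join) (auto simp: pathstart_compose pathfinish_compose)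
  then show ?thesis
    using * \<open>homotopic_paths S p (D \<circ> linepath (0,0) (0,1))\<close> homotopic_paths_trans by blast
qed

end

locale pointed_glued_cell = glued_cell P q S K a0 a1 b0 b1
  for P :: "'p::euclidean_space set" and q :: "'p \<Rightarrow> 'm::real_normed_vector" and S :: "'m set"
    and K :: "'k set" and a0 a1 b0 b1 :: "'k \<Rightarrow> 'p" +
  fixes w0 :: 'p
  assumes w0: "w0 \<in> P"
begin

abbreviation "pi1 \<equiv> fundamental_group S (q w0)"

abbreviation rho :: "'p \<Rightarrow> real \<Rightarrow> 'm" where "rho w \<equiv> q \<circ> linepath w0 w"

sublocale pi1: group pi1
  by (rule group_fundamental_group) (rule q_in_S[OF w0])

definition arrow :: "'p \<Rightarrow> (real \<Rightarrow> 'm) \<Rightarrow> 'p \<Rightarrow> bool" where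
  "arrow w p w' \<longleftrightarrow> w \<in> P \<and> w' \<in> P \<and> path p \<and> path_image p \<subseteq> S \<and> pathstart p = q w \<and> pathfinish p = q w'"

definition conn :: "'p \<Rightarrow> (real \<Rightarrow> 'm) \<Rightarrow> 'p \<Rightarrow> (real \<Rightarrow> 'm) set" where
  "conn w p w' = path_class S (rho w +++ (p +++ reversepath (rho w')))"

lemma rho: "w \<in> P \<Longrightarrow> path (rho w)" "w \<in> P \<Longrightarrow> path_image (rho w) \<subseteq> S"
  "pathstart (rho w) = q w0" "pathfinish (rho w) = q w"
  using path_q_linepath[OF w0] by (auto simp: pathstart_compose pathfinish_compose)

lemma conn_loop: "arrow w p w' \<Longrightarrow> rho w +++ (p +++ reversepath (rho w')) \<in> loops_at S (q w0)"
  unfolding arrow_def loops_at_def mem_Collect_eq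
  by (intro conjI path_join_imp subset_path_image_join) (simp_all add: rho path_join_imp)

lemma conn_carrier: "arrow w p w' \<Longrightarrow> conn w p w' \<in> carrier pi1"
  unfolding conn_def fundamental_group_def using conn_loop by auto

lemma conn_cong: "arrow w p w' \<Longrightarrow> homotopic_paths S p p' \<Longrightarrow> conn w p w' = conn w p' w'"
  unfolding conn_def
  by (subst path_class_eq_iff[OF conn_loop], assumption, intro homotopic_paths_join)
    (auto simp: arrow_def rho homotopic_paths_refl)

lemma arrow_join: "arrow w p w' \<Longrightarrow> arrow w' p' w'' \<Longrightarrow> arrow w (p +++ p') w''"
  by (auto simp: arrow_def path_join_imp subset_path_image_join)

lemma arrow_const: "w \<in> P \<Longrightarrow> w' \<in> P \<Longrightarrow> q w = q w' \<Longrightarrow> arrow w (linepath (q w) (q w)) w'"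
  by (simp add: arrow_def q_in_S)

lemma arrow_segment: "w \<in> P \<Longrightarrow> w' \<in> P \<Longrightarrow> arrow w (q \<circ> linepath w w') w'"
  using path_q_linepath by (simp add: arrow_def)

lemma conn_mult:
  assumes 1: "arrow w p w'" and 2: "arrow w' p' w''"
  shows "conn w p w' \<otimes>\<^bsub>pi1\<^esub> conn w' p' w'' = conn w (p +++ p') w''"
proof -
  define R where "R = p' +++ reversepath (rho w'')"
  let ?h = "homotopic_paths S"
  have P: "w \<in> P" "w' \<in> P" "w'' \<in> P"
    and p: "path p" "path_image p \<subseteq> S" "pathstart p = q w" "pathfinish p = q w'"
    and p': "path p'" "path_image p' \<subseteq> S" "pathstart p' = q w'" "pathfinish p' = q w''"
    using 1 2 by (auto simp: arrow_def)
  have R: "path R" "path_image R \<subseteq> S" "pathstart R = q w'"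
    using p' P by (simp_all add: R_def rho path_join_imp subset_path_image_join)
  note simps = p R P rho p' path_join_imp subset_path_image_join path_image_join
  let ?a = "rho w" and ?b = "rho w'"
  have rr: "path_image (?b) \<subseteq> S" "path_image (?a) \<subseteq> S" using P rho by auto
  have "?h (reversepath ?b +++ (?b +++ R)) ((reversepath ?b +++ ?b) +++ R)"
    by (rule homotopic_paths_assoc) (use rr in \<open>simp_all add: simps\<close>)
  also have "?h \<dots> (linepath (q w') (q w') +++ R)"
    using homotopic_paths_linv[of ?b S]
    by (intro homotopic_paths_join) (use rr in \<open>simp_all add: simps homotopic_paths_refl\<close>)
  also have "?h \<dots> R"
    by (rule homotopic_paths_lid') (use rr in \<open>simp_all add: simps\<close>)
  finally (homotopic_paths_trans) have a: "?h (reversepath ?b +++ (?b +++ R)) R" .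
  have "?h ((p +++ reversepath ?b) +++ (?b +++ R)) (p +++ (reversepath ?b +++ (?b +++ R)))"
    by (rule homotopic_paths_sym, rule homotopic_paths_assoc) (use rr in \<open>simp_all add: simps\<close>)
  also have "?h \<dots> (p +++ R)"
    using a by (intro homotopic_paths_join) (simp_all add: simps homotopic_paths_refl)
  also have "?h \<dots> ((p +++ p') +++ reversepath (rho w''))"
    unfolding R_def by (rule homotopic_paths_assoc) (use rho(2)[of w''] in \<open>simp_all add: simps\<close>)
  finally (homotopic_paths_trans) have b:
    "?h ((p +++ reversepath ?b) +++ (?b +++ R)) ((p +++ p') +++ reversepath (rho w''))" .
  have "?h ((?a +++ (p +++ reversepath ?b)) +++ (?b +++ R)) (?a +++ ((p +++ reversepath ?b) +++ (?b +++ R)))"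
    by (rule homotopic_paths_sym, rule homotopic_paths_assoc) (use rr in \<open>simp_all add: simps\<close>)
  also have "?h \<dots> (?a +++ ((p +++ p') +++ reversepath (rho w'')))"
    by (rule homotopic_paths_join[OF _ b]) (use rr in \<open>simp_all add: simps homotopic_paths_refl\<close>)
  finally (homotopic_paths_trans) show ?thesis
    unfolding conn_def
    by (subst fundamental_group_mult[OF conn_loop[OF 1] conn_loop[OF 2]],
        subst path_class_eq_iff[OF loops_at_join[OF conn_loop[OF 1] conn_loop[OF 2]]])
      (simp add: R_def)
qed

lemma conn_segment:
  assumes "w \<in> P" "w' \<in> P"
  shows "conn w (q \<circ> linepath w w') w' = \<one>\<^bsub>pi1\<^esub>"
proof -
  have seg: "path_image (linepath u v) \<subseteq> P" if "u \<in> P" "v \<in> P" for u v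
    using convex_P that by (simp add: closed_segment_subset)
  have "homotopic_paths P (linepath w0 w +++ (linepath w w' +++ linepath w' w0)) (linepath w0 w0)"
  proof -
    have "simply_connected P" using convex_P by (rule convex_imp_simply_connected)
    then show ?thesis
      unfolding simply_connected_eq_homotopic_paths
      using seg[OF w0 assms(1)] seg[OF assms] seg[OF assms(2) w0] seg[OF w0 w0]
      by (simp add: path_image_join del: path_image_linepath)
  qed
  from homotopic_paths_continuous_image[OF this continuous_q, of S]
  have "homotopic_paths S (rho w +++ ((q \<circ> linepath w w') +++ (q \<circ> linepath w' w0))) (q \<circ> linepath w0 w0)"
    using q_in_S by (simp add: path_compose_join)
  moreover have "reversepath (rho w') = q \<circ> linepath w' w0"
    by (simp add: fun_eq_iff reversepath_def linepath_def algebra_simps)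
  moreover have "q \<circ> linepath w0 w0 = (\<lambda>_. q w0)" by (auto simp: linepath_refl)
  ultimately have "path_class S (rho w +++ ((q \<circ> linepath w w') +++ reversepath (rho w'))) = path_class S (\<lambda>_. q w0)"
    using path_class_eq_iff[OF conn_loop[OF arrow_segment[OF assms]]] by simp
  then show ?thesis by (simp add: conn_def fundamental_group_def)
qed

definition jump :: "'p \<Rightarrow> 'p \<Rightarrow> (real \<Rightarrow> 'm) set" where "jump w w' = conn w (linepath (q w) (q w)) w'"

lemma jump_carrier: "w \<in> P \<Longrightarrow> w' \<in> P \<Longrightarrow> q w = q w' \<Longrightarrow> jump w w' \<in> carrier pi1"
  unfolding jump_def by (intro conn_carrier arrow_const)

lemma jump_conn:
  assumes "arrow w p w'" "v \<in> P" "q v = q w"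
  shows "jump v w \<otimes>\<^bsub>pi1\<^esub> conn w p w' = conn v p w'"
proof -
  have a: "arrow v (linepath (q v) (q v)) w" using assms by (intro arrow_const) (auto simp: arrow_def)
  have h: "homotopic_paths S (linepath (q v) (q v) +++ p) p"
    using assms by (intro homotopic_paths_lid') (auto simp: arrow_def)
  show ?thesis
    unfolding jump_def conn_mult[OF a assms(1)]
    by (rule conn_cong[OF arrow_join[OF a assms(1)] h])
qed

lemma conn_jump:
  assumes "arrow w p w'" "v \<in> P" "q v = q w'"
  shows "conn w p w' \<otimes>\<^bsub>pi1\<^esub> jump w' v = conn w p v"
proof -
  have a: "arrow w' (linepath (q w') (q w')) v" using assms by (intro arrow_const) (auto simp: arrow_def)
  have h: "homotopic_paths S (p +++ linepath (q w') (q w')) p"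
    using assms by (intro homotopic_paths_rid') (auto simp: arrow_def)
  show ?thesis
    unfolding jump_def conn_mult[OF assms(1) a]
    by (rule conn_cong[OF arrow_join[OF assms(1) a] h])
qed

lemma jump_mult:
  assumes "w \<in> P" "w' \<in> P" "w'' \<in> P" "q w = q w'" "q w' = q w''"
  shows "jump w w' \<otimes>\<^bsub>pi1\<^esub> jump w' w'' = jump w w''"
  using jump_conn[OF arrow_const[of w' w''], of w] assms by (simp add: jump_def)

lemma jump_refl: "w \<in> P \<Longrightarrow> jump w w = \<one>\<^bsub>pi1\<^esub>"
proof -
  assume "w \<in> P"
  moreover have "q \<circ> linepath w w = linepath (q w) (q w)" by (auto simp: linepath_refl)
  ultimately show ?thesis using conn_segment[of w w] by (simp add: jump_def)
qed

lemma q_al_be: "k \<in> K \<Longrightarrow> t \<in> {0..1} \<Longrightarrow> q (al k t) = q (be k t)"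
  using q_eq_iff al_be_in_P glI by blast

lemma jump_side:
  assumes k: "k \<in> K" and t: "t \<in> {0..1}"
  shows "jump (al k t) (be k t) = jump (a0 k) (b0 k)"
proof -
  note P = al_be_in_P[OF k t] ends[OF k]
  have q0: "q (a0 k) = q (b0 k)" using q_al_be[OF k, of 0] by (simp add: linepath_0')
  note qt = q_al_be[OF k t]
  let ?p = "q \<circ> linepath (a0 k) (al k t)" and ?p' = "q \<circ> linepath (b0 k) (be k t)"
  have lin: "linepath u (linepath u v t) s = linepath u v (s * t)" for u v :: 'p and s
    by (simp add: linepath_def algebra_simps)
  have eq: "homotopic_paths S ?p' ?p"
  proof (rule homotopic_paths_eq)
    show "?p' s = ?p s" if "s \<in> {0..1}" for s
      using q_al_be[OF k, of "s * t"] that t by (simp add: lin mult_le_one)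
  qed (use P path_q_linepath in auto)
  have a: "arrow (b0 k) ?p' (be k t)" "arrow (a0 k) ?p (al k t)" using P arrow_segment by auto
  have a': "arrow (a0 k) ?p' (be k t)" using a(1) q0 P by (simp add: arrow_def)
  have "jump (a0 k) (b0 k) = jump (a0 k) (b0 k) \<otimes>\<^bsub>pi1\<^esub> conn (b0 k) ?p' (be k t)"
    using P q0 jump_carrier[of "a0 k" "b0 k"] by (simp add: conn_segment)
  also have "\<dots> = conn (a0 k) ?p (be k t)"
    using jump_conn[OF a(1), of "a0 k"] P q0 conn_cong[OF a' eq] by simp
  also have "\<dots> = conn (a0 k) ?p (al k t) \<otimes>\<^bsub>pi1\<^esub> jump (al k t) (be k t)"
    using conn_jump[OF a(2), of "be k t"] P qt by simp
  also have "\<dots> = jump (al k t) (be k t)"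
    using P jump_carrier[of "al k t" "be k t"] qt by (simp add: conn_segment)
  finally show ?thesis by simp
qed

definition gen :: "'k \<Rightarrow> (real \<Rightarrow> 'm) set" where "gen k = jump (a0 k) (b0 k)"

lemma gen_carrier: "k \<in> K \<Longrightarrow> gen k \<in> carrier pi1"
  unfolding gen_def using q_al_be[of k 0] ends[of k] by (intro jump_carrier) (auto simp: linepath_0')

lemma gen_image: "gen ` K \<subseteq> carrier pi1" using gen_carrier by blast

lemma jump_inv: "w \<in> P \<Longrightarrow> w' \<in> P \<Longrightarrow> q w = q w' \<Longrightarrow> jump w' w = inv\<^bsub>pi1\<^esub> jump w w'"
  using jump_mult[of w' w w'] jump_refl[of w'] jump_carrier[of w w'] jump_carrier[of w' w]
  by (metis pi1.inv_equality)

lemma jump_step: "gl y z \<Longrightarrow> jump y z \<in> generate pi1 (gen ` K)"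
  by (induction rule: glue.induct) (auto simp: jump_side simp flip: gen_def intro: generate.incl)

lemma jump_generated: "equivclp gl w w' \<Longrightarrow> w \<in> P \<Longrightarrow> w' \<in> P \<and> jump w w' \<in> generate pi1 (gen ` K)"
proof (induction rule: equivclp_induct)
  case base
  then show ?case by (simp add: jump_refl generate.one)
next
  case (step y z)
  have P: "w \<in> P" "y \<in> P" "z \<in> P" using step gl_in_P by auto
  have "equivclp gl y z" using step(2) by blast
  then have q: "q y = q z" "q w = q y" using q_eq_iff P step(1) by auto
  have "jump y z \<in> generate pi1 (gen ` K)"
    using step(2)
  proof
    assume "gl z y"
    then show ?thesis
      using jump_step[of z y] jump_inv[of z y] P q pi1.generate_m_inv_closed[OF gen_image] by simp
  qed (rule jump_step)
  then show ?case
    using jump_mult[of w y z] generate.eng[of "jump w y" pi1 "gen ` K" "jump y z"] step P q by simp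
qed

lemma arrow_subpath:
  assumes "path p" "path_image p \<subseteq> S" "a \<in> {0..1}" "b \<in> {0..1}" "w \<in> P" "q w = p a" "w' \<in> P" "q w' = p b"
  shows "arrow w (subpath a b p) w'"
  using assms path_image_subpath_subset[of a b p] by (auto simp: arrow_def)

lemma conn_generated:
  assumes p: "arrow w p w'"
  shows "conn w p w' \<in> generate pi1 (gen ` K)"
proof -
  have pp: "path p" "path_image p \<subseteq> S" using p by (auto simp: arrow_def)
  have pS: "p t \<in> S" if "t \<in> {0..1}" for t using pp that by (auto simp: path_image_def)
  define Pr where "Pr a b \<longleftrightarrow> (0 \<le> a \<longrightarrow> b \<le> 1 \<longrightarrow> (\<forall>w\<in>P. \<forall>w'\<in>P. q w = p a \<longrightarrow> q w' = p b \<longrightarrow>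
     conn w (subpath a b p) w' \<in> generate pi1 (gen ` K)))" for a b
  have "(0::real) \<le> 1" by simp
  then have "Pr 0 1"
  proof (induction rule: Bolzano)
    case (trans a b c)
    show ?case
      unfolding Pr_def
    proof (intro impI ballI)
      fix w w' assume h: "0 \<le> a" "c \<le> 1" "w \<in> P" "w' \<in> P" "q w = p a" "q w' = p c"
      have b: "a \<in> {0..1}" "b \<in> {0..1}" "c \<in> {0..1}" using trans h by auto
      obtain v where v: "v \<in> P" "q v = p b" using pS[of b] q_image b by (metis imageE)
      have "conn w (subpath a b p) v \<otimes>\<^bsub>pi1\<^esub> conn v (subpath b c p) w' \<in> generate pi1 (gen ` K)"
        using trans h v b unfolding Pr_def by (intro generate.eng) auto
      also have "conn w (subpath a b p) v \<otimes>\<^bsub>pi1\<^esub> conn v (subpath b c p) w' = conn w (subpath a b p +++ subpath b c p) w'"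
        by (rule conn_mult; rule arrow_subpath) (use pp h v b in auto)
      also have "\<dots> = conn w (subpath a c p) w'"
        by (rule conn_cong[OF arrow_join[of _ _ v]]; (rule arrow_subpath homotopic_join_subpaths1)?)
          (use pp h v b trans in auto)
      finally show "conn w (subpath a c p) w' \<in> generate pi1 (gen ` K)" .
    qed
  next
    case (local s)
    define x where "x = p s"
    have x: "x \<in> S" using pS local by (auto simp: x_def)
    have "openin (top_of_set S) (star x (radius x))" by (rule openin_star) simp
    then obtain V where V: "open V" "star x (radius x) = S \<inter> V" by (auto simp: openin_open)
    have "x \<in> V" using V centre_in_star[OF x radius_pos] by auto
    then obtain e where e: "e > 0" "ball x e \<subseteq> V" using V(1) by (auto simp: open_contains_ball)
    have "continuous_on {0..1} p" using pp by (simp add: path_def)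
    then obtain d where d: "d > 0" "\<And>t. t \<in> {0..1} \<Longrightarrow> dist t s < d \<Longrightarrow> dist (p t) x < e"
      using local e(1) unfolding continuous_on_iff x_def by (meson atLeastAtMost_iff)
    have "Pr a b" if ab: "a \<le> s" "s \<le> b" "b - a < d" for a b
      unfolding Pr_def
    proof (intro impI ballI)
      fix w w' assume h: "0 \<le> a" "b \<le> 1" "w \<in> P" "w' \<in> P" "q w = p a" "q w' = p b"
      have ab': "a \<in> {0..1}" "b \<in> {0..1}" using ab h by auto
      have arr: "arrow w (subpath a b p) w'" by (rule arrow_subpath) (use pp h ab' in auto)
      have sub: "path_image (subpath a b p) \<subseteq> star x (radius x)"
      proof -
        have "path_image (subpath a b p) = p ` {a..b}"
          using ab by (simp add: path_image_subpath)
        moreover have "p t \<in> star x (radius x)" if "t \<in> {a..b}" for t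
        proof -
          have "dist (p t) x < e" using that ab h by (intro d(2)) (auto simp: dist_real_def)
          then show ?thesis using pS[of t] that h V(2) e(2) by (auto simp: dist_commute)
        qed
        ultimately show ?thesis by auto
      qed
      have wN: "w \<in> nbhd x (radius x)" "w' \<in> nbhd x (radius x)"
        using sub h pathstart_in_path_image[of "subpath a b p"] pathfinish_in_path_image[of "subpath a b p"]
        by (auto intro!: nbhd_saturated simp: star_def)
      let ?c = "centre x w" and ?c' = "centre x w'"
      have c: "?c \<in> P" "?c' \<in> P" "q ?c = x" "q ?c' = x"
        using wN nbhd_iff[of "radius x" x] by (auto simp: fibre_def)
      have 1: "arrow w (q \<circ> linepath w ?c) ?c" "arrow ?c (linepath x x) ?c'" "arrow ?c' (q \<circ> linepath ?c' w') w'"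
        using arrow_segment h c arrow_const[of ?c ?c'] by auto
      have "conn w (subpath a b p) w' = conn w ((q \<circ> linepath w ?c) +++ (linepath x x +++ (q \<circ> linepath ?c' w'))) w'"
        by (rule conn_cong[OF arr homotopic_paths_via_centre]) (use arr sub h in \<open>auto simp: arrow_def\<close>)
      also have "\<dots> = \<one>\<^bsub>pi1\<^esub> \<otimes>\<^bsub>pi1\<^esub> (jump ?c ?c' \<otimes>\<^bsub>pi1\<^esub> \<one>\<^bsub>pi1\<^esub>)"
        using conn_mult[OF 1(1) arrow_join[OF 1(2,3)]] conn_mult[OF 1(2,3)] h c
        by (simp add: conn_segment jump_def)
      also have "\<dots> = jump ?c ?c'" using jump_carrier[of ?c ?c'] c by simp
      also have "\<dots> \<in> generate pi1 (gen ` K)"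
        using jump_generated[of ?c ?c'] q_eq_iff[of ?c ?c'] c by simp
      finally show "conn w (subpath a b p) w' \<in> generate pi1 (gen ` K)" .
    qed
    then show ?case using d(1) by blast
  qed
  then show ?thesis using p unfolding Pr_def by (simp add: arrow_def pathstart_def pathfinish_def)
qed

lemma generate_gen: "generate pi1 (gen ` K) = carrier pi1"
proof
  show "generate pi1 (gen ` K) \<subseteq> carrier pi1"
    using pi1.generate_incl[OF gen_image] .
  show "carrier pi1 \<subseteq> generate pi1 (gen ` K)"
  proof
    fix C assume "C \<in> carrier pi1"
    then obtain p where p: "p \<in> loops_at S (q w0)" "C = path_class S p" by (auto simp: fundamental_group_def)
    have arr: "arrow w0 p w0" using p w0 by (auto simp: arrow_def loops_at_def)
    have r: "rho w0 = linepath (q w0) (q w0)" by (auto simp: linepath_refl)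
    have pp: "path p" "path_image p \<subseteq> S" "pathstart p = q w0" "pathfinish p = q w0"
      using arr by (auto simp: arrow_def)
    have "homotopic_paths S (rho w0 +++ (p +++ reversepath (rho w0))) (p +++ reversepath (rho w0))"
      unfolding r by (rule homotopic_paths_lid') (use pp q_in_S[OF w0] in \<open>auto simp: path_join_imp path_image_join\<close>)
    also have "homotopic_paths S \<dots> p"
      unfolding r reversepath_linepath by (rule homotopic_paths_rid') (use pp in auto)
    finally (homotopic_paths_trans) have "conn w0 p w0 = C"
      unfolding conn_def p(2) using path_class_eq_iff[OF conn_loop[OF arr]] by simp
    then show "C \<in> generate pi1 (gen ` K)" using conn_generated[OF arr] by simp
  qed
qed

end

section \<open>Holonomy of labels\<close>

lemma (in group) cancel_middle:
  assumes "x \<in> carrier G" "y \<in> carrier G" "z \<in> carrier G"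
  shows "(x \<otimes> inv y) \<otimes> (y \<otimes> z) = x \<otimes> z"
  using assms by (metis inv_closed m_assoc l_inv l_one m_closed)

locale labelled_glued_cell = pointed_glued_cell P q S K a0 a1 b0 b1 w0 + Q: group Q
  for P :: "'p::euclidean_space set" and q :: "'p \<Rightarrow> 'm::real_normed_vector" and S :: "'m set"
    and K :: "'k set" and a0 a1 b0 b1 :: "'k \<Rightarrow> 'p" and w0 :: 'p
    and Q :: "('g, 'z) monoid_scheme" (structure) +
  fixes s :: "'p \<Rightarrow> 'g" and T :: "'k \<Rightarrow> 'g"
  assumes s_carrier: "\<And>w. w \<in> P \<Longrightarrow> s w \<in> carrier Q"
    and T_carrier: "\<And>k. k \<in> K \<Longrightarrow> T k \<in> carrier Q"
    and label: "\<And>k t. k \<in> K \<Longrightarrow> t \<in> {0..1} \<Longrightarrow> s (be k t) = s (al k t) \<otimes> T k"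
begin

definition dif :: "'p \<Rightarrow> 'p \<Rightarrow> 'g" where "dif w w' = s w \<otimes> inv s w'"

lemma dif_carrier: "w \<in> P \<Longrightarrow> w' \<in> P \<Longrightarrow> dif w w' \<in> carrier Q"
  by (simp add: dif_def s_carrier)

lemma dif_mult: "w \<in> P \<Longrightarrow> w' \<in> P \<Longrightarrow> w'' \<in> P \<Longrightarrow> dif w w' \<otimes> dif w' w'' = dif w w''"
  unfolding dif_def by (rule Q.cancel_middle) (auto simp: s_carrier)

lemma dif_refl: "w \<in> P \<Longrightarrow> dif w w = \<one>"
  by (simp add: dif_def s_carrier)

lemma dif_inv: "w \<in> P \<Longrightarrow> w' \<in> P \<Longrightarrow> inv (dif w w') = dif w' w"
  by (simp add: dif_def s_carrier Q.inv_mult_group)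

lemma glp_dif: "glp v v' \<Longrightarrow> dif (fst v) (snd v) = dif (fst v') (snd v')"
proof (induction rule: glue_pair.induct)
  case (1 k t t')
  have "s (al k t) \<in> carrier Q" "s (al k t') \<in> carrier Q" "T k \<in> carrier Q"
    using 1 al_be_in_P s_carrier T_carrier by auto
  moreover from this have "(s (al k t) \<otimes> T k) \<otimes> inv (s (al k t') \<otimes> T k) = s (al k t) \<otimes> inv (s (al k t'))"
    using Q.cancel_middle[of "s (al k t)" "inv (T k)" "inv (s (al k t'))"] by (simp add: Q.inv_mult_group)
  ultimately show ?case using 1 by (simp add: dif_def label)
qed

lemma equivclp_glp_dif: "equivclp glp v v' \<Longrightarrow> dif (fst v) (snd v) = dif (fst v') (snd v')"
  by (induction rule: equivclp_induct) (auto dest: glp_dif)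

text \<open>
  \<open>s\<close> trivializes the covering discontinuously; \<open>h\<close> is the parallel transport from \<open>y\<close> to \<open>y'\<close> through
  a common nearby point \<open>q w1 = q w2\<close>.
\<close>

definition chain :: "real \<Rightarrow> 'm \<Rightarrow> 'm \<Rightarrow> 'g \<Rightarrow> bool" where
  "chain d y y' h \<longleftrightarrow> (\<exists>w\<in>P. \<exists>w1\<in>P. \<exists>w2\<in>P. \<exists>w'\<in>P. q w = y \<and> q w1 = q w2 \<and> q w' = y' \<and>
     dist w w1 < d \<and> dist w2 w' < d \<and> h = dif w w1 \<otimes> dif w2 w')"

definition local_label :: "'m \<Rightarrow> 'm \<Rightarrow> 'g" where
  "local_label x y = (let w = (SOME w. w \<in> nbhd x (radius x) \<and> q w = y) in dif w (centre x w))"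

lemma local_label_eq:
  assumes "w \<in> nbhd x (radius x)"
  shows "local_label x (q w) = dif w (centre x w)"
proof -
  define w' where "w' = (SOME w'. w' \<in> nbhd x (radius x) \<and> q w' = q w)"
  have w': "w' \<in> nbhd x (radius x) \<and> q w' = q w"
    unfolding w'_def by (rule someI[of _ w]) (use assms in auto)
  then have "equivclp glp (w, centre x w) (w', centre x w')"
    using pair_of_eq[of w x "radius x" w'] assms nbhd_iff[of "radius x" x w'] by auto
  from equivclp_glp_dif[OF this] show ?thesis by (simp add: local_label_def w'_def Let_def)
qed

lemma chain_carrier: "chain d y y' h \<Longrightarrow> h \<in> carrier Q"
  by (auto simp: chain_def dif_carrier)

lemma chain_local:
  assumes "chain d y y' h" "y \<in> star x (radius x / 2)" "y' \<in> star x (radius x / 2)" "d \<le> radius x / 2"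
  shows "local_label x y \<in> carrier Q \<and> local_label x y' \<in> carrier Q \<and> h = local_label x y \<otimes> inv local_label x y'"
proof -
  obtain w w1 w2 w' where P: "w \<in> P" "w1 \<in> P" "w2 \<in> P" "w' \<in> P"
    and q: "q w = y" "q w1 = q w2" "q w' = y'" and d: "dist w w1 < d" "dist w2 w' < d"
    and h: "h = dif w w1 \<otimes> dif w2 w'"
    using assms(1) unfolding chain_def by blast
  have e: "radius x / 2 \<le> radius x" using radius_pos[of x] by simp
  have "w \<in> nbhd x (radius x / 2)" "w' \<in> nbhd x (radius x / 2)"
    using nbhd_saturated[OF e] P q assms(2,3) by (auto simp: star_def)
  then have c: "centre x w \<in> fibre x" "dist w (centre x w) < radius x / 2" "centre x w' \<in> fibre x" "dist w' (centre x w') < radius x / 2"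
    using nbhd_iff[OF e] by auto
  have d1: "dist w1 (centre x w) < radius x"
    using dist_triangle[of w1 "centre x w" w] c(2) d(1) assms(4) by (simp add: dist_commute)
  have d2: "dist w2 (centre x w') < radius x"
    using dist_triangle[of w2 "centre x w'" w'] c(4) d(2) assms(4) by simp
  have c1: "centre x w1 = centre x w" "centre x w2 = centre x w'"
    using centre_eq[OF c(1) d1] centre_eq[OF c(3) d2] by auto
  have nbhd: "w \<in> nbhd x (radius x)" "w1 \<in> nbhd x (radius x)" "w2 \<in> nbhd x (radius x)" "w' \<in> nbhd x (radius x)"
    using P c c1 d1 d2 radius_pos[of x] by (auto simp: nbhd_iff)
  have cP: "centre x w \<in> P" "centre x w' \<in> P" using c by (auto simp: fibre_def)
  have g: "local_label x y = dif w (centre x w)" "local_label x y' = dif w' (centre x w')"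
    using local_label_eq nbhd q by auto
  have eq: "dif w1 (centre x w) = dif w2 (centre x w')"
    using local_label_eq[OF nbhd(2)] local_label_eq[OF nbhd(3)] q(2) c1 by simp
  have "local_label x y \<otimes> inv local_label x y' = (dif w w1 \<otimes> dif w1 (centre x w)) \<otimes> inv (dif w' w2 \<otimes> dif w2 (centre x w'))"
    using P cP by (simp add: g dif_mult)
  also have "\<dots> = (dif w w1 \<otimes> dif w2 (centre x w')) \<otimes> (dif (centre x w') w2 \<otimes> dif w2 w')"
    using P cP by (simp add: eq dif_carrier Q.inv_mult_group dif_inv)
  also have "\<dots> = dif w w1 \<otimes> (dif w2 (centre x w') \<otimes> (dif (centre x w') w2 \<otimes> dif w2 w'))"
    using P cP by (simp add: Q.m_assoc dif_carrier)
  also have "\<dots> = h"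
    using P cP by (simp add: dif_mult h)
  finally show ?thesis using P cP by (simp add: g dif_carrier)
qed

definition fine_scale :: "real \<Rightarrow> real \<Rightarrow> bool" where
  "fine_scale d e \<longleftrightarrow> d > 0 \<and> e > 0 \<and>
     (\<forall>y1\<in>S. \<forall>y2\<in>S. \<forall>y3\<in>S. \<forall>h h' h''. dist y1 y2 < e \<longrightarrow> dist y1 y3 < e \<longrightarrow>
        chain d y1 y2 h \<longrightarrow> chain d y2 y3 h' \<longrightarrow> chain d y1 y3 h'' \<longrightarrow> h \<otimes> h' = h'') \<and>
     (\<forall>y\<in>S. \<forall>y'\<in>S. dist y y' < e \<longrightarrow> (\<exists>h. chain d y y' h))"

lemma chain_exists:
  assumes "d > 0"
  shows "\<exists>e>0. \<forall>y\<in>S. \<forall>y'\<in>S. dist y y' < e \<longrightarrow> (\<exists>h. chain d y y' h)"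
proof -
  define R where "R = (\<Union>z\<in>{z \<in> P \<times> P. q (fst z) = q (snd z)}. ball (fst z) d \<times> ball (snd z) d)"
  have "open R" unfolding R_def by (intro open_UN ballI open_Times open_ball)
  then have comp: "compact (P \<times> P - R)" using compact_P by (intro compact_diff compact_Times)
  have cont: "continuous_on (P \<times> P - R) (\<lambda>z. dist (q (fst z)) (q (snd z)))"
    by (intro continuous_on_dist continuous_on_compose2[OF continuous_q continuous_on_fst[OF continuous_on_id]]
        continuous_on_compose2[OF continuous_q continuous_on_snd[OF continuous_on_id]]) auto
  have "\<exists>e>0. \<forall>z\<in>P \<times> P - R. e \<le> dist (q (fst z)) (q (snd z))"
  proof (cases "P \<times> P - R = {}")
    case False
    then obtain z where z: "z \<in> P \<times> P - R" "\<forall>z'\<in>P \<times> P - R. dist (q (fst z)) (q (snd z)) \<le> dist (q (fst z')) (q (snd z'))"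
      using continuous_attains_inf[OF comp False cont] by blast
    have "q (fst z) \<noteq> q (snd z)"
    proof
      assume "q (fst z) = q (snd z)"
      then have "z \<in> R" unfolding R_def using z(1) assms by (intro UN_I[of z]) (auto simp: mem_Times_iff)
      then show False using z by simp
    qed
    then show ?thesis using z by (intro exI[of _ "dist (q (fst z)) (q (snd z))"]) auto
  next
    case True
    then show ?thesis by (intro exI[of _ 1]) auto
  qed
  then obtain e where e: "e > 0" "\<And>z. z \<in> P \<times> P - R \<Longrightarrow> e \<le> dist (q (fst z)) (q (snd z))" by blast
  have "\<exists>h. chain d y y' h" if y: "y \<in> S" "y' \<in> S" "dist y y' < e" for y y'
  proof -
    obtain w w' where w: "w \<in> P" "w' \<in> P" "q w = y" "q w' = y'" using y q_image by blast
    then have "(w, w') \<in> R" using e(2)[of "(w, w')"] y(3) by force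
    then obtain z where z: "z \<in> P \<times> P" "q (fst z) = q (snd z)" "dist (fst z) w < d" "dist (snd z) w' < d"
      unfolding R_def by auto
    have "chain d y y' (dif w (fst z) \<otimes> dif (snd z) w')"
      unfolding chain_def
      by (intro bexI[of _ w] bexI[of _ "fst z"] bexI[of _ "snd z"] bexI[of _ w'])
        (use w z in \<open>auto simp: dist_commute\<close>)
    then show ?thesis by blast
  qed
  then show ?thesis using e(1) by blast
qed

lemma chain_mult_exists:
  "\<exists>d>0. \<exists>e>0. \<forall>y1\<in>S. \<forall>y2\<in>S. \<forall>y3\<in>S. \<forall>h h' h''. dist y1 y2 < e \<longrightarrow> dist y1 y3 < e \<longrightarrow>
        chain d y1 y2 h \<longrightarrow> chain d y2 y3 h' \<longrightarrow> chain d y1 y3 h'' \<longrightarrow> h \<otimes> h' = h''"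
proof -
  have "\<forall>x. \<exists>V. open V \<and> star x (radius x / 2) = S \<inter> V"
  proof
    fix x
    have "openin (top_of_set S) (star x (radius x / 2))" using radius_pos[of x] by (intro openin_star) simp
    then show "\<exists>V. open V \<and> star x (radius x / 2) = S \<inter> V" by (auto simp: openin_open)
  qed
  then obtain V where V: "\<And>x. open (V x)" "\<And>x. star x (radius x / 2) = S \<inter> V x" by metis
  have xV: "x \<in> V x" if "x \<in> S" for x
    using centre_in_star[OF that, of "radius x / 2"] radius_pos[of x] V(2) by auto
  obtain D where D: "D \<subseteq> S" "finite D" "S \<subseteq> (\<Union>x\<in>D. V x)"
    by (rule compactE_image[OF compact_S, of S V]) (use V xV in auto)
  have "D \<noteq> {}" using D(3) q_in_S[OF w0] by auto
  define d where "d = Min ((\<lambda>x. radius x / 2) ` D)"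
  have d: "d > 0" "\<And>x. x \<in> D \<Longrightarrow> d \<le> radius x / 2"
    unfolding d_def using D(2) \<open>D \<noteq> {}\<close> radius_pos by (simp, intro Min_le) simp_all
  obtain e where e: "e > 0" "\<And>y. y \<in> S \<Longrightarrow> \<exists>B\<in>V ` D. ball y e \<subseteq> B"
    by (rule Heine_Borel_lemma[OF compact_S, of "V ` D"]) (use D V in auto)
  have "h \<otimes> h' = h''"
    if y: "y1 \<in> S" "y2 \<in> S" "y3 \<in> S" "dist y1 y2 < e" "dist y1 y3 < e"
      and c: "chain d y1 y2 h" "chain d y2 y3 h'" "chain d y1 y3 h''" for y1 y2 y3 h h' h''
  proof -
    obtain x where x: "x \<in> D" "ball y1 e \<subseteq> V x" using e(2)[OF y(1)] by blast
    have "y1 \<in> V x" "y2 \<in> V x" "y3 \<in> V x" using x(2) y(4,5) e(1) by auto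
    then have u: "y1 \<in> star x (radius x / 2)" "y2 \<in> star x (radius x / 2)" "y3 \<in> star x (radius x / 2)"
      using V(2) y by auto
    show ?thesis
      using chain_local[OF c(1) u(1,2) d(2)[OF x(1)]] chain_local[OF c(2) u(2,3) d(2)[OF x(1)]]
        chain_local[OF c(3) u(1,3) d(2)[OF x(1)]] Q.cancel_middle[of "local_label x y1" "local_label x y2" "inv (local_label x y3)"]
      by simp
  qed
  then show ?thesis using d(1) e(1) by blast
qed

lemma fine_scale_exists: "\<exists>d e. fine_scale d e"
proof -
  obtain d e where d: "d > 0" "e > 0" "\<forall>y1\<in>S. \<forall>y2\<in>S. \<forall>y3\<in>S. \<forall>h h' h''. dist y1 y2 < e \<longrightarrow> dist y1 y3 < e \<longrightarrow>
        chain d y1 y2 h \<longrightarrow> chain d y2 y3 h' \<longrightarrow> chain d y1 y3 h'' \<longrightarrow> h \<otimes> h' = h''"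
    using chain_mult_exists by blast
  obtain e' where "e' > 0" "\<forall>y\<in>S. \<forall>y'\<in>S. dist y y' < e' \<longrightarrow> (\<exists>h. chain d y y' h)"
    using chain_exists[OF d(1)] by blast
  then have "fine_scale d (min e e')" using d unfolding fine_scale_def by simp
  then show ?thesis by blast
qed

definition delta :: real where "delta = (SOME d. \<exists>e. fine_scale d e)"
definition eta :: real where "eta = (SOME e. fine_scale delta e)"

lemma fine_scale_delta_eta: "fine_scale delta eta"
proof -
  have "\<exists>e. fine_scale delta e" unfolding delta_def by (rule someI_ex[OF fine_scale_exists])
  then show ?thesis unfolding eta_def by (rule someI_ex)
qed

lemma delta_pos: "delta > 0" and eta_pos: "eta > 0"
  using fine_scale_delta_eta by (auto simp: fine_scale_def)

definition coc :: "'m \<Rightarrow> 'm \<Rightarrow> 'g" where "coc y y' = (SOME h. chain delta y y' h)"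

lemma coc_chain: "y \<in> S \<Longrightarrow> y' \<in> S \<Longrightarrow> dist y y' < eta \<Longrightarrow> chain delta y y' (coc y y')"
proof -
  assume "y \<in> S" "y' \<in> S" "dist y y' < eta"
  then have "\<exists>h. chain delta y y' h"
    using fine_scale_delta_eta[unfolded fine_scale_def] by blast
  then show ?thesis unfolding coc_def by (rule someI_ex)
qed

lemma coc_carrier: "y \<in> S \<Longrightarrow> y' \<in> S \<Longrightarrow> dist y y' < eta \<Longrightarrow> coc y y' \<in> carrier Q"
  using coc_chain chain_carrier by blast

lemma chain_mult:
  assumes "y1 \<in> S" "y2 \<in> S" "y3 \<in> S" "dist y1 y2 < eta" "dist y1 y3 < eta"
    "chain delta y1 y2 h" "chain delta y2 y3 h'" "chain delta y1 y3 h''"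
  shows "h \<otimes> h' = h''"
  using fine_scale_delta_eta assms unfolding fine_scale_def by blast

lemma coc_mult:
  assumes "y1 \<in> S" "y2 \<in> S" "y3 \<in> S" "dist y1 y2 < eta" "dist y1 y3 < eta" "dist y2 y3 < eta"
  shows "coc y1 y2 \<otimes> coc y2 y3 = coc y1 y3"
  using assms chain_mult[OF assms(1-5)] coc_chain by blast

lemma coc_refl: "y \<in> S \<Longrightarrow> coc y y = \<one>"
  using coc_mult[of y y y] eta_pos coc_carrier[of y y] by (simp add: Q.l_cancel_one)

lemma coc_q:
  assumes "w \<in> P" "w' \<in> P" "dist w w' < delta" "dist (q w) (q w') < eta"
  shows "coc (q w) (q w') = dif w w'"
proof -
  have S: "q w \<in> S" "q w' \<in> S" using assms q_in_S by auto
  have "chain delta (q w) (q w') (dif w w' \<otimes> dif w' w')"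
    unfolding chain_def
    by (intro bexI[of _ w] bexI[of _ w']) (use assms delta_pos in auto)
  then have 1: "chain delta (q w) (q w') (dif w w')" using assms by (simp add: dif_mult)
  have "chain delta (q w') (q w') (coc (q w') (q w'))" using S eta_pos by (intro coc_chain) auto
  then have 2: "chain delta (q w') (q w') \<one>" using S by (simp add: coc_refl)
  show ?thesis
    using chain_mult[OF S S(2) assms(4,4) coc_chain[OF S assms(4)] 2 1] coc_carrier[OF S assms(4)] by simp
qed

primrec walk :: "(nat \<Rightarrow> 'm) \<Rightarrow> nat \<Rightarrow> 'g" where
  "walk f 0 = \<one>"
| "walk f (Suc m) = walk f m \<otimes> coc (f m) (f (Suc m))"

lemma walk_cong: "(\<And>k. k \<le> m \<Longrightarrow> f k = f' k) \<Longrightarrow> walk f m = walk f' m"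
  by (induction m) simp_all

lemma walk_carrier:
  "(\<And>k. k \<le> m \<Longrightarrow> f k \<in> S) \<Longrightarrow> (\<And>k. k < m \<Longrightarrow> dist (f k) (f (Suc k)) < eta) \<Longrightarrow> walk f m \<in> carrier Q"
  by (induction m) (simp_all add: coc_carrier)

lemma walk_add:
  assumes "\<And>k. k \<le> m + n \<Longrightarrow> f k \<in> S" "\<And>k. k < m + n \<Longrightarrow> dist (f k) (f (Suc k)) < eta"
  shows "walk f (m + n) = walk f m \<otimes> walk (\<lambda>k. f (m + k)) n"
  using assms
proof (induction n)
  case 0
  then show ?case by (simp add: walk_carrier)
next
  case (Suc n)
  have c: "walk f m \<in> carrier Q" "walk (\<lambda>k. f (m + k)) n \<in> carrier Q" "coc (f (m + n)) (f (Suc (m + n))) \<in> carrier Q"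
    using Suc.prems by (auto intro!: walk_carrier coc_carrier)
  show ?case using Suc c by (simp add: Q.m_assoc)
qed

lemma walk_short:
  assumes "\<And>k. k \<le> m \<Longrightarrow> f k \<in> S" "\<And>i j. i \<le> m \<Longrightarrow> j \<le> m \<Longrightarrow> dist (f i) (f j) < eta"
  shows "walk f m = coc (f 0) (f m)"
  using assms
proof (induction m)
  case 0
  then show ?case by (simp add: coc_refl)
next
  case (Suc m)
  then show ?case by (simp add: coc_mult)
qed

lemma walk_refine:
  assumes "\<And>k. k \<le> m * n \<Longrightarrow> f k \<in> S"
    and "\<And>j i i'. j < m \<Longrightarrow> i \<le> n \<Longrightarrow> i' \<le> n \<Longrightarrow> dist (f (j * n + i)) (f (j * n + i')) < eta"
    and "\<And>k. k < m * n \<Longrightarrow> dist (f k) (f (Suc k)) < eta"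
  shows "walk f (m * n) = walk (\<lambda>j. f (j * n)) m"
  using assms
proof (induction m)
  case (Suc m)
  have "walk f (m * n + n) = walk f (m * n) \<otimes> walk (\<lambda>k. f (m * n + k)) n"
    by (rule walk_add) (use Suc.prems in \<open>auto simp: add.commute\<close>)
  also have "walk f (m * n) = walk (\<lambda>j. f (j * n)) m"
    using Suc by simp
  also have "walk (\<lambda>k. f (m * n + k)) n = coc (f (m * n)) (f (m * n + n))"
    by (subst walk_short) (use Suc.prems in \<open>auto simp: add.commute\<close>)
  finally show ?case by (simp add: add.commute)
qed simp

lemma walk_ladder:
  assumes "\<And>k. k \<le> m \<Longrightarrow> f k \<in> S \<and> f' k \<in> S \<and> dist (f k) (f' k) < eta"
    and "\<And>k. k < m \<Longrightarrow> dist (f k) (f (Suc k)) < eta \<and> dist (f' k) (f' (Suc k)) < eta \<and> dist (f k) (f' (Suc k)) < eta"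
  shows "walk f m \<otimes> coc (f m) (f' m) = coc (f 0) (f' 0) \<otimes> walk f' m"
  using assms
proof (induction m)
  case 0
  then show ?case by (simp add: coc_carrier)
next
  case (Suc m)
  have c: "walk f m \<in> carrier Q" "walk f' m \<in> carrier Q" "coc (f m) (f (Suc m)) \<in> carrier Q"
    "coc (f (Suc m)) (f' (Suc m)) \<in> carrier Q" "coc (f m) (f' m) \<in> carrier Q" "coc (f 0) (f' 0) \<in> carrier Q"
    "coc (f' m) (f' (Suc m)) \<in> carrier Q"
    using Suc.prems by (auto intro!: walk_carrier coc_carrier)
  have "walk f (Suc m) \<otimes> coc (f (Suc m)) (f' (Suc m)) =
      walk f m \<otimes> (coc (f m) (f (Suc m)) \<otimes> coc (f (Suc m)) (f' (Suc m)))"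
    using c by (simp add: Q.m_assoc)
  also have "\<dots> = walk f m \<otimes> (coc (f m) (f' m) \<otimes> coc (f' m) (f' (Suc m)))"
    using Suc.prems by (simp add: coc_mult)
  also have "\<dots> = (walk f m \<otimes> coc (f m) (f' m)) \<otimes> coc (f' m) (f' (Suc m))"
    using c by (simp add: Q.m_assoc)
  also have "\<dots> = coc (f 0) (f' 0) \<otimes> walk f' (Suc m)"
    using c Suc by (simp add: Q.m_assoc)
  finally show ?case .
qed

definition mesh :: "(real \<Rightarrow> 'm) \<Rightarrow> nat \<Rightarrow> bool" where
  "mesh p m \<longleftrightarrow> m > 0 \<and> (\<forall>t\<in>{0..1}. \<forall>t'\<in>{0..1}. \<bar>t - t'\<bar> \<le> 1 / real m \<longrightarrow> dist (p t) (p t') < eta)"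

definition mhol :: "(real \<Rightarrow> 'm) \<Rightarrow> nat \<Rightarrow> 'g" where
  "mhol p m = walk (\<lambda>k. p (real k / real m)) m"

definition hol :: "(real \<Rightarrow> 'm) \<Rightarrow> 'g" where "hol p = mhol p (SOME m. mesh p m)"

lemma mesh_mono: "mesh p m \<Longrightarrow> m \<le> n \<Longrightarrow> mesh p n"
proof -
  assume m: "mesh p m" "m \<le> n"
  then have "1 / real n \<le> 1 / real m" by (auto simp: mesh_def frac_le)
  then show ?thesis using m unfolding mesh_def by force
qed

lemma mesh_exists:
  assumes "path p"
  shows "\<exists>m. mesh p m"
proof -
  have "uniformly_continuous_on {0..1} p"
    using assms by (intro compact_uniformly_continuous) (auto simp: path_def)
  then obtain d where d: "d > 0" "\<And>t t'. t \<in> {0..1} \<Longrightarrow> t' \<in> {0..1} \<Longrightarrow> dist t' t < d \<Longrightarrow> dist (p t') (p t) < eta"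
    using eta_pos unfolding uniformly_continuous_on_def by metis
  obtain m :: nat where m: "m > 0" "1 / real m < d"
    using reals_Archimedean[OF d(1)] by (metis inverse_eq_divide zero_less_Suc)
  then have "mesh p m" unfolding mesh_def using d(2) by (auto simp: dist_real_def)
  then show ?thesis ..
qed

lemma mhol_refine:
  assumes p: "p ` {0..1} \<subseteq> S" and m: "mesh p m" and n: "n > 0"
  shows "mhol p (m * n) = mhol p m"
proof -
  have m0: "m > 0" using m by (simp add: mesh_def)
  have mn: "mesh p (m * n)" using mesh_mono[OF m] n by simp
  have I: "real k / real (m * n) \<in> {0..1}" if "k \<le> m * n" for k
    using that m0 n by (auto simp: divide_le_eq_1 simp flip: of_nat_mult)
  have "walk (\<lambda>k. p (real k / real (m * n))) (m * n) = walk (\<lambda>j. p (real (j * n) / real (m * n))) m"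
  proof (rule walk_refine)
    show "p (real k / real (m * n)) \<in> S" if "k \<le> m * n" for k using p I[OF that] by blast
    show "dist (p (real k / real (m * n))) (p (real (Suc k) / real (m * n))) < eta" if "k < m * n" for k
      using mn I[of k] I[of "Suc k"] that unfolding mesh_def
      by (auto simp: abs_le_iff simp flip: diff_divide_distrib)
    show "dist (p (real (j * n + i) / real (m * n))) (p (real (j * n + i') / real (m * n))) < eta"
      if "j < m" "i \<le> n" "i' \<le> n" for j i i'
    proof -
      have jn: "Suc j * n \<le> m * n" using that(1) by (intro mult_right_mono) auto
      have b: "j * n + i \<le> m * n" "j * n + i' \<le> m * n" using that jn by auto
      have "\<bar>real i - real i'\<bar> \<le> real n" using that by auto
      then have "\<bar>real i - real i'\<bar> / real (m * n) \<le> real n / real (m * n)"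
        by (intro divide_right_mono) auto
      then have "\<bar>real (j * n + i) / real (m * n) - real (j * n + i') / real (m * n)\<bar> \<le> 1 / real m"
        using n by (simp add: abs_divide flip: diff_divide_distrib)
      then show ?thesis using m I[OF b(1)] I[OF b(2)] unfolding mesh_def by blast
    qed
  qed
  then show ?thesis using n by (simp add: mhol_def)
qed

lemma hol_eq:
  assumes "p ` {0..1} \<subseteq> S" "mesh p m"
  shows "hol p = mhol p m"
proof -
  define n where "n = (SOME m. mesh p m)"
  have n: "mesh p n" unfolding n_def by (rule someI[of "mesh p", OF assms(2)])
  have "m > 0" "n > 0" using n assms(2) by (auto simp: mesh_def)
  then show ?thesis
    using mhol_refine[OF assms, of n] mhol_refine[OF assms(1) n, of m]
    by (simp add: hol_def n_def[symmetric] mult.commute)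
qed

lemma path_S: "path_image p \<subseteq> S \<longleftrightarrow> p ` {0..1} \<subseteq> S" by (simp add: path_image_def)

lemma mhol_carrier:
  assumes "p ` {0..1} \<subseteq> S" "mesh p m"
  shows "mhol p m \<in> carrier Q"
proof -
  have m: "m > 0" using assms by (simp add: mesh_def)
  have I: "real k / real m \<in> {0..1}" if "k \<le> m" for k using that m by auto
  show ?thesis
    unfolding mhol_def
  proof (rule walk_carrier)
    show "p (real k / real m) \<in> S" if "k \<le> m" for k using assms(1) I[OF that] by blast
    show "dist (p (real k / real m)) (p (real (Suc k) / real m)) < eta" if "k < m" for k
      using assms(2) I[of k] I[of "Suc k"] that unfolding mesh_def
      by (auto simp: abs_le_iff simp flip: diff_divide_distrib)
  qed
qed

lemma hol_carrier: "path p \<Longrightarrow> path_image p \<subseteq> S \<Longrightarrow> hol p \<in> carrier Q"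
proof -
  assume p: "path p" "path_image p \<subseteq> S"
  obtain m where "mesh p m" using mesh_exists[OF p(1)] ..
  then show ?thesis using hol_eq[of p m] mhol_carrier[of p m] p(2) by (simp add: path_S)
qed

lemma hol_join:
  assumes p: "path p" "path_image p \<subseteq> S" and p': "path p'" "path_image p' \<subseteq> S"
    and fin: "pathfinish p = pathstart p'"
  shows "hol (p +++ p') = hol p \<otimes> hol p'"
proof -
  have j: "path (p +++ p')" "path_image (p +++ p') \<subseteq> S"
    using assms by (simp_all add: path_join_imp subset_path_image_join)
  obtain m1 where "mesh p m1" using mesh_exists[OF p(1)] ..
  obtain m2 where "mesh p' m2" using mesh_exists[OF p'(1)] ..
  obtain m3 where "mesh (p +++ p') m3" using mesh_exists[OF j(1)] ..
  define m where "m = max m1 (max m2 m3)"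
  have m: "mesh p m" "mesh p' m" "mesh (p +++ p') (m + m)"
    using mesh_mono[OF \<open>mesh p m1\<close>] mesh_mono[OF \<open>mesh p' m2\<close>] mesh_mono[OF \<open>mesh (p +++ p') m3\<close>]
    by (auto simp: m_def)
  have m0: "m > 0" using m by (simp add: mesh_def)
  let ?f = "\<lambda>k. (p +++ p') (real k / real (m + m))"
  have I: "real k / real (m + m) \<in> {0..1}" if "k \<le> m + m" for k using that m0 by auto
  have "walk ?f (m + m) = walk ?f m \<otimes> walk (\<lambda>k. ?f (m + k)) m"
  proof (rule walk_add)
    show "?f k \<in> S" if "k \<le> m + m" for k using j(2) I[OF that] unfolding path_S by blast
    show "dist (?f k) (?f (Suc k)) < eta" if "k < m + m" for k
      using m(3) I[of k] I[of "Suc k"] that unfolding mesh_def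
      by (auto simp: abs_le_iff simp flip: diff_divide_distrib)
  qed
  also have "walk ?f m = walk (\<lambda>k. p (real k / real m)) m"
  proof (rule walk_cong)
    fix k assume "k \<le> m"
    then have "real k / real m \<le> 1" using m0 by simp
    moreover have "2 * (real k / real (m + m)) = real k / real m" using m0 by (simp add: field_simps)
    ultimately have "real k / real (m + m) \<le> 1/2" "2 * (real k / real (m + m)) = real k / real m" by linarith+
    then show "?f k = p (real k / real m)" by (simp add: joinpaths_def)
  qed
  also have "walk (\<lambda>k. ?f (m + k)) m = walk (\<lambda>k. p' (real k / real m)) m"
  proof (rule walk_cong)
    fix k assume "k \<le> m"
    have e: "2 * (real (m + k) / real (m + m)) - 1 = real k / real m"
      using m0 by (auto simp: field_simps)
    show "?f (m + k) = p' (real k / real m)"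
    proof (cases "k = 0")
      case True
      then have h: "real (m + k) / real (m + m) = 1/2" using m0 by (simp add: field_simps)
      show ?thesis unfolding h using fin True by (simp add: joinpaths_def pathstart_def pathfinish_def)
    next
      case False
      then have "\<not> real (m + k) / real (m + m) \<le> 1/2" using m0 by (simp add: field_simps)
      then show ?thesis using e by (simp add: joinpaths_def)
    qed
  qed
  finally show ?thesis
    using hol_eq m p p' j path_S by (simp add: mhol_def)
qed

lemma hol_homotopic:
  assumes "homotopic_paths S p p'"
  shows "hol p = hol p'"
proof -
  obtain H :: "real \<times> real \<Rightarrow> 'm" where H: "continuous_on ({0..1} \<times> {0..1}) H" "H \<in> ({0..1} \<times> {0..1}) \<rightarrow> S"
    and H0: "\<And>t. t \<in> {0..1} \<Longrightarrow> H (0, t) = p t" and H1: "\<And>t. t \<in> {0..1} \<Longrightarrow> H (1, t) = p' t"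
    and Hs: "\<And>r. r \<in> {0..1} \<Longrightarrow> H (r, 0) = p 0" and Hf: "\<And>r. r \<in> {0..1} \<Longrightarrow> H (r, 1) = p 1"
  proof -
    from assms obtain H where "continuous_on ({0..1} \<times> {0..1}) H" "H \<in> ({0..1} \<times> {0..1}) \<rightarrow> S"
      "\<forall>t\<in>{0..1}. H (0::real, t) = p t" "\<forall>t\<in>{0..1}. H (1, t) = p' t"
      and "\<forall>r\<in>{0..1::real}. pathstart (H \<circ> Pair r) = pathstart p \<and> pathfinish (H \<circ> Pair r) = pathfinish p"
      unfolding homotopic_paths by blast
    then show ?thesis by (intro that[of H]) (simp_all add: pathstart_def pathfinish_def)
  qed
  have "uniformly_continuous_on ({0..1} \<times> {0..1}) H"
    by (intro compact_uniformly_continuous H compact_Times) auto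
  then obtain d where d: "d > 0" "\<And>z z'. z \<in> {0..1} \<times> {0..1} \<Longrightarrow> z' \<in> {0..1} \<times> {0..1} \<Longrightarrow>
      dist z' z < d \<Longrightarrow> dist (H z') (H z) < eta"
    using eta_pos unfolding uniformly_continuous_on_def by metis
  obtain m :: nat where m: "m > 0" "1 / real m < d / 2"
    using reals_Archimedean[of "d / 2"] d(1) by (metis half_gt_zero inverse_eq_divide zero_less_Suc)
  have close: "dist (H (a, b)) (H (a', b')) < eta"
    if "a \<in> {0..1}" "b \<in> {0..1}" "a' \<in> {0..1}" "b' \<in> {0..1}" "\<bar>a - a'\<bar> \<le> 1 / real m" "\<bar>b - b'\<bar> \<le> 1 / real m"
    for a b a' b'
  proof (rule d(2))
    have "dist (a, b) (a', b') \<le> \<bar>a - a'\<bar> + \<bar>b - b'\<bar>"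
      unfolding dist_Pair_Pair dist_real_def using sqrt_sum_squares_le_sum_abs[of "\<bar>a - a'\<bar>" "\<bar>b - b'\<bar>"] by simp
    then show "dist (a, b) (a', b') < d" using that m by simp
  qed (use that in auto)
  have I: "real k / real m \<in> {0..1}" if "k \<le> m" for k using that m by auto
  have step: "\<bar>real (Suc k) / real m - real k / real m\<bar> \<le> 1 / real m"
    "\<bar>real k / real m - real (Suc k) / real m\<bar> \<le> 1 / real m" for k
    by (auto simp: abs_divide simp flip: diff_divide_distrib)
  let ?w = "\<lambda>j. walk (\<lambda>k. H (real j / real m, real k / real m)) m"
  have HS: "H (a, b) \<in> S" if "a \<in> {0..1}" "b \<in> {0..1}" for a b using H(2) that by auto
  have "?w j = ?w (Suc j)" if j: "j < m" for j
  proof -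
    let ?f = "\<lambda>k. H (real j / real m, real k / real m)"
    let ?f' = "\<lambda>k. H (real (Suc j) / real m, real k / real m)"
    note Ij = I[of j] I[of "Suc j"]
    have "walk ?f m \<otimes> coc (?f m) (?f' m) = coc (?f 0) (?f' 0) \<otimes> walk ?f' m"
      by (rule walk_ladder) (use Ij j I step in \<open>auto intro!: close HS simp del: of_nat_Suc\<close>)
    moreover have "?f m = p 1" "?f' m = p 1" "?f 0 = p 0" "?f' 0 = p 0"
      using Ij j Hs Hf m by simp_all
    moreover have "p 0 \<in> S" "p 1 \<in> S" using HS[of 0 0] HS[of 0 1] H0 by auto
    moreover have "walk ?f m \<in> carrier Q" "walk ?f' m \<in> carrier Q"
      by (rule walk_carrier; use Ij j I step in \<open>auto intro!: close HS simp del: of_nat_Suc\<close>)+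
    ultimately show ?thesis by (simp add: coc_refl)
  qed
  then have all: "?w 0 = ?w j" if "j \<le> m" for j
    using that by (induction j) (simp_all add: Suc_le_eq)
  have "?w 0 = ?w m" by (rule all) simp
  moreover have "?w 0 = mhol p m" "?w m = mhol p' m"
    unfolding mhol_def using I m by (auto intro!: walk_cong simp: H0 H1)
  moreover have "mesh p m"
    unfolding mesh_def using close[of 0 _ 0] m H0 by simp
  moreover have "mesh p' m"
    unfolding mesh_def using close[of 1 _ 1] m H1 by simp
  ultimately show ?thesis
    using homotopic_paths_imp_subset[OF assms] hol_eq path_S by metis
qed

lemma hol_segment:
  assumes "w \<in> P" "w' \<in> P"
  shows "hol (q \<circ> linepath w w') = dif w w'"
proof -
  let ?p = "q \<circ> linepath w w'"
  obtain m1 where m1: "mesh ?p m1" using mesh_exists path_q_linepath(1)[OF assms] by blast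
  obtain m2 :: nat where m2: "dist w w' / delta < real m2" using reals_Archimedean2 by blast
  define m where "m = max m1 m2"
  have m: "mesh ?p m" "m > 0" using mesh_mono[OF m1, of m] by (auto simp: m_def mesh_def)
  have "dist w w' / delta < real m" using m2 by (simp add: m_def less_max_iff_disj)
  then have small: "dist w w' / real m < delta" using delta_pos m(2) by (simp add: field_simps)
  let ?l = "\<lambda>k. linepath w w' (real k / real m)"
  have I: "real k / real m \<in> {0..1}" if "k \<le> m" for k using that m by auto
  have lP: "?l k \<in> P" if "k \<le> m" for k using linepath_in_P assms I[OF that] by blast
  have "walk (\<lambda>k. q (?l k)) k = dif w (?l k)" if "k \<le> m" for k
    using that
  proof (induction k)
    case 0
    then show ?case using assms by (simp add: dif_refl linepath_0')
  next
    case (Suc k)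
    have "dist (?l k) (?l (Suc k)) < delta"
      using small by (simp add: dist_linepath abs_divide flip: diff_divide_distrib)
    moreover have "dist (q (?l k)) (q (?l (Suc k))) < eta"
      using m(1) I[of k] I[of "Suc k"] Suc.prems unfolding mesh_def
      by (auto simp: abs_le_iff simp flip: diff_divide_distrib)
    ultimately have "coc (q (?l k)) (q (?l (Suc k))) = dif (?l k) (?l (Suc k))"
      using lP[of k] lP[of "Suc k"] Suc.prems by (intro coc_q) auto
    then show ?case using Suc lP[of k] lP[of "Suc k"] assms by (simp add: dif_mult)
  qed
  from this[of m] have "mhol ?p m = dif w w'" using m(2) by (simp add: mhol_def linepath_1')
  then show ?thesis using hol_eq[OF _ m(1)] path_q_linepath(2)[OF assms] path_S by simp
qed

definition hom_of_loop :: "(real \<Rightarrow> 'm) set \<Rightarrow> 'g" where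
  "hom_of_loop C = inv s w0 \<otimes> hol (SOME p. p \<in> C) \<otimes> s w0"

lemma hom_of_loop_eq:
  assumes "p \<in> loops_at S (q w0)"
  shows "hom_of_loop (path_class S p) = inv s w0 \<otimes> hol p \<otimes> s w0"
proof -
  have "\<exists>p'. p' \<in> path_class S p"
    using assms by (intro exI[of _ p]) (simp add: mem_path_class loops_at_def)
  then have "homotopic_paths S p (SOME p'. p' \<in> path_class S p)"
    by (metis mem_path_class someI_ex)
  then show ?thesis using hol_homotopic by (simp add: hom_of_loop_def)
qed

lemma hom_of_loop_hom: "hom_of_loop \<in> hom pi1 Q"
proof (rule homI)
  have c: "s w0 \<in> carrier Q" using s_carrier w0 by simp
  have hc: "hol p \<in> carrier Q" if "p \<in> loops_at S (q w0)" for p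
    using that hol_carrier by (auto simp: loops_at_def)
  show "hom_of_loop C \<in> carrier Q" if "C \<in> carrier pi1" for C
    using that c hc by (auto simp: fundamental_group_def hom_of_loop_eq)
  show "hom_of_loop (C \<otimes>\<^bsub>pi1\<^esub> D) = hom_of_loop C \<otimes> hom_of_loop D"
    if CD: "C \<in> carrier pi1" "D \<in> carrier pi1" for C D
  proof -
    obtain p p' where p: "p \<in> loops_at S (q w0)" "p' \<in> loops_at S (q w0)" "C = path_class S p" "D = path_class S p'"
      using CD by (auto simp: fundamental_group_def)
    have "hol (p +++ p') = hol p \<otimes> hol p'" using p(1,2) by (intro hol_join) (auto simp: loops_at_def)
    moreover have "(inv s w0 \<otimes> hol p \<otimes> s w0) \<otimes> (inv s w0 \<otimes> hol p' \<otimes> s w0) = inv s w0 \<otimes> (hol p \<otimes> hol p') \<otimes> s w0"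
      using c hc[OF p(1)] hc[OF p(2)] Q.cancel_middle[of "inv s w0 \<otimes> hol p" "inv s w0" "hol p' \<otimes> s w0"]
      by (simp add: Q.m_assoc)
    ultimately show ?thesis
      using p by (simp add: fundamental_group_mult hom_of_loop_eq loops_at_join)
  qed
qed

lemma hom_of_loop_gen: "k \<in> K \<Longrightarrow> hom_of_loop (gen k) = T k"
proof -
  assume k: "k \<in> K"
  note P = ends[OF k]
  have qq: "q (a0 k) = q (b0 k)" using q_al_be[OF k, of 0] by (simp add: linepath_0')
  have c: "s w0 \<in> carrier Q" "s (a0 k) \<in> carrier Q" "s (b0 k) \<in> carrier Q" using s_carrier w0 P by auto
  have const: "linepath (q (a0 k)) (q (a0 k)) = q \<circ> linepath (a0 k) (a0 k)" by (auto simp: linepath_refl)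
  have rev: "reversepath (rho (b0 k)) = q \<circ> linepath (b0 k) w0"
    by (simp add: fun_eq_iff reversepath_def linepath_def algebra_simps)
  note seg = path_q_linepath
  have pp: "path ((q \<circ> linepath (a0 k) (a0 k)) +++ (q \<circ> linepath (b0 k) w0))"
    "path_image ((q \<circ> linepath (a0 k) (a0 k)) +++ (q \<circ> linepath (b0 k) w0)) \<subseteq> S"
    using P w0 seg qq by (simp_all add: path_join_imp subset_path_image_join)
  have "hol (rho (a0 k) +++ ((q \<circ> linepath (a0 k) (a0 k)) +++ (q \<circ> linepath (b0 k) w0))) =
      dif w0 (a0 k) \<otimes> (dif (a0 k) (a0 k) \<otimes> dif (b0 k) w0)"
    using P w0 seg qq pp by (simp add: hol_join hol_segment)
  moreover have "gen k = path_class S (rho (a0 k) +++ ((q \<circ> linepath (a0 k) (a0 k)) +++ (q \<circ> linepath (b0 k) w0)))"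
    by (simp only: gen_def jump_def conn_def const rev)
  moreover have "rho (a0 k) +++ ((q \<circ> linepath (a0 k) (a0 k)) +++ (q \<circ> linepath (b0 k) w0)) \<in> loops_at S (q w0)"
    using conn_loop[OF arrow_const[of "a0 k" "b0 k"]] P qq unfolding const rev by simp
  moreover have "inv s w0 \<otimes> (dif w0 (a0 k) \<otimes> (dif (a0 k) (a0 k) \<otimes> dif (b0 k) w0)) \<otimes> s w0 = inv s (a0 k) \<otimes> s (b0 k)"
  proof -
    have "inv s w0 \<otimes> dif w0 (a0 k) = inv s (a0 k)"
      unfolding dif_def using c Q.m_assoc[of "inv s w0" "s w0" "inv s (a0 k)"] by simp
    moreover have "dif (b0 k) w0 \<otimes> s w0 = s (b0 k)"
      unfolding dif_def using c by (simp add: Q.m_assoc)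
    ultimately show ?thesis using c P w0 by (simp add: dif_refl dif_carrier Q.m_assoc flip: Q.m_assoc[of "inv s w0"])
  qed
  moreover have "inv s (a0 k) \<otimes> s (b0 k) = T k"
    using label[OF k, of 0] c T_carrier[OF k] Q.m_assoc[of "inv s (a0 k)" "s (a0 k)" "T k"]
    by (simp add: linepath_0')
  ultimately show ?thesis by (simp add: hom_of_loop_eq)
qed

lemma labelled_hom: "\<exists>h\<in>hom pi1 Q. \<forall>k\<in>K. h (gen k) = T k"
  using hom_of_loop_hom hom_of_loop_gen by blast

end

section \<open>The presentation of a surface group\<close>

primrec surface_word :: "('g, 'z) monoid_scheme \<Rightarrow> (nat \<Rightarrow> 'g) \<Rightarrow> (nat \<Rightarrow> 'g) \<Rightarrow> nat \<Rightarrow> 'g" where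
  "surface_word G u v 0 = \<one>\<^bsub>G\<^esub>"
| "surface_word G u v (Suc j) = surface_word G u v j \<otimes>\<^bsub>G\<^esub>
     (u j \<otimes>\<^bsub>G\<^esub> inv\<^bsub>G\<^esub> v j \<otimes>\<^bsub>G\<^esub> inv\<^bsub>G\<^esub> u j \<otimes>\<^bsub>G\<^esub> v j)"

lemma (in group) surface_word_closed:
  "(\<And>j. j < n \<Longrightarrow> u j \<in> carrier G \<and> v j \<in> carrier G) \<Longrightarrow> surface_word G u v n \<in> carrier G"
  by (induction n) auto

lemma (in group_hom) hom_surface_word:
  "(\<And>j. j < n \<Longrightarrow> u j \<in> carrier G \<and> v j \<in> carrier G) \<Longrightarrow>
    h (surface_word G u v n) = surface_word H (h \<circ> u) (h \<circ> v) n"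
  by (induction n) (auto simp: G.surface_word_closed)

definition sides :: "nat \<Rightarrow> nat set" where "sides g = {i. i < 4 * g \<and> i mod 4 < 2}"

definition side_angle :: "nat \<Rightarrow> real" where "side_angle g = 2 * pi / real (4 * g)"

context
  fixes g :: nat
  assumes g: "2 \<le> g"
begin

abbreviation "ang \<equiv> side_angle g"
abbreviation "vx \<equiv> polygon_vertex g"
abbreviation "sd \<equiv> polygon_side g"

lemma ang_bounds: "0 < ang" "ang \<le> pi / 4"
  using g by (auto simp: side_angle_def field_simps)

lemma full_angle: "real (4 * g) * ang = 2 * pi"
  using g by (simp add: side_angle_def)

lemma vertex_cis: "vx k = cis (real k * ang)"
  by (simp add: polygon_vertex_def side_angle_def mult.commute mult.left_commute)

lemma vertex_Suc: "vx (Suc k) = vx k * cis ang"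
  by (simp add: vertex_cis cis_mult distrib_right add.commute)

lemma vertex_period: "vx (4 * g) = vx 0"
  using g by (simp add: polygon_vertex_def)

lemma vertex_in_polygon: "k \<le> 4 * g \<Longrightarrow> vx k \<in> surface_polygon g"
proof -
  assume k: "k \<le> 4 * g"
  have "vx k \<in> vx ` {..<4 * g}"
  proof (cases "k = 4 * g")
    case True
    then show ?thesis using vertex_period g by (intro image_eqI[of _ _ 0]) auto
  qed (use k in auto)
  then show ?thesis unfolding surface_polygon_def by (rule hull_inc)
qed

lemma vertex_inj: "k < 4 * g \<Longrightarrow> l < 4 * g \<Longrightarrow> vx k = vx l \<Longrightarrow> k = l"
proof -
  have "inj_on vx {..<4 * g}"
    using bij_betw_imp_inj_on[OF Complex.bij_betw_roots_unity[of "4 * g"]] g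
    unfolding polygon_vertex_def by simp
  then show "k < 4 * g \<Longrightarrow> l < 4 * g \<Longrightarrow> vx k = vx l \<Longrightarrow> k = l" by (auto dest: inj_onD)
qed

lemma side_mult: "sd k t = vx k * linepath 1 (cis ang) t"
  by (simp add: polygon_side_def vertex_Suc linepath_def scaleR_conv_of_real algebra_simps)

lemma norm_side: "(norm (sd k t))\<^sup>2 = 1 - 2 * (t * (1 - t)) * (1 - cos ang)"
proof -
  have "norm (sd k t) = norm (linepath 1 (cis ang) t)"
    by (simp add: side_mult norm_mult vertex_cis)
  also have "(norm (linepath 1 (cis ang) t))\<^sup>2 = (1 - t + t * cos ang)\<^sup>2 + (t * sin ang)\<^sup>2"
    unfolding cmod_power2 by (simp add: linepath_def)
  also have "\<dots> = (1 - t)\<^sup>2 + 2 * t * (1 - t) * cos ang + t\<^sup>2 * ((sin ang)\<^sup>2 + (cos ang)\<^sup>2)"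
  proof -
    have "(1 - t + t * c)\<^sup>2 + (t * s)\<^sup>2 = (1 - t)\<^sup>2 + 2 * t * (1 - t) * c + t\<^sup>2 * (s\<^sup>2 + c\<^sup>2)" for c s
      by (simp add: power2_eq_square algebra_simps)
    then show ?thesis .
  qed
  also have "\<dots> = 1 - 2 * (t * (1 - t)) * (1 - cos ang)"
    unfolding sin_cos_squared_add by (simp add: power2_eq_square algebra_simps)
  finally show ?thesis by simp
qed

lemma cos_ang_less: "cos ang < 1"
  using cos_monotone_0_pi[of 0 ang] ang_bounds pi_gt_zero by simp

lemma norm_side_eq:
  assumes "norm (sd k t) = norm (sd l t')"
  shows "t' = t \<or> t' = 1 - t"
proof -
  have "(t * (1 - t)) * (1 - cos ang) = (t' * (1 - t')) * (1 - cos ang)"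
    using norm_side[of k t] norm_side[of l t'] unfolding assms by linarith
  then have "t * (1 - t) = t' * (1 - t')" using cos_ang_less by simp
  then have "(t' - t) * (t' - (1 - t)) = 0" by (simp add: algebra_simps)
  then show ?thesis by simp
qed

lemma cos_strict:
  assumes "1/2 < y" "y < real (4 * g) - 1/2"
  shows "cos (y * ang) < cos (ang / 2)"
proof (cases "y * ang \<le> pi")
  case True
  have "1/2 * ang < y * ang" using assms(1) ang_bounds(1) by (rule mult_strict_right_mono)
  then show ?thesis using True ang_bounds by (intro cos_monotone_0_pi) auto
next
  case False
  have "cos (y * ang) = cos (2 * pi - y * ang)" by (simp add: cos_diff)
  also have "\<dots> < cos (ang / 2)"
  proof (rule cos_monotone_0_pi)
    note full_angle
    moreover have "y * ang < (real (4 * g) - 1/2) * ang" using assms(2) ang_bounds(1) by (rule mult_strict_right_mono)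
    ultimately show "ang / 2 < 2 * pi - y * ang" by (simp add: left_diff_distrib)
  qed (use False ang_bounds in auto)
  finally show ?thesis .
qed

lemma cos_weak:
  assumes "1/2 \<le> y" "y \<le> real (4 * g) - 1/2"
  shows "cos (y * ang) \<le> cos (ang / 2)"
proof -
  have "cos ((real (4 * g) - 1/2) * ang) = cos (2 * pi - ang / 2)"
    unfolding left_diff_distrib full_angle by simp
  also have "\<dots> = cos (ang / 2)" by (simp add: cos_diff)
  finally have "cos ((real (4 * g) - 1/2) * ang) = cos (ang / 2)" .
  moreover have "cos (1/2 * ang) = cos (ang / 2)" by simp
  moreover have "1/2 < y \<and> y < real (4 * g) - 1/2 \<or> y = 1/2 \<or> y = real (4 * g) - 1/2"
    using assms by linarith
  ultimately show ?thesis using cos_strict[of y] by (metis less_imp_le order_refl)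
qed

text \<open>The linear functional that is maximal on the side \<open>i\<close> separates it from the other sides.\<close>

lemma side_disjoint:
  assumes i: "i < 4 * g" and j: "j < 4 * g" and t: "0 < t" "t < 1" and eq: "sd i t = sd j t'"
  shows "i = j \<and> t = t'"
proof -
  have "t' = t \<or> t' = 1 - t" using norm_side_eq[of i t j t'] eq by simp
  then have t': "0 < t'" "t' < 1" using t by auto
  define f where "f z = Re (z * cis (- ((real i + 1/2) * ang)))" for z
  have fv: "f (vx k) = cos ((real k - real i - 1/2) * ang)" for k
    by (simp add: f_def vertex_cis cis_mult algebra_simps)
  have fs: "f (sd k r) = (1 - r) * f (vx k) + r * f (vx (Suc k))" for k r
    by (simp add: f_def polygon_side_def linepath_def algebra_simps)
  have "f (sd i t) = cos (ang / 2)"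
  proof -
    have "f (vx i) = cos (ang / 2)" using fv[of i] cos_minus[of "ang / 2"] by simp
    moreover have "f (vx (Suc i)) = cos (ang / 2)" using fv[of "Suc i"] by simp
    ultimately show ?thesis by (simp add: fs algebra_simps)
  qed
  then have eq': "(1 - t') * f (vx j) + t' * f (vx (Suc j)) = cos (ang / 2)" using eq fs by simp
  have sym: "cos (y * ang) = cos (- y * ang)" for y by simp
  have ij: "i = j"
  proof (rule ccontr)
    assume "i \<noteq> j"
    then consider "i < j" | "j < i" by linarith
    then have "f (vx j) \<le> cos (ang / 2) \<and> f (vx (Suc j)) \<le> cos (ang / 2) \<and>
      (f (vx j) < cos (ang / 2) \<or> f (vx (Suc j)) < cos (ang / 2))"
    proof cases
      case 1
      have b: "real j - real i - 1/2 \<ge> 1/2" "real (Suc j) - real i - 1/2 > 1/2"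
        "real j - real i - 1/2 < real (4 * g) - 1/2" "real (Suc j) - real i - 1/2 \<le> real (4 * g) - 1/2"
        using 1 j by (auto simp: )
      show ?thesis
      proof (cases "j = Suc i")
        case True
        have "real (Suc j) - real i - 1/2 < real (4 * g) - 1/2" using True g by simp
        then show ?thesis unfolding fv using cos_weak b cos_strict by auto
      next
        case False
        then have "real j - real i - 1/2 > 1/2" using 1 by simp
        then show ?thesis unfolding fv using cos_weak b cos_strict by auto
      qed
    next
      case 2
      have b: "- (real j - real i - 1/2) > 1/2" "- (real (Suc j) - real i - 1/2) \<ge> 1/2"
        "- (real j - real i - 1/2) \<le> real (4 * g) - 1/2" "- (real (Suc j) - real i - 1/2) < real (4 * g) - 1/2"
        using 2 i by (auto simp: )
      show ?thesis
      proof (cases "i = Suc j")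
        case True
        have "- (real j - real i - 1/2) < real (4 * g) - 1/2" using True g by simp
        then show ?thesis unfolding fv sym[of "real _ - real i - 1/2"] using cos_weak b cos_strict by auto
      next
        case False
        then have "- (real (Suc j) - real i - 1/2) > 1/2" using 2 by simp
        then show ?thesis unfolding fv sym[of "real _ - real i - 1/2"] using cos_weak b cos_strict by auto
      qed
    qed
    then have "(1 - t') * f (vx j) + t' * f (vx (Suc j)) < (1 - t') * cos (ang / 2) + t' * cos (ang / 2)"
      using t' by (smt (verit) mult_le_cancel_left_pos mult_less_cancel_left_pos)
    then show False using eq' by (simp add: algebra_simps)
  qed
  have "(of_real (t - t') :: complex) * (vx (Suc i) - vx i) = 0"
    using eq unfolding ij polygon_side_def linepath_def by (simp add: scaleR_conv_of_real algebra_simps)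
  moreover have "vx (Suc i) \<noteq> vx i"
  proof
    assume "vx (Suc i) = vx i"
    then have "cis ang = 1" unfolding vertex_Suc by (simp add: vertex_cis)
    then show False using cos_ang_less by (metis Re_complex_of_real cis.sel(1) of_real_1 less_irrefl)
  qed
  ultimately have "t = t'" by simp
  with ij show ?thesis by simp
qed

lemma side_vertex:
  assumes "0 < t" "t < 1" shows "sd k t \<noteq> vx l"
proof
  assume "sd k t = vx l"
  then have "(norm (sd k t))\<^sup>2 = 1" by (simp add: vertex_cis)
  then have "2 * (t * (1 - t)) * (1 - cos ang) = 0" using norm_side[of k t] by simp
  then show False using assms cos_ang_less by simp
qed

lemma sides_bound: "k \<in> sides g \<Longrightarrow> k + 3 \<le> 4 * g"
proof -
  assume "k \<in> sides g"
  then have "k < 4 * g" "k mod 4 < 2" by (auto simp: sides_def)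
  then show ?thesis by presburger
qed

abbreviation "sa0 k \<equiv> vx k"
abbreviation "sa1 k \<equiv> vx (k + 1)"
abbreviation "sb0 k \<equiv> vx (k + 3)"
abbreviation "sb1 k \<equiv> vx (k + 2)"

abbreviation "side_glue \<equiv> glue (sides g) (\<lambda>k. linepath (sa0 k) (sa1 k)) (\<lambda>k. linepath (sb0 k) (sb1 k))"

lemma side_b: "linepath (sb0 k) (sb1 k) t = sd (k + 2) (1 - t)"
  by (simp add: polygon_side_def linepath_def numeral_3_eq_3 add.commute)

lemma side_a: "linepath (sa0 k) (sa1 k) t = sd k t"
  by (simp add: polygon_side_def)

lemma side_gluing_iff: "side_gluing g = side_glue"
proof (intro ext iffI)
  fix w w'
  show "side_glue w w'" if "side_gluing g w w'"
    using that
  proof (induction rule: side_gluing.induct)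
    case (1 i t)
    then show ?case
      using glue.intros[of i "sides g" t "\<lambda>k. linepath (sa0 k) (sa1 k)" "\<lambda>k. linepath (sb0 k) (sb1 k)"]
      unfolding side_a side_b by (simp add: sides_def)
  qed
  show "side_gluing g w w'" if "side_glue w w'"
    using that
  proof (induction rule: glue.induct)
    case (1 k t)
    then show ?case unfolding side_a side_b by (intro side_gluing.intros) (auto simp: sides_def)
  qed
qed

lemma glue_norm_step:
  "side_glue y z \<Longrightarrow> norm y = norm z \<and> (\<exists>j<4 * g. \<exists>t\<in>{0..1}. y = sd j t) \<and> (\<exists>j<4 * g. \<exists>t\<in>{0..1}. z = sd j t)"
proof (induction rule: glue.induct)
  case (1 k t)
  have "(norm (sd k t))\<^sup>2 = (norm (sd (k + 2) (1 - t)))\<^sup>2"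
    unfolding norm_side by (simp add: mult.commute)
  then have "norm (sd k t) = norm (sd (k + 2) (1 - t))" by simp
  moreover have "k < 4 * g" "k + 2 < 4 * g" using sides_bound[OF 1(1)] by auto
  moreover have "1 - t \<in> {0..1}" using 1 by simp
  ultimately show ?case unfolding side_a side_b using 1(2) by blast
qed

lemma glue_norm: "equivclp side_glue w w' \<Longrightarrow>
  norm w' = norm w \<and> (w' = w \<or> (\<exists>j<4 * g. \<exists>t\<in>{0..1}. w' = sd j t))"
proof (induction rule: equivclp_induct)
  case (step y z)
  have "norm z = norm y \<and> (\<exists>j<4 * g. \<exists>t\<in>{0..1}. z = sd j t)"
    using step(2)
  proof
    assume "side_glue z y"
    from glue_norm_step[OF this] show ?thesis by simp
  next
    assume "side_glue y z"
    from glue_norm_step[OF this] show ?thesis by simp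
  qed
  then show ?case using step(3) by simp
qed simp

lemma finite_side_norm: "finite {w. \<exists>j<4 * g. \<exists>t\<in>{0..1}. w = sd j t \<and> norm w = r}"
proof -
  have "finite {w. \<exists>t\<in>{0..1}. w = sd j t \<and> norm w = r}" for j
  proof (cases "\<exists>t\<in>{0..1}. norm (sd j t) = r")
    case True
    then obtain t0 where "norm (sd j t0) = r" by blast
    then have "w \<in> {sd j t0, sd j (1 - t0)}" if w: "w \<in> {w. \<exists>t\<in>{0..1}. w = sd j t \<and> norm w = r}" for w
    proof -
      obtain t where "w = sd j t" "norm (sd j t) = r" using w by blast
      then show ?thesis using norm_side_eq[of j t0 j t] \<open>norm (sd j t0) = r\<close> by auto
    qed
    then have "{w. \<exists>t\<in>{0..1}. w = sd j t \<and> norm w = r} \<subseteq> {sd j t0, sd j (1 - t0)}" by blast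
    then show ?thesis by (rule finite_subset) simp
  next
    case False
    then have "{w. \<exists>t\<in>{0..1}. w = sd j t \<and> norm w = r} = {}" by auto
    then show ?thesis by (simp only: finite.emptyI)
  qed
  then have "finite (\<Union>j\<in>{..<4 * g}. {w. \<exists>t\<in>{0..1}. w = sd j t \<and> norm w = r})" by simp
  moreover have "{w. \<exists>j<4 * g. \<exists>t\<in>{0..1}. w = sd j t \<and> norm w = r} =
      (\<Union>j\<in>{..<4 * g}. {w. \<exists>t\<in>{0..1}. w = sd j t \<and> norm w = r})" by auto
  ultimately show ?thesis by simp
qed

lemma surface_glued_cell:
  fixes S :: "'m::real_normed_vector set"
  assumes quot: "quotient_map (top_of_set (surface_polygon g)) (top_of_set S) q"
    and eq: "\<forall>x\<in>surface_polygon g. \<forall>y\<in>surface_polygon g. q x = q y \<longleftrightarrow> equivclp (side_gluing g) x y"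
  shows "glued_cell (surface_polygon g) q S (sides g) sa0 sa1 sb0 sb1"
proof
  show "compact (surface_polygon g)"
    unfolding surface_polygon_def by (intro finite_imp_compact_convex_hull) auto
  show "convex (surface_polygon g)" unfolding surface_polygon_def by (rule convex_convex_hull)
  show "finite (sides g)" by (rule finite_subset[of _ "{..<4 * g}"]) (auto simp: sides_def)
  show "sa0 k \<in> surface_polygon g \<and> sa1 k \<in> surface_polygon g \<and> sb0 k \<in> surface_polygon g \<and> sb1 k \<in> surface_polygon g"
    if "k \<in> sides g" for k
    using sides_bound[OF that] by (intro conjI vertex_in_polygon) auto
  have d: "dist (vx k) (vx (Suc k)) = norm (1 - cis ang)" for k
  proof -
    have "vx k - vx (Suc k) = vx k * (1 - cis ang)" by (simp add: vertex_Suc algebra_simps)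
    then show ?thesis by (simp add: dist_norm norm_mult vertex_cis)
  qed
  show "dist (sa0 k) (sa1 k) = dist (sb0 k) (sb1 k)" for k
    using d[of k] d[of "k + 2"] by (simp add: dist_commute numeral_3_eq_3)
  show "q w = q w' \<longleftrightarrow> equivclp side_glue w w'"
    if "w \<in> surface_polygon g" "w' \<in> surface_polygon g" for w w'
    using eq that by (simp add: side_gluing_iff)
  show "finite {w \<in> surface_polygon g. q w = x}" for x
  proof (cases "\<exists>w0\<in>surface_polygon g. q w0 = x")
    case True
    then obtain w0 where w0: "w0 \<in> surface_polygon g" "q w0 = x" by blast
    have "{w \<in> surface_polygon g. q w = x} \<subseteq> insert w0 {w. \<exists>j<4 * g. \<exists>t\<in>{0..1}. w = sd j t \<and> norm w = norm w0}"
    proof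
      fix w assume "w \<in> {w \<in> surface_polygon g. q w = x}"
      then have "equivclp side_glue w0 w" using w0 eq unfolding side_gluing_iff by fastforce
      from glue_norm[OF this] show "w \<in> insert w0 {w. \<exists>j<4 * g. \<exists>t\<in>{0..1}. w = sd j t \<and> norm w = norm w0}" by blast
    qed
    then show ?thesis by (rule finite_subset) (simp only: finite_insert finite_side_norm)
  next
    case False
    then have "{w \<in> surface_polygon g. q w = x} = {}" by auto
    then show ?thesis by (simp only: finite.emptyI)
  qed
qed (rule quot)

end

text \<open>The label of the corner at vertex \<open>k\<close>, obtained by going once around the vertex of the surface.\<close>

definition corner_label :: "('g, 'z) monoid_scheme \<Rightarrow> (nat \<Rightarrow> 'g) \<Rightarrow> (nat \<Rightarrow> 'g) \<Rightarrow> nat \<Rightarrow> 'g" where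
  "corner_label Q u v k = (let j = k div 4; r = surface_word Q u v j in
     if k mod 4 = 0 then r
     else if k mod 4 = 1 then r \<otimes>\<^bsub>Q\<^esub> u j \<otimes>\<^bsub>Q\<^esub> inv\<^bsub>Q\<^esub> v j \<otimes>\<^bsub>Q\<^esub> inv\<^bsub>Q\<^esub> u j
     else if k mod 4 = 2 then r \<otimes>\<^bsub>Q\<^esub> u j \<otimes>\<^bsub>Q\<^esub> inv\<^bsub>Q\<^esub> v j
     else r \<otimes>\<^bsub>Q\<^esub> u j)"

definition side_label :: "(nat \<Rightarrow> 'g) \<Rightarrow> (nat \<Rightarrow> 'g) \<Rightarrow> nat \<Rightarrow> 'g" where
  "side_label u v k = (if k mod 4 = 0 then u (k div 4) else v (k div 4))"

lemma (in group) corner_label_step: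
  assumes uv: "\<And>j. j < g \<Longrightarrow> u j \<in> carrier G \<and> v j \<in> carrier G"
    and k: "k < 4 * g" "k mod 4 < 2"
  shows "corner_label G u v (k + 3) = corner_label G u v k \<otimes> side_label u v k"
    "corner_label G u v (k + 2) = corner_label G u v (k + 1) \<otimes> side_label u v k"
proof -
  define j where "j = k div 4"
  have j: "j < g" using k(1) by (simp add: j_def)
  have c: "u j \<in> carrier G" "v j \<in> carrier G" "surface_word G u v j \<in> carrier G"
    using uv j by (auto intro!: surface_word_closed)
  have "k mod 4 = 0 \<or> k mod 4 = 1" using k by linarith
  then consider "k = 4 * j" | "k = 4 * j + 1"
    unfolding j_def by (metis add.right_neutral mult_div_mod_eq)
  then have "corner_label G u v (k + 3) = corner_label G u v k \<otimes> side_label u v k \<and>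
    corner_label G u v (k + 2) = corner_label G u v (k + 1) \<otimes> side_label u v k"
  proof cases
    case 1
    have "(4 * j + 3) div 4 = j" "(4 * j + 2) div 4 = j" "(4 * j + 1) div 4 = j"
      "(4 * j + 3) mod 4 = 3" "(4 * j + 2) mod 4 = 2" "(4 * j + 1) mod 4 = 1" by presburger+
    then show ?thesis unfolding 1 using c by (simp add: corner_label_def side_label_def m_assoc)
  next
    case 2
    have "(4 * j + 1 + 3) div 4 = Suc j" "(4 * j + 1 + 2) div 4 = j" "(4 * j + 1 + 1) div 4 = j" "(4 * j + 1) div 4 = j"
      "(4 * j + 1 + 3) mod 4 = 0" "(4 * j + 1 + 2) mod 4 = 3" "(4 * j + 1 + 1) mod 4 = 2" "(4 * j + 1) mod 4 = 1"
      by presburger+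
    then show ?thesis unfolding 2 using c by (simp add: corner_label_def side_label_def m_assoc)
  qed
  then show "corner_label G u v (k + 3) = corner_label G u v k \<otimes> side_label u v k"
    "corner_label G u v (k + 2) = corner_label G u v (k + 1) \<otimes> side_label u v k" by auto
qed

lemma (in group) corner_label_closed:
  assumes uv: "\<And>j. j < g \<Longrightarrow> u j \<in> carrier G \<and> v j \<in> carrier G" and k: "k \<le> 4 * g"
  shows "corner_label G u v k \<in> carrier G"
proof (cases "k = 4 * g")
  case True
  then show ?thesis using uv by (simp add: corner_label_def surface_word_closed)
next
  case False
  then have "k div 4 < g" using k by simp
  moreover from this have "surface_word G u v (k div 4) \<in> carrier G" using uv by (intro surface_word_closed) auto
  ultimately show ?thesis using uv by (simp add: corner_label_def Let_def)
qed

definition point_label ::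
    "nat \<Rightarrow> ('g, 'z) monoid_scheme \<Rightarrow> (nat \<Rightarrow> 'g) \<Rightarrow> (nat \<Rightarrow> 'g) \<Rightarrow> complex \<Rightarrow> 'g" where
  "point_label g Q u v w =
     (if \<exists>k<4 * g. w = polygon_vertex g k then corner_label Q u v (THE k. k < 4 * g \<and> w = polygon_vertex g k)
      else if \<exists>k\<in>sides g. \<exists>t. 0 < t \<and> t < 1 \<and> w = polygon_side g (k + 2) t
      then side_label u v (THE k. k \<in> sides g \<and> (\<exists>t. 0 < t \<and> t < 1 \<and> w = polygon_side g (k + 2) t))
      else \<one>\<^bsub>Q\<^esub>)"

context group begin

context
  fixes g :: nat and u v :: "nat \<Rightarrow> 'a"
  assumes g: "2 \<le> g" and uv: "\<And>j. j < g \<Longrightarrow> u j \<in> carrier G \<and> v j \<in> carrier G"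
    and rel: "surface_word G u v g = \<one>"
begin

lemma point_label_vertex: "k \<le> 4 * g \<Longrightarrow> point_label g G u v (polygon_vertex g k) = corner_label G u v k"
proof -
  have *: "point_label g G u v (polygon_vertex g k) = corner_label G u v k" if k: "k < 4 * g" for k
  proof -
    have "(THE l. l < 4 * g \<and> polygon_vertex g k = polygon_vertex g l) = k"
      using k vertex_inj[OF g] by (intro the_equality) auto
    then show ?thesis using k by (auto simp: point_label_def)
  qed
  have "corner_label G u v (4 * g) = corner_label G u v 0"
    by (simp add: corner_label_def rel)
  then show "k \<le> 4 * g \<Longrightarrow> ?thesis"
    using * vertex_period[OF g] g by (cases "k = 4 * g") auto
qed

lemma point_label_side:
  assumes k: "k \<in> sides g" and t: "0 < t" "t < 1"
  shows "point_label g G u v (polygon_side g (k + 2) t) = side_label u v k"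
    "point_label g G u v (polygon_side g k t) = \<one>"
proof -
  have b: "l < 4 * g" "l + 2 < 4 * g" "l mod 4 < 2" if "l \<in> sides g" for l
    using that sides_bound[OF g that] by (auto simp: sides_def)
  have nv: "\<not> (\<exists>l<4 * g. polygon_side g j t = polygon_vertex g l)" for j
    using side_vertex[OF g t] by blast
  have "(THE l. l \<in> sides g \<and> (\<exists>t'. 0 < t' \<and> t' < 1 \<and> polygon_side g (k + 2) t = polygon_side g (l + 2) t')) = k"
  proof (rule the_equality)
    show "l = k" if "l \<in> sides g \<and> (\<exists>t'. 0 < t' \<and> t' < 1 \<and> polygon_side g (k + 2) t = polygon_side g (l + 2) t')" for l
      using that side_disjoint[OF g b(2)[OF k] _ t] b by (metis add_right_cancel)
  qed (use k t in auto)
  then show "point_label g G u v (polygon_side g (k + 2) t) = side_label u v k"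
    using nv[of "k + 2"] k t by (auto simp: point_label_def)
  have "k \<noteq> l + 2" if "l \<in> sides g" for l
    using b[OF k] b[OF that] by presburger
  then have "\<not> (\<exists>l\<in>sides g. \<exists>t'. 0 < t' \<and> t' < 1 \<and> polygon_side g k t = polygon_side g (l + 2) t')"
    using side_disjoint[OF g b(1)[OF k] _ t] b(2) by blast
  then show "point_label g G u v (polygon_side g k t) = \<one>"
    using nv[of k] by (auto simp: point_label_def)
qed

lemma point_label_glue:
  assumes k: "k \<in> sides g" and t: "t \<in> {0..1}"
  shows "point_label g G u v (linepath (polygon_vertex g (k + 3)) (polygon_vertex g (k + 2)) t) =
    point_label g G u v (linepath (polygon_vertex g k) (polygon_vertex g (k + 1)) t) \<otimes> side_label u v k"
proof -
  have k': "k < 4 * g" "k mod 4 < 2" "k + 3 \<le> 4 * g"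
    using k sides_bound[OF g k] by (auto simp: sides_def)
  have sc: "side_label u v k \<in> carrier G" using uv[of "k div 4"] k' by (simp add: side_label_def)
  consider "t = 0" | "t = 1" | "0 < t" "t < 1" using t by fastforce
  then show ?thesis
  proof cases
    case 1
    then show ?thesis
      using corner_label_step(1)[OF uv k'(1,2)] k' by (simp add: linepath_0' point_label_vertex)
  next
    case 2
    then show ?thesis
      using corner_label_step(2)[OF uv k'(1,2)] k' by (simp add: linepath_1' point_label_vertex)
  next
    case 3
    then show ?thesis
      using point_label_side(1)[OF k, of "1 - t"] point_label_side(2)[OF k, of t] sc
      unfolding side_a[OF g] side_b[OF g] by simp
  qed
qed

lemma point_label_closed: "point_label g G u v w \<in> carrier G"
proof -
  consider (v) k where "k < 4 * g" "w = polygon_vertex g k"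
    | (s) k t where "\<not> (\<exists>k<4 * g. w = polygon_vertex g k)" "k \<in> sides g" "0 < t" "t < 1" "w = polygon_side g (k + 2) t"
    | (o) "\<not> (\<exists>k<4 * g. w = polygon_vertex g k)" "\<not> (\<exists>k\<in>sides g. \<exists>t. 0 < t \<and> t < 1 \<and> w = polygon_side g (k + 2) t)"
    by blast
  then show ?thesis
  proof cases
    case v
    then show ?thesis using point_label_vertex[of k] corner_label_closed[OF uv, where k = k] by simp
  next
    case s
    then have "k < 4 * g" by (simp add: sides_def)
    then show ?thesis using s point_label_side(1)[of k t] uv[of "k div 4"] by (simp add: side_label_def)
  next
    case o
    then show ?thesis by (simp only: point_label_def if_False one_closed)
  qed
qed

end

end

theorem surface_presentation:
  fixes S :: "'m::real_normed_vector set"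
  assumes S: "closed_orientable_surface g S" and x: "x \<in> S" and g: "2 \<le> g"
  shows "\<exists>u v. (\<forall>j<g. u j \<in> carrier (fundamental_group S x) \<and> v j \<in> carrier (fundamental_group S x)) \<and>
    generate (fundamental_group S x) (u ` {..<g} \<union> v ` {..<g}) = carrier (fundamental_group S x) \<and>
    surface_word (fundamental_group S x) u v g = \<one>\<^bsub>fundamental_group S x\<^esub> \<and>
    (\<forall>(Q :: 'g monoid) U V. group Q \<longrightarrow> (\<forall>j<g. U j \<in> carrier Q \<and> V j \<in> carrier Q) \<longrightarrow>
       surface_word Q U V g = \<one>\<^bsub>Q\<^esub> \<longrightarrow>
       (\<exists>h\<in>hom (fundamental_group S x) Q. \<forall>j<g. h (u j) = U j \<and> h (v j) = V j))"
proof -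
  let ?P = "surface_polygon g"
  let ?v = "polygon_vertex g"
  obtain q where quot: "quotient_map (top_of_set ?P) (top_of_set S) q"
    and eq: "\<forall>x\<in>?P. \<forall>y\<in>?P. q x = q y \<longleftrightarrow> equivclp (side_gluing g) x y"
    using S unfolding closed_orientable_surface_def by blast
  interpret glued_cell ?P q S "sides g" "\<lambda>k. ?v k" "\<lambda>k. ?v (k + 1)" "\<lambda>k. ?v (k + 3)" "\<lambda>k. ?v (k + 2)"
    by (rule surface_glued_cell[OF g quot eq])
  obtain w0 where w0x: "w0 \<in> ?P" "q w0 = x" using x q_image by blast
  interpret pointed_glued_cell ?P q S "sides g" "\<lambda>k. ?v k" "\<lambda>k. ?v (k + 1)" "\<lambda>k. ?v (k + 3)" "\<lambda>k. ?v (k + 2)" w0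
    by unfold_locales (rule w0x)
  define u v where "u j = gen (4 * j)" and "v j = gen (4 * j + 1)" for j
  have K: "4 * j \<in> sides g" "4 * j + 1 \<in> sides g" if "j < g" for j
    using that by (auto simp: sides_def)
  have K': "k \<in> sides g \<Longrightarrow> \<exists>j<g. k = 4 * j \<or> k = 4 * j + 1" for k
  proof -
    assume "k \<in> sides g"
    then have "k < 4 * g" "k mod 4 < 2" by (auto simp: sides_def)
    then show "\<exists>j<g. k = 4 * j \<or> k = 4 * j + 1" by presburger
  qed
  have uvc: "u j \<in> carrier pi1" "v j \<in> carrier pi1" if "j < g" for j
    using gen_carrier K[OF that] by (auto simp: u_def v_def)
  have "gen ` sides g = u ` {..<g} \<union> v ` {..<g}"
    using K K' unfolding u_def v_def by fast
  then have gen: "generate pi1 (u ` {..<g} \<union> v ` {..<g}) = carrier pi1" using generate_gen by simp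
  have vP: "?v k \<in> ?P" if "k \<le> 4 * g" for k using vertex_in_polygon[OF g that] .
  have rel: "surface_word pi1 u v n = jump (?v 0) (?v (4 * n)) \<and> q (?v 0) = q (?v (4 * n))" if "n \<le> g" for n
    using that
  proof (induction n)
    case 0
    then show ?case using vP[of 0] by (simp add: jump_refl)
  next
    case (Suc n)
    then have n: "n < g" by simp
    let ?a = "?v (4 * n)" and ?b = "?v (4 * n + 1)" and ?c = "?v (4 * n + 2)" and ?d = "?v (4 * n + 3)" and ?e = "?v (4 * n + 4)"
    have P: "?a \<in> ?P" "?b \<in> ?P" "?c \<in> ?P" "?d \<in> ?P" "?e \<in> ?P" "?v 0 \<in> ?P" using n by (auto intro!: vP)
    have idx: "4 * n + 1 + 1 = 4 * n + 2" "4 * n + 1 + 2 = 4 * n + 3" "4 * n + 1 + 3 = 4 * n + 4" by simp_all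
    have z: "(0::real) \<in> {0..1}" "(1::real) \<in> {0..1}" by simp_all
    have 0: "q ?a = q ?d" "q ?b = q ?c" "q ?b = q ?e" "q ?c = q ?d"
      using q_al_be[OF K(1)[OF n] z(1)] q_al_be[OF K(1)[OF n] z(2)] q_al_be[OF K(2)[OF n] z(1)] q_al_be[OF K(2)[OF n] z(2)]
      unfolding linepath_0' linepath_1' idx by (simp_all only: refl)
    have 1: "u n = jump ?a ?d" "v n = jump ?b ?e" unfolding u_def v_def gen_def idx by (rule refl)+
    have 2: "u n = jump ?b ?c" "v n = jump ?c ?d"
      using jump_side[OF K(1)[OF n] z(2)] jump_side[OF K(2)[OF n] z(2)]
      unfolding 1 linepath_1' idx by (simp_all only: refl)
    have "inv\<^bsub>pi1\<^esub> v n = jump ?d ?c" "inv\<^bsub>pi1\<^esub> u n = jump ?c ?b"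
      unfolding 2 by (rule jump_inv[symmetric], use P 0 in simp_all)+
    then have "u n \<otimes>\<^bsub>pi1\<^esub> inv\<^bsub>pi1\<^esub> v n \<otimes>\<^bsub>pi1\<^esub> inv\<^bsub>pi1\<^esub> u n \<otimes>\<^bsub>pi1\<^esub> v n = jump ?a ?e"
      using P 0 1 by (simp add: jump_mult)
    moreover have "jump (?v 0) ?a \<otimes>\<^bsub>pi1\<^esub> jump ?a ?e = jump (?v 0) ?e"
      using P 0 Suc n by (intro jump_mult) auto
    ultimately show ?case using Suc n 0 by (simp add: add.commute)
  qed
  have word: "surface_word pi1 u v g = \<one>\<^bsub>pi1\<^esub>"
    using rel[of g] vertex_period[OF g] vP[of 0] by (simp add: jump_refl)
  have "\<exists>h\<in>hom pi1 Q. \<forall>j<g. h (u j) = U j \<and> h (v j) = V j"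
    if Q: "group Q" and UV: "\<forall>j<g. U j \<in> carrier Q \<and> V j \<in> carrier Q" and r: "surface_word Q U V g = \<one>\<^bsub>Q\<^esub>"
    for Q :: "'g monoid" and U V
  proof -
    interpret Q: group Q by (rule Q)
    interpret labelled_glued_cell ?P q S "sides g" "\<lambda>k. ?v k" "\<lambda>k. ?v (k + 1)" "\<lambda>k. ?v (k + 3)" "\<lambda>k. ?v (k + 2)" w0
      Q "point_label g Q U V" "side_label U V"
    proof unfold_locales
      show "point_label g Q U V w \<in> carrier Q" for w
        using Q.point_label_closed[OF g _ r] UV by blast
      show "side_label U V k \<in> carrier Q" if "k \<in> sides g" for k
        using that UV by (auto simp: sides_def side_label_def)
      show "point_label g Q U V (linepath (?v (k + 3)) (?v (k + 2)) t) =
          point_label g Q U V (linepath (?v k) (?v (k + 1)) t) \<otimes>\<^bsub>Q\<^esub> side_label U V k"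
        if "k \<in> sides g" "t \<in> {0..1}" for k t
        using Q.point_label_glue[OF g _ r that] UV by blast
    qed
    obtain h where h: "h \<in> hom pi1 Q" "\<forall>k\<in>sides g. h (gen k) = side_label U V k" using labelled_hom by blast
    have "h (u j) = U j \<and> h (v j) = V j" if "j < g" for j
    proof -
      have "(4 * j + 1) div 4 = j" "(4 * j + 1) mod 4 = 1" by presburger+
      then show ?thesis using h(2) K[OF that] by (simp add: u_def v_def side_label_def)
    qed
    then show ?thesis using h(1) by blast
  qed
  then show ?thesis unfolding w0x(2)[symmetric] using uvc gen word by blast
qed

section \<open>Splitting central extensions of surface groups\<close>

lemma surface_group_presentation:
  assumes "surface_group g G"
  shows "\<exists>u v. (\<forall>j<g. u j \<in> carrier G \<and> v j \<in> carrier G) \<and>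
    generate G (u ` {..<g} \<union> v ` {..<g}) = carrier G \<and>
    surface_word G u v g = \<one>\<^bsub>G\<^esub> \<and>
    (\<forall>(Q :: 'g monoid) U V. group Q \<longrightarrow> (\<forall>j<g. U j \<in> carrier Q \<and> V j \<in> carrier Q) \<longrightarrow>
       surface_word Q U V g = \<one>\<^bsub>Q\<^esub> \<longrightarrow>
       (\<exists>h\<in>hom G Q. \<forall>j<g. h (u j) = U j \<and> h (v j) = V j))"
proof -
  obtain S :: "(real ^ 3) set" and x where g: "2 \<le> g" and G: "group G"
    and S: "closed_orientable_surface g S" "x \<in> S" and iso: "G \<cong> fundamental_group S x"
    using assms unfolding surface_group_def by blast
  let ?p = "fundamental_group S x"
  interpret G: group G by (rule G)
  interpret p: group ?p by (rule group_fundamental_group[OF S(2)])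
  have "?p \<cong> G" using G.iso_sym[OF iso] .
  then obtain f where f: "f \<in> iso ?p G" by (auto simp: is_iso_def)
  interpret f: group_hom ?p G f
    using f by unfold_locales (simp add: iso_def)
  obtain u v where uv: "\<forall>j<g. u j \<in> carrier ?p \<and> v j \<in> carrier ?p"
    and gen: "generate ?p (u ` {..<g} \<union> v ` {..<g}) = carrier ?p"
    and word: "surface_word ?p u v g = \<one>\<^bsub>?p\<^esub>"
    and univ: "\<forall>(Q :: 'g monoid) U V. group Q \<longrightarrow> (\<forall>j<g. U j \<in> carrier Q \<and> V j \<in> carrier Q) \<longrightarrow>
       surface_word Q U V g = \<one>\<^bsub>Q\<^esub> \<longrightarrow> (\<exists>h\<in>hom ?p Q. \<forall>j<g. h (u j) = U j \<and> h (v j) = V j)"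
    using surface_presentation[OF S g] by blast
  have "\<forall>j<g. (f \<circ> u) j \<in> carrier G \<and> (f \<circ> v) j \<in> carrier G" using uv by simp
  moreover have "generate G ((f \<circ> u) ` {..<g} \<union> (f \<circ> v) ` {..<g}) = carrier G"
  proof -
    have "generate G (f ` (u ` {..<g} \<union> v ` {..<g})) = f ` generate ?p (u ` {..<g} \<union> v ` {..<g})"
      by (rule f.generate_img) (use uv in auto)
    also have "\<dots> = carrier G" using f gen by (simp add: iso_def bij_betw_def)
    finally show ?thesis by (simp add: image_Un image_comp)
  qed
  moreover have "surface_word G (f \<circ> u) (f \<circ> v) g = \<one>\<^bsub>G\<^esub>"
    using f.hom_surface_word[of g u v] uv word by simp
  moreover have "\<exists>h\<in>hom G Q. \<forall>j<g. h ((f \<circ> u) j) = U j \<and> h ((f \<circ> v) j) = V j"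
    if Q: "group Q" "\<forall>j<g. U j \<in> carrier Q \<and> V j \<in> carrier Q" "surface_word Q U V g = \<one>\<^bsub>Q\<^esub>"
    for Q :: "'g monoid" and U V
  proof -
    obtain h where h: "h \<in> hom ?p Q" "\<forall>j<g. h (u j) = U j \<and> h (v j) = V j" using univ Q by blast
    define f' where "f' = inv_into (carrier ?p) f"
    have "f' \<in> iso G ?p" unfolding f'_def by (rule p.iso_set_sym[OF f])
    then have "h \<circ> f' \<in> hom G Q" using h(1) by (intro hom_compose) (auto simp: iso_def)
    moreover have "f' (f y) = y" if "y \<in> carrier ?p" for y
      unfolding f'_def using f that by (intro inv_into_f_f) (auto simp: iso_def bij_betw_def)
    ultimately show ?thesis using h(2) uv by (intro bexI[of _ "h \<circ> f'"]) auto
  qed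
  ultimately show ?thesis by blast
qed

definition twisted_product :: "('b, 'y) monoid_scheme \<Rightarrow> 'b \<Rightarrow> ('b \<times> int \<times> int) monoid" where
  "twisted_product G z =
    \<lparr> carrier = carrier G \<times> UNIV,
      mult = (\<lambda>(x, m, n) (y, m', n'). (x \<otimes>\<^bsub>G\<^esub> y \<otimes>\<^bsub>G\<^esub> z [^]\<^bsub>G\<^esub> (m * n'), m + m', n + n')),
      one = (\<one>\<^bsub>G\<^esub>, 0, 0) \<rparr>"

context group begin

lemma inv_mult_cancel: "x \<in> carrier G \<Longrightarrow> y \<in> carrier G \<Longrightarrow> inv x \<otimes> (x \<otimes> y) = y"
  by (simp flip: m_assoc)

context
  fixes z
  assumes z: "z \<in> carrier G" and central: "\<And>y. y \<in> carrier G \<Longrightarrow> z \<otimes> y = y \<otimes> z"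
begin

lemma int_pow_central:
  assumes y: "y \<in> carrier G"
  shows "z [^] (k::int) \<otimes> y = y \<otimes> z [^] k"
proof -
  have n: "z [^] (m::nat) \<otimes> y = y \<otimes> z [^] m" for m
  proof (induction m)
    case (Suc m)
    then show ?case using z y central[OF y] by (simp add: m_assoc) (metis m_assoc nat_pow_closed)
  qed (use y in simp)
  have i: "inv (z [^] m) \<otimes> y = y \<otimes> inv (z [^] m)" for m :: nat
    using n[of m] z y by (metis inv_solve_left inv_solve_right' m_assoc m_closed inv_closed nat_pow_closed)
  show ?thesis
  proof (cases k)
    case (nonneg m)
    then show ?thesis using n[of m] by (simp only: int_pow_int)
  next
    case (neg m)
    show ?thesis unfolding neg int_pow_neg_int[OF z] by (rule i)
  qed
qed

lemma group_twisted_product: "group (twisted_product G z)"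
proof (rule groupI)
  let ?Q = "twisted_product G z"
  have Z: "z [^] k \<in> carrier G" for k :: int using z by simp
  have Zadd: "z [^] (k + l) = z [^] k \<otimes> z [^] l" for k l :: int using z by (simp add: int_pow_mult)
  show "\<one>\<^bsub>?Q\<^esub> \<in> carrier ?Q" by (simp add: twisted_product_def)
  show "a \<otimes>\<^bsub>?Q\<^esub> b \<in> carrier ?Q" if "a \<in> carrier ?Q" "b \<in> carrier ?Q" for a b
    using that Z by (auto simp: twisted_product_def)
  show "\<one>\<^bsub>?Q\<^esub> \<otimes>\<^bsub>?Q\<^esub> a = a" if "a \<in> carrier ?Q" for a
    using that by (auto simp: twisted_product_def)
  show "a \<otimes>\<^bsub>?Q\<^esub> b \<otimes>\<^bsub>?Q\<^esub> c = a \<otimes>\<^bsub>?Q\<^esub> (b \<otimes>\<^bsub>?Q\<^esub> c)"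
    if "a \<in> carrier ?Q" "b \<in> carrier ?Q" "c \<in> carrier ?Q" for a b c
  proof -
    obtain x m n y m' n' w m'' n'' where abc: "a = (x, m, n)" "b = (y, m', n')" "c = (w, m'', n'')"
      by (metis prod_cases3)
    have xyw: "x \<in> carrier G" "y \<in> carrier G" "w \<in> carrier G" using that by (auto simp: abc twisted_product_def)
    have "x \<otimes> y \<otimes> z [^] (m * n') \<otimes> w \<otimes> z [^] ((m + m') * n'') =
        x \<otimes> y \<otimes> (z [^] (m * n') \<otimes> w) \<otimes> z [^] ((m + m') * n'')"
      using xyw Z by (simp add: m_assoc)
    also have "\<dots> = x \<otimes> y \<otimes> w \<otimes> z [^] (m * n' + (m + m') * n'')"
      using xyw Z by (simp add: int_pow_central[OF xyw(3)] Zadd m_assoc)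
    also have "m * n' + (m + m') * n'' = m' * n'' + m * (n' + n'')" by (simp add: algebra_simps)
    also have "x \<otimes> y \<otimes> w \<otimes> z [^] (m' * n'' + m * (n' + n'')) =
        x \<otimes> (y \<otimes> w \<otimes> z [^] (m' * n'')) \<otimes> z [^] (m * (n' + n''))"
      using xyw Z by (simp add: Zadd m_assoc)
    finally show ?thesis by (simp add: abc twisted_product_def add.assoc)
  qed
  show "\<exists>b\<in>carrier ?Q. b \<otimes>\<^bsub>?Q\<^esub> a = \<one>\<^bsub>?Q\<^esub>" if "a \<in> carrier ?Q" for a
  proof -
    obtain x m n where a: "a = (x, m, n)" by (metis prod_cases3)
    have x: "x \<in> carrier G" using that by (auto simp: a twisted_product_def)
    have "inv x \<otimes> z [^] (m * n) \<otimes> x \<otimes> z [^] (- m * n) = inv x \<otimes> (z [^] (m * n) \<otimes> x) \<otimes> z [^] (- m * n)"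
      using x Z by (simp add: m_assoc)
    also have "\<dots> = (inv x \<otimes> x) \<otimes> (z [^] (m * n) \<otimes> z [^] (- m * n))"
      using x Z by (simp add: int_pow_central[OF x] m_assoc inv_mult_cancel)
    also have "\<dots> = \<one>" using x z by (simp flip: Zadd)
    finally show ?thesis
      using x Z by (intro bexI[of _ "(inv x \<otimes> z [^] (m * n), - m, - n)"]) (auto simp: a twisted_product_def)
  qed
qed

lemma twisted_product_mult:
  "(x, m, n) \<otimes>\<^bsub>twisted_product G z\<^esub> (y, m', n') = (x \<otimes> y \<otimes> z [^] (m * n'), m + m', n + n')"
  by (simp add: twisted_product_def)

lemma twisted_product_one: "\<one>\<^bsub>twisted_product G z\<^esub> = (\<one>, 0, 0)"
  by (simp add: twisted_product_def)

lemma twisted_product_inv: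
  assumes "x \<in> carrier G" "m = 0 \<or> n = 0"
  shows "inv\<^bsub>twisted_product G z\<^esub> (x, m, n) = (inv x, - m, - n)"
proof -
  interpret Q: group "twisted_product G z" by (rule group_twisted_product)
  show ?thesis
    by (rule Q.inv_equality) (use assms in \<open>auto simp: twisted_product_def\<close>)
qed

text \<open>Only the first handle is twisted, and it contributes exactly one factor \<open>z\<inverse>\<close>.\<close>

lemma twisted_surface_word:
  assumes uv: "\<And>j. j < n \<Longrightarrow> u j \<in> carrier G \<and> v j \<in> carrier G"
  shows "surface_word (twisted_product G z) (\<lambda>j. (u j, if j = 0 then 1 else 0, 0)) (\<lambda>j. (v j, 0, if j = 0 then 1 else 0)) n =
    (if n = 0 then \<one> else surface_word G u v n \<otimes> inv z, 0, 0)"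
  using assms
proof (induction n)
  case 0
  then show ?case by (simp add: twisted_product_def)
next
  case (Suc n)
  have c: "u n \<in> carrier G" "v n \<in> carrier G" "surface_word G u v n \<in> carrier G"
    using Suc.prems by (auto intro!: surface_word_closed)
  have zi: "z [^] (- 1 :: int) = inv z" using z by (simp add: int_pow_neg)
  have iz: "inv z \<otimes> y = y \<otimes> inv z" if "y \<in> carrier G" for y using int_pow_central[OF that, of "-1"] by (simp add: zi)
  show ?case
  proof (cases "n = 0")
    case True
    have "u n \<otimes> inv v n \<otimes> inv z \<otimes> inv u n \<otimes> v n = u n \<otimes> inv v n \<otimes> inv u n \<otimes> v n \<otimes> inv z"
      using c z iz by (simp add: m_assoc)
    then show ?thesis using True c z Suc
      by (simp add: twisted_product_inv twisted_product_mult zi twisted_product_one)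
  next
    case False
    then show ?thesis using c z Suc iz
      by (simp add: twisted_product_inv twisted_product_mult m_assoc)
  qed
qed

end

end

lemma (in group) hom_eq_id_on_generate:
  assumes h: "h \<in> hom G G" and gen: "generate G X' = carrier G" and X: "X' \<subseteq> carrier G" "\<And>x. x \<in> X' \<Longrightarrow> h x = x"
    and x: "x \<in> carrier G"
  shows "h x = x"
proof -
  interpret h: group_hom G G h using h by unfold_locales
  have "x \<in> generate G X'" using x gen by simp
  then show ?thesis
  proof (induction rule: generate.induct)
    case (eng h1 h2)
    then show ?case using X generate_in_carrier[OF X(1)] by simp
  qed (use X in auto)
qed

lemma surface_central_section:
  fixes \<Gamma> :: "('b, 'y) monoid_scheme" and G :: "('c, 'z) monoid_scheme"
  assumes G: "surface_group g G" and \<Gamma>: "group \<Gamma>"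
    and \<phi>: "\<phi> \<in> hom \<Gamma> G" "\<phi> ` carrier \<Gamma> = carrier G"
    and central: "\<And>x y. x \<in> carrier \<Gamma> \<Longrightarrow> \<phi> x = \<one>\<^bsub>G\<^esub> \<Longrightarrow> y \<in> carrier \<Gamma> \<Longrightarrow> x \<otimes>\<^bsub>\<Gamma>\<^esub> y = y \<otimes>\<^bsub>\<Gamma>\<^esub> x"
    and e: "\<And>x. x \<in> carrier \<Gamma> \<Longrightarrow> \<phi> x = \<one>\<^bsub>G\<^esub> \<Longrightarrow> x [^]\<^bsub>\<Gamma>\<^esub> (e::nat) = \<one>\<^bsub>\<Gamma>\<^esub>"
  shows "\<exists>f \<alpha>. \<alpha> \<in> hom G integer_group \<and> \<alpha> ` carrier G = UNIV \<and>
    (\<forall>x\<in>carrier G. f x \<in> carrier \<Gamma> \<and> \<phi> (f x) = x) \<and>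
    (\<forall>x\<in>carrier G. \<forall>y\<in>carrier G. int e dvd \<alpha> x \<longrightarrow> f (x \<otimes>\<^bsub>G\<^esub> y) = f x \<otimes>\<^bsub>\<Gamma>\<^esub> f y)"
proof -
  interpret \<Gamma>: group \<Gamma> by (rule \<Gamma>)
  interpret G: group G using G by (simp add: surface_group_def)
  interpret \<phi>: group_hom \<Gamma> G \<phi> using \<phi> by unfold_locales
  have g: "2 \<le> g" using G by (simp add: surface_group_def)
  obtain a b where ab: "\<forall>j<g. a j \<in> carrier G \<and> b j \<in> carrier G"
    and gen: "generate G (a ` {..<g} \<union> b ` {..<g}) = carrier G"
    and word: "surface_word G a b g = \<one>\<^bsub>G\<^esub>"
    and univ: "\<forall>(Q :: ('b \<times> int \<times> int) monoid) U V. group Q \<longrightarrow> (\<forall>j<g. U j \<in> carrier Q \<and> V j \<in> carrier Q) \<longrightarrow>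
       surface_word Q U V g = \<one>\<^bsub>Q\<^esub> \<longrightarrow> (\<exists>h\<in>hom G Q. \<forall>j<g. h (a j) = U j \<and> h (b j) = V j)"
    using surface_group_presentation[OF G] by blast
  have "\<forall>j. \<exists>u. j < g \<longrightarrow> u \<in> carrier \<Gamma> \<and> \<phi> u = a j"
    using ab \<phi>(2) by (metis imageE)
  then obtain u where u: "\<And>j. j < g \<Longrightarrow> u j \<in> carrier \<Gamma> \<and> \<phi> (u j) = a j" by metis
  have "\<forall>j. \<exists>v. j < g \<longrightarrow> v \<in> carrier \<Gamma> \<and> \<phi> v = b j"
    using ab \<phi>(2) by (metis imageE)
  then obtain v where v: "\<And>j. j < g \<Longrightarrow> v j \<in> carrier \<Gamma> \<and> \<phi> (v j) = b j" by metis
  define z where "z = surface_word \<Gamma> u v g"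
  have z: "z \<in> carrier \<Gamma>" unfolding z_def using u v by (intro \<Gamma>.surface_word_closed) auto
  have word_cong: "surface_word G c d n = surface_word G c' d' n"
    if "\<And>j. j < n \<Longrightarrow> c j = c' j \<and> d j = d' j" for c d c' d' n
    using that by (induction n) auto
  have "\<phi> z = surface_word G (\<phi> \<circ> u) (\<phi> \<circ> v) g"
    unfolding z_def using u v by (intro \<phi>.hom_surface_word) auto
  also have "\<dots> = surface_word G a b g" using u v by (intro word_cong) auto
  finally have \<phi>z: "\<phi> z = \<one>\<^bsub>G\<^esub>" using word by simp
  have zc: "z \<otimes>\<^bsub>\<Gamma>\<^esub> y = y \<otimes>\<^bsub>\<Gamma>\<^esub> z" if "y \<in> carrier \<Gamma>" for y
    using central[OF z \<phi>z that] .
  let ?Q = "twisted_product \<Gamma> z"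
  let ?U = "\<lambda>j. (u j, if j = 0 then 1 else 0, 0)" and ?V = "\<lambda>j. (v j, 0, if j = 0 then 1 else 0)"
  have "group ?Q" by (rule \<Gamma>.group_twisted_product[OF z zc])
  moreover have "surface_word ?Q ?U ?V g = \<one>\<^bsub>?Q\<^esub>"
    using \<Gamma>.twisted_surface_word[OF z zc, of g u v] u v g z by (simp add: twisted_product_def z_def[symmetric])
  moreover have "\<forall>j<g. ?U j \<in> carrier ?Q \<and> ?V j \<in> carrier ?Q" using u v by (simp add: twisted_product_def)
  ultimately have "\<exists>h\<in>hom G ?Q. \<forall>j<g. h (a j) = ?U j \<and> h (b j) = ?V j"
    using univ[THEN spec[of _ ?Q], THEN spec[of _ ?U], THEN spec[of _ ?V]] by (elim impE) assumption+
  then obtain h where h: "h \<in> hom G ?Q" and hab: "\<forall>j<g. h (a j) = ?U j \<and> h (b j) = ?V j"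
    by (elim bexE)
  define f \<alpha> \<beta> where "f x = fst (h x)" and "\<alpha> x = fst (snd (h x))" and "\<beta> x = snd (snd (h x))" for x
  have hx: "h x = (f x, \<alpha> x, \<beta> x)" for x by (simp add: f_def \<alpha>_def \<beta>_def)
  have fc: "f x \<in> carrier \<Gamma>" if "x \<in> carrier G" for x
    using hom_in_carrier[OF h that] by (simp add: hx twisted_product_def)
  have hm: "f (x \<otimes>\<^bsub>G\<^esub> y) = f x \<otimes>\<^bsub>\<Gamma>\<^esub> f y \<otimes>\<^bsub>\<Gamma>\<^esub> z [^]\<^bsub>\<Gamma>\<^esub> (\<alpha> x * \<beta> y) \<and> \<alpha> (x \<otimes>\<^bsub>G\<^esub> y) = \<alpha> x + \<alpha> y"
    if "x \<in> carrier G" "y \<in> carrier G" for x y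
    using hom_mult[OF h that] by (simp add: hx twisted_product_def)
  have \<alpha>: "\<alpha> \<in> hom G integer_group" using hm by (auto intro!: homI)
  have "\<alpha> ` carrier G = UNIV"
  proof -
    interpret \<alpha>: group_hom G integer_group \<alpha> using \<alpha> by (intro group_hom.intro group_hom_axioms.intro) auto
    have a0: "a 0 \<in> carrier G" "\<alpha> (a 0) = 1" using ab hab g by (auto simp: \<alpha>_def)
    have "\<alpha> (a 0 [^]\<^bsub>G\<^esub> k) = k" for k :: int
      using \<alpha>.hom_int_pow[OF a0(1), of k] a0(2) by simp
    then show ?thesis using a0(1) by (metis G.int_pow_closed UNIV_eq_I image_eqI)
  qed
  moreover have "\<phi> (f x) = x" if x: "x \<in> carrier G" for x
  proof -
    have "\<phi> (z [^]\<^bsub>\<Gamma>\<^esub> k) = \<one>\<^bsub>G\<^esub>" for k :: int using z \<phi>z by (simp add: \<phi>.hom_int_pow)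
    then have "(\<lambda>x. \<phi> (f x)) \<in> hom G G" using fc hm z by (auto intro!: homI)
    then show ?thesis
      by (rule G.hom_eq_id_on_generate[OF _ gen]) (use ab hab u v x in \<open>auto simp: f_def\<close>)
  qed
  moreover have "f (x \<otimes>\<^bsub>G\<^esub> y) = f x \<otimes>\<^bsub>\<Gamma>\<^esub> f y"
    if xy: "x \<in> carrier G" "y \<in> carrier G" and dv: "int e dvd \<alpha> x" for x y
  proof -
    obtain k where k: "\<alpha> x = int e * k" using dv by (auto elim: dvdE)
    have "z [^]\<^bsub>\<Gamma>\<^esub> (\<alpha> x * \<beta> y) = (z [^]\<^bsub>\<Gamma>\<^esub> int e) [^]\<^bsub>\<Gamma>\<^esub> (k * \<beta> y)"
      using z by (simp add: k \<Gamma>.int_pow_pow mult.assoc)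
    also have "z [^]\<^bsub>\<Gamma>\<^esub> int e = \<one>\<^bsub>\<Gamma>\<^esub>" using e[OF z \<phi>z] by (simp add: int_pow_int)
    finally show ?thesis using hm[OF xy] fc xy by simp
  qed
  ultimately show ?thesis using \<alpha> fc by (intro exI[of _ f] exI[of _ \<alpha>]) blast
qed

lemma central_extensionD:
  assumes "central_extension A \<Gamma> G \<iota> \<phi>"
  shows "group A" "group \<Gamma>" "group G" "\<iota> \<in> hom A \<Gamma>" "inj_on \<iota> (carrier A)" "\<phi> \<in> hom \<Gamma> G"
    "\<phi> ` carrier \<Gamma> = carrier G"
    "\<And>x. x \<in> carrier \<Gamma> \<Longrightarrow> \<phi> x = \<one>\<^bsub>G\<^esub> \<longleftrightarrow> x \<in> \<iota> ` carrier A"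
    "\<And>a x. a \<in> carrier A \<Longrightarrow> x \<in> carrier \<Gamma> \<Longrightarrow> \<iota> a \<otimes>\<^bsub>\<Gamma>\<^esub> x = x \<otimes>\<^bsub>\<Gamma>\<^esub> \<iota> a"
    "\<And>a. a \<in> carrier A \<Longrightarrow> \<phi> (\<iota> a) = \<one>\<^bsub>G\<^esub>"
  using assms unfolding central_extension_def kernel_def by blast+

lemma subgroup_preimage:
  assumes "group_hom \<Gamma> G \<phi>" "subgroup H G"
  shows "subgroup (preimage_subgroup \<Gamma> \<phi> H) \<Gamma>"
proof -
  interpret group_hom \<Gamma> G \<phi> by (rule assms)
  interpret H: subgroup H G by (rule assms)
  show ?thesis
    by (rule G.subgroupI) (auto simp: preimage_subgroup_def intro!: exI[of _ "\<one>\<^bsub>\<Gamma>\<^esub>"])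
qed

lemma trivial_extension_of_section:
  assumes ext: "central_extension A \<Gamma> G \<iota> \<phi>" and H: "subgroup H G"
    and f: "\<And>x. x \<in> H \<Longrightarrow> f x \<in> carrier \<Gamma> \<and> \<phi> (f x) = x"
    and hom: "\<And>x y. x \<in> H \<Longrightarrow> y \<in> H \<Longrightarrow> f (x \<otimes>\<^bsub>G\<^esub> y) = f x \<otimes>\<^bsub>\<Gamma>\<^esub> f y"
  shows "trivial_extension A (\<Gamma>\<lparr>carrier := preimage_subgroup \<Gamma> \<phi> H\<rparr>) (G\<lparr>carrier := H\<rparr>) \<iota> \<phi>"
proof -
  note D = central_extensionD[OF ext]
  interpret A: group A by (rule D)
  interpret \<Gamma>: group \<Gamma> by (rule D)
  interpret G: group G by (rule D)
  interpret \<iota>: group_hom A \<Gamma> \<iota> using D by unfold_locales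
  interpret \<phi>: group_hom \<Gamma> G \<phi> using D by unfold_locales
  interpret H: subgroup H G by (rule H)
  define \<theta> where "\<theta> = (\<lambda>(a, x). \<iota> a \<otimes>\<^bsub>\<Gamma>\<^esub> f x)"
  have f1: "f \<one>\<^bsub>G\<^esub> = \<one>\<^bsub>\<Gamma>\<^esub>"
    using hom[of "\<one>\<^bsub>G\<^esub>" "\<one>\<^bsub>G\<^esub>"] f[of "\<one>\<^bsub>G\<^esub>"] by (simp add: \<Gamma>.l_cancel_one)
  have \<phi>\<theta>: "\<phi> (\<theta> (a, x)) = x" if "a \<in> carrier A" "x \<in> H" for a x
    using that f[of x] D(10) by (simp add: \<theta>_def)
  have c: "\<theta> (a, x) \<in> preimage_subgroup \<Gamma> \<phi> H" if "a \<in> carrier A" "x \<in> H" for a x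
    using that f[of x] \<phi>\<theta>[OF that] by (simp add: \<theta>_def preimage_subgroup_def)
  have "\<theta> \<in> iso (A \<times>\<times> G\<lparr>carrier := H\<rparr>) (\<Gamma>\<lparr>carrier := preimage_subgroup \<Gamma> \<phi> H\<rparr>)"
  proof (rule isoI)
    show "\<theta> \<in> hom (A \<times>\<times> G\<lparr>carrier := H\<rparr>) (\<Gamma>\<lparr>carrier := preimage_subgroup \<Gamma> \<phi> H\<rparr>)"
    proof (rule homI)
      show "\<theta> p \<in> carrier (\<Gamma>\<lparr>carrier := preimage_subgroup \<Gamma> \<phi> H\<rparr>)" if "p \<in> carrier (A \<times>\<times> G\<lparr>carrier := H\<rparr>)" for p
        using that c by auto
      show "\<theta> (p \<otimes>\<^bsub>A \<times>\<times> G\<lparr>carrier := H\<rparr>\<^esub> r) = \<theta> p \<otimes>\<^bsub>\<Gamma>\<lparr>carrier := preimage_subgroup \<Gamma> \<phi> H\<rparr>\<^esub> \<theta> r"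
        if pr: "p \<in> carrier (A \<times>\<times> G\<lparr>carrier := H\<rparr>)" "r \<in> carrier (A \<times>\<times> G\<lparr>carrier := H\<rparr>)" for p r
      proof -
        obtain a x b y where ab: "p = (a, x)" "r = (b, y)" "a \<in> carrier A" "b \<in> carrier A" "x \<in> H" "y \<in> H"
          using pr by auto
        have fx: "f x \<in> carrier \<Gamma>" "f y \<in> carrier \<Gamma>" "\<iota> a \<in> carrier \<Gamma>" "\<iota> b \<in> carrier \<Gamma>" using ab f by auto
        have "\<iota> (a \<otimes>\<^bsub>A\<^esub> b) \<otimes>\<^bsub>\<Gamma>\<^esub> f (x \<otimes>\<^bsub>G\<^esub> y) = \<iota> a \<otimes>\<^bsub>\<Gamma>\<^esub> (\<iota> b \<otimes>\<^bsub>\<Gamma>\<^esub> f x) \<otimes>\<^bsub>\<Gamma>\<^esub> f y"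
          using ab fx by (simp add: hom \<Gamma>.m_assoc)
        also have "\<dots> = (\<iota> a \<otimes>\<^bsub>\<Gamma>\<^esub> f x) \<otimes>\<^bsub>\<Gamma>\<^esub> (\<iota> b \<otimes>\<^bsub>\<Gamma>\<^esub> f y)"
          using D(9)[OF ab(4) fx(1)] fx by (simp add: \<Gamma>.m_assoc)
        finally show ?thesis by (simp add: ab \<theta>_def)
      qed
    qed
    show "bij_betw \<theta> (carrier (A \<times>\<times> G\<lparr>carrier := H\<rparr>)) (carrier (\<Gamma>\<lparr>carrier := preimage_subgroup \<Gamma> \<phi> H\<rparr>))"
      unfolding bij_betw_def
    proof
      show "inj_on \<theta> (carrier (A \<times>\<times> G\<lparr>carrier := H\<rparr>))"
      proof (rule inj_onI)
        fix p r assume pr: "p \<in> carrier (A \<times>\<times> G\<lparr>carrier := H\<rparr>)" "r \<in> carrier (A \<times>\<times> G\<lparr>carrier := H\<rparr>)" "\<theta> p = \<theta> r"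
        obtain a x b y where ab: "p = (a, x)" "r = (b, y)" "a \<in> carrier A" "b \<in> carrier A" "x \<in> H" "y \<in> H"
          using pr by auto
        have "x = y" using \<phi>\<theta>[OF ab(3,5)] \<phi>\<theta>[OF ab(4,6)] pr(3) ab by simp
        moreover have "\<iota> a = \<iota> b"
          using pr(3) ab f[of y] \<open>x = y\<close> by (simp add: \<theta>_def)
        ultimately show "p = r" using D(5) ab by (simp add: inj_on_eq_iff)
      qed
      show "\<theta> ` carrier (A \<times>\<times> G\<lparr>carrier := H\<rparr>) = carrier (\<Gamma>\<lparr>carrier := preimage_subgroup \<Gamma> \<phi> H\<rparr>)"
      proof
        show "\<theta> ` carrier (A \<times>\<times> G\<lparr>carrier := H\<rparr>) \<subseteq> carrier (\<Gamma>\<lparr>carrier := preimage_subgroup \<Gamma> \<phi> H\<rparr>)"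
          using c by auto
        show "carrier (\<Gamma>\<lparr>carrier := preimage_subgroup \<Gamma> \<phi> H\<rparr>) \<subseteq> \<theta> ` carrier (A \<times>\<times> G\<lparr>carrier := H\<rparr>)"
        proof
          fix y assume "y \<in> carrier (\<Gamma>\<lparr>carrier := preimage_subgroup \<Gamma> \<phi> H\<rparr>)"
          then have y: "y \<in> carrier \<Gamma>" "\<phi> y \<in> H" by (auto simp: preimage_subgroup_def)
          have fy: "f (\<phi> y) \<in> carrier \<Gamma>" "\<phi> (f (\<phi> y)) = \<phi> y" using f y by auto
          then have "\<phi> (y \<otimes>\<^bsub>\<Gamma>\<^esub> inv\<^bsub>\<Gamma>\<^esub> f (\<phi> y)) = \<one>\<^bsub>G\<^esub>" using y by simp
          then obtain a where a: "a \<in> carrier A" "y \<otimes>\<^bsub>\<Gamma>\<^esub> inv\<^bsub>\<Gamma>\<^esub> f (\<phi> y) = \<iota> a"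
            using D(8)[of "y \<otimes>\<^bsub>\<Gamma>\<^esub> inv\<^bsub>\<Gamma>\<^esub> f (\<phi> y)"] y fy by auto
          have "\<theta> (a, \<phi> y) = y" using fy y by (simp add: \<theta>_def a(2)[symmetric] \<Gamma>.m_assoc)
          then show "y \<in> \<theta> ` carrier (A \<times>\<times> G\<lparr>carrier := H\<rparr>)" using a(1) y(2) by (intro image_eqI[of _ _ "(a, \<phi> y)"]) auto
        qed
      qed
    qed
  qed
  moreover have "\<theta> (a, \<one>\<^bsub>G\<^esub>) = \<iota> a" if "a \<in> carrier A" for a
    using that by (simp add: \<theta>_def f1)
  ultimately have "trivialization A (\<Gamma>\<lparr>carrier := preimage_subgroup \<Gamma> \<phi> H\<rparr>) (G\<lparr>carrier := H\<rparr>) \<iota> \<phi> \<theta>"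
    unfolding trivialization_def using \<phi>\<theta> by simp
  then show ?thesis unfolding trivial_extension_def by blast
qed

lemma cyclic_integer_mod_group: "cyclic_group (integer_mod_group n)"
proof -
  have "(\<lambda>k. k mod int n) \<in> epi integer_group (integer_mod_group n)"
  proof -
    have "(\<lambda>k. k mod int n) \<in> hom integer_group (integer_mod_group n)"
      by (rule homI) (auto simp: carrier_integer_mod_group mod_simps)
    moreover have "(\<lambda>k. k mod int n) ` UNIV = carrier (integer_mod_group n)"
    proof
      show "carrier (integer_mod_group n) \<subseteq> (\<lambda>k. k mod int n) ` UNIV"
      proof
        fix k assume "k \<in> carrier (integer_mod_group n)"
        then have "k = k mod int n" by (simp add: carrier_integer_mod_group split: if_splits)
        then show "k \<in> range (\<lambda>k. k mod int n)" by (rule image_eqI) simp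
      qed
    qed (auto simp: carrier_integer_mod_group)
    ultimately show ?thesis by (simp add: epi_def)
  qed
  then show ?thesis
    by (rule group.cyclic_group_epimorphic_image[OF group_integer_group]) auto
qed

lemma (in group) mod_hom_kernel:
  assumes \<alpha>: "\<alpha> \<in> hom G integer_group" "\<alpha> ` carrier G = UNIV" and e: "0 < e"
  defines "H \<equiv> {x \<in> carrier G. int e dvd \<alpha> x}"
  shows "H \<lhd> G" "cyclic_group (G Mod H)" "order (G Mod H) = e"
proof -
  let ?Z = "integer_mod_group e"
  define \<kappa> where "\<kappa> x = \<alpha> x mod int e" for x
  have \<kappa>: "\<kappa> \<in> hom G ?Z"
    using e hom_mult[OF \<alpha>(1)] by (intro homI) (auto simp: \<kappa>_def carrier_integer_mod_group mod_simps)
  have im: "\<kappa> ` carrier G = carrier ?Z"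
  proof
    show "\<kappa> ` carrier G \<subseteq> carrier ?Z" using hom_in_carrier[OF \<kappa>] by blast
    show "carrier ?Z \<subseteq> \<kappa> ` carrier G"
    proof
      fix k assume k: "k \<in> carrier ?Z"
      obtain x where "x \<in> carrier G" "\<alpha> x = k" using \<alpha>(2) by (metis UNIV_I imageE)
      then show "k \<in> \<kappa> ` carrier G" using k e by (intro image_eqI[of _ _ x]) (auto simp: \<kappa>_def carrier_integer_mod_group)
    qed
  qed
  interpret \<kappa>: group_hom G ?Z \<kappa>
    using \<kappa> by (intro group_hom.intro group_hom_axioms.intro) auto
  have H: "kernel G ?Z \<kappa> = H" by (auto simp: kernel_def H_def \<kappa>_def dvd_eq_mod_eq_0)
  show n: "H \<lhd> G" using \<kappa>.normal_kernel H by simp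
  have iso: "(\<lambda>D. the_elem (\<kappa> ` D)) \<in> iso (G Mod H) ?Z" using \<kappa>.FactGroup_iso_set[OF im] H by simp
  then have "G Mod H \<cong> ?Z" by (rule is_isoI)
  then show "cyclic_group (G Mod H)"
    using isomorphic_group_cyclicity[of "G Mod H" ?Z] normal.factorgroup_is_group[OF n] cyclic_integer_mod_group by simp
  have "card (carrier (G Mod H)) = card (carrier ?Z)"
    using iso by (auto simp: iso_def intro: bij_betw_same_card)
  then show "order (G Mod H) = e" using e by (simp add: order_def carrier_integer_mod_group)
qed

section \<open>Counting conjugates\<close>

definition conj_set :: "('b, 'y) monoid_scheme \<Rightarrow> 'b \<Rightarrow> 'b set \<Rightarrow> 'b set" where
  "conj_set G x C = (\<lambda>k. x \<otimes>\<^bsub>G\<^esub> k \<otimes>\<^bsub>G\<^esub> inv\<^bsub>G\<^esub> x) ` C"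

lemma (in group) normalizer_iff:
  assumes "C \<subseteq> carrier G"
  shows "x \<in> normalizer G C \<longleftrightarrow> x \<in> carrier G \<and> conj_set G x C = C"
proof -
  have "x <# C #> inv x = conj_set G x C"
    by (auto simp: l_coset_def r_coset_def conj_set_def)
  then show ?thesis using assms by (simp add: normalizer_def stabilizer_def)
qed

lemma (in group) conj_set_mult:
  assumes "x \<in> carrier G" "y \<in> carrier G" "C \<subseteq> carrier G"
  shows "conj_set G x (conj_set G y C) = conj_set G (x \<otimes> y) C"
  unfolding conj_set_def image_image
  by (rule image_cong) (use assms in \<open>auto simp: m_assoc inv_mult_group subset_iff\<close>)

lemma (in group) conj_set_one: "C \<subseteq> carrier G \<Longrightarrow> conj_set G \<one> C = C"
  unfolding conj_set_def by (auto simp: subset_iff image_iff)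

lemma (in group) card_rcosets_normalizer_le:
  assumes C: "C \<subseteq> carrier G" and fin: "finite \<C>" and conj: "\<And>x. x \<in> carrier G \<Longrightarrow> conj_set G x C \<in> \<C>"
  shows "finite (rcosets (normalizer G C)) \<and> card (rcosets (normalizer G C)) \<le> card \<C>"
proof -
  let ?N = "normalizer G C"
  define c where "c x = conj_set G (inv x) C" for x
  have sub: "subgroup ?N G" using normalizer_imp_subgroup[OF C] .
  have same: "?N #> x = ?N #> y" if "x \<in> carrier G" "y \<in> carrier G" "c x = c y" for x y
  proof -
    have "conj_set G (x \<otimes> inv y) C = conj_set G x (c y)"
      unfolding c_def using that C by (simp add: conj_set_mult)
    also have "\<dots> = conj_set G (x \<otimes> inv x) C"
      unfolding that(3)[symmetric] unfolding c_def using that C by (simp add: conj_set_mult)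
    also have "\<dots> = C" using that C by (simp add: conj_set_one)
    finally have "x \<otimes> inv y \<in> ?N" using that C by (simp add: normalizer_iff)
    then have "x \<in> ?N #> y"
      using that unfolding r_coset_def by (intro UN_I[of "x \<otimes> inv y"]) (simp_all add: m_assoc)
    then show ?thesis using repr_independence[OF _ that(2) sub] by simp
  qed
  define r where "r D = ?N #> (SOME x. x \<in> carrier G \<and> c x = D)" for D
  have "rcosets ?N \<subseteq> r ` \<C>"
  proof
    fix M assume "M \<in> rcosets ?N"
    then obtain x where x: "x \<in> carrier G" "M = ?N #> x" by (auto simp: RCOSETS_def)
    define y where "y = (SOME y. y \<in> carrier G \<and> c y = c x)"
    have "y \<in> carrier G \<and> c y = c x" unfolding y_def by (rule someI[of _ x]) (use x in simp)
    then have "M = r (c x)" using same[of y x] x by (simp add: r_def y_def)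
    moreover have "c x \<in> \<C>" unfolding c_def using x by (intro conj) simp
    ultimately show "M \<in> r ` \<C>" by blast
  qed
  then show ?thesis
    using fin by (meson card_image_le card_mono finite_imageI finite_subset le_trans)
qed

text \<open>Schreier's generators \<open>\<rho>(m) s \<rho>(m \<kappa>(s))\<inverse>\<close> of the kernel, for a set-theoretic section \<open>\<rho>\<close> of \<open>\<kappa>\<close>.\<close>

lemma schreier:
  assumes \<kappa>: "group_hom G M \<kappa>" and surj: "\<kappa> ` carrier G = carrier M" and fin: "finite (carrier M)"
    and B: "finite B" "B \<subseteq> carrier G" "generate G B = carrier G"
  shows "\<exists>Y. finite Y \<and> Y \<subseteq> kernel G M \<kappa> \<and> card Y \<le> card (carrier M) * card B \<and> generate G Y = kernel G M \<kappa>"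
proof -
  interpret group_hom G M \<kappa> by (rule \<kappa>)
  define \<rho> where "\<rho> m = (if m = \<one>\<^bsub>M\<^esub> then \<one>\<^bsub>G\<^esub> else (SOME x. x \<in> carrier G \<and> \<kappa> x = m))" for m
  have \<rho>: "\<rho> m \<in> carrier G \<and> \<kappa> (\<rho> m) = m" if "m \<in> carrier M" for m
  proof (cases "m = \<one>\<^bsub>M\<^esub>")
    case False
    have "\<exists>x. x \<in> carrier G \<and> \<kappa> x = m" using surj that by (metis imageE)
    from someI_ex[OF this] show ?thesis using False by (simp add: \<rho>_def)
  qed (simp add: \<rho>_def)
  define y where "y m x = \<rho> m \<otimes>\<^bsub>G\<^esub> x \<otimes>\<^bsub>G\<^esub> inv\<^bsub>G\<^esub> \<rho> (m \<otimes>\<^bsub>M\<^esub> \<kappa> x)" for m x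
  define Y where "Y = (\<lambda>(m, x). y m x) ` (carrier M \<times> B)"
  have yc: "y m x \<in> kernel G M \<kappa>" if "m \<in> carrier M" "x \<in> carrier G" for m x
    using that \<rho>[of m] \<rho>[of "m \<otimes>\<^bsub>M\<^esub> \<kappa> x"] by (simp add: kernel_def y_def)
  have YK: "Y \<subseteq> kernel G M \<kappa>" using yc B(2) by (auto simp: Y_def)
  have YG: "Y \<subseteq> carrier G" using YK by (auto simp: kernel_def)
  have "y m x \<in> generate G Y" if "x \<in> generate G B" "m \<in> carrier M" for x m
    using that
  proof (induction arbitrary: m rule: generate.induct)
    case one
    then show ?case using \<rho>[of m] by (simp add: y_def generate.one)
  next
    case (incl h)
    then have "y m h \<in> Y" unfolding Y_def by (intro image_eqI[of _ _ "(m, h)"]) auto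
    then show ?case by (rule generate.incl)
  next
    case (inv h)
    have h: "h \<in> carrier G" using inv(1) B(2) by blast
    define m' where "m' = m \<otimes>\<^bsub>M\<^esub> inv\<^bsub>M\<^esub> \<kappa> h"
    have m': "m' \<in> carrier M" "m' \<otimes>\<^bsub>M\<^esub> \<kappa> h = m" using h inv(2) by (simp_all add: m'_def H.m_assoc)
    have "y m' h \<in> Y" unfolding Y_def using inv(1) m'(1) by (intro image_eqI[of _ _ "(m', h)"]) auto
    then have "inv\<^bsub>G\<^esub> y m' h \<in> generate G Y" by (rule generate.inv)
    moreover have "inv\<^bsub>G\<^esub> y m' h = y m (inv\<^bsub>G\<^esub> h)"
      using \<rho>[OF inv(2)] \<rho>[OF m'(1)] h m'(2) by (simp add: y_def m'_def[symmetric] G.inv_mult_group G.m_assoc)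
    ultimately show ?case by simp
  next
    case (eng h1 h2)
    have h: "h1 \<in> carrier G" "h2 \<in> carrier G" using eng B(3) by auto
    let ?m = "m \<otimes>\<^bsub>M\<^esub> \<kappa> h1"
    have m: "?m \<in> carrier M" "?m \<otimes>\<^bsub>M\<^esub> \<kappa> h2 \<in> carrier M" using h eng.prems by auto
    have "y m h1 \<otimes>\<^bsub>G\<^esub> y ?m h2 = y m (h1 \<otimes>\<^bsub>G\<^esub> h2)"
    proof -
      have "y m h1 \<otimes>\<^bsub>G\<^esub> y ?m h2 = ((\<rho> m \<otimes>\<^bsub>G\<^esub> h1) \<otimes>\<^bsub>G\<^esub> inv\<^bsub>G\<^esub> \<rho> ?m) \<otimes>\<^bsub>G\<^esub> (\<rho> ?m \<otimes>\<^bsub>G\<^esub> (h2 \<otimes>\<^bsub>G\<^esub> inv\<^bsub>G\<^esub> \<rho> (?m \<otimes>\<^bsub>M\<^esub> \<kappa> h2)))"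
        using \<rho>[OF eng.prems] \<rho>[OF m(1)] \<rho>[OF m(2)] h by (simp add: y_def G.m_assoc)
      also have "\<dots> = (\<rho> m \<otimes>\<^bsub>G\<^esub> h1) \<otimes>\<^bsub>G\<^esub> (h2 \<otimes>\<^bsub>G\<^esub> inv\<^bsub>G\<^esub> \<rho> (?m \<otimes>\<^bsub>M\<^esub> \<kappa> h2))"
        by (rule G.cancel_middle) (use \<rho>[OF eng.prems] \<rho>[OF m(1)] \<rho>[OF m(2)] h in auto)
      also have "\<dots> = y m (h1 \<otimes>\<^bsub>G\<^esub> h2)"
        using \<rho>[OF eng.prems] \<rho>[OF m(2)] h eng.prems by (simp add: y_def G.m_assoc H.m_assoc)
      finally show ?thesis .
    qed
    then show ?case using eng.IH(1)[OF eng.prems] eng.IH(2)[OF m(1)] generate.eng by metis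
  qed
  then have "x \<in> generate G Y" if "x \<in> kernel G M \<kappa>" for x
  proof -
    have x: "x \<in> carrier G" "\<kappa> x = \<one>\<^bsub>M\<^esub>" using that by (auto simp: kernel_def)
    then have "y \<one>\<^bsub>M\<^esub> x = x" by (simp add: y_def \<rho>_def)
    then show ?thesis using \<open>\<And>x m. x \<in> generate G B \<Longrightarrow> m \<in> carrier M \<Longrightarrow> y m x \<in> generate G Y\<close>[of x "\<one>\<^bsub>M\<^esub>"] x B(3) by simp
  qed
  moreover have "generate G Y \<subseteq> kernel G M \<kappa>"
    by (rule G.generate_subgroup_incl[OF YK subgroup_kernel])
  moreover have "card Y \<le> card (carrier M) * card B"
    unfolding Y_def using fin B(1) by (metis card_cartesian_product card_image_le finite_cartesian_product)
  moreover have "finite Y" using fin B(1) by (simp add: Y_def)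
  ultimately show ?thesis using YK by blast
qed

lemma hom_eq_on_generate:
  assumes "group_hom G M h" "group_hom G M h'" "B \<subseteq> carrier G" "\<And>b. b \<in> B \<Longrightarrow> h b = h' b" "x \<in> generate G B"
  shows "h x = h' x"
proof -
  interpret h: group_hom G M h by fact
  interpret h': group_hom G M h' by fact
  show ?thesis
    using assms(5)
  proof (induction rule: generate.induct)
    case (eng h1 h2)
    then show ?case using h.G.generate_in_carrier[OF assms(3)] by simp
  qed (use assms(3,4) in auto)
qed

lemma card_kernels_le:
  assumes G: "group G" and M: "group M" "finite (carrier M)"
    and B: "finite B" "B \<subseteq> carrier G" "generate G B = carrier G"
  shows "finite (kernel G M ` hom G M) \<and> card (kernel G M ` hom G M) \<le> card (carrier M) ^ card B"
proof -
  let ?E = "B \<rightarrow>\<^sub>E carrier M"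
  define k where "k r = kernel G M (SOME \<kappa>. \<kappa> \<in> hom G M \<and> restrict \<kappa> B = r)" for r
  have "kernel G M ` hom G M \<subseteq> k ` ?E"
  proof
    fix L assume "L \<in> kernel G M ` hom G M"
    then obtain \<kappa> where \<kappa>: "\<kappa> \<in> hom G M" "L = kernel G M \<kappa>" by blast
    define \<kappa>' where "\<kappa>' = (SOME \<kappa>'. \<kappa>' \<in> hom G M \<and> restrict \<kappa>' B = restrict \<kappa> B)"
    have \<kappa>': "\<kappa>' \<in> hom G M \<and> restrict \<kappa>' B = restrict \<kappa> B"
      unfolding \<kappa>'_def by (rule someI[of _ \<kappa>]) (use \<kappa> in simp)
    have "\<kappa>' x = \<kappa> x" if "x \<in> carrier G" for x
    proof (rule hom_eq_on_generate[of G M _ _ B])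
      show "\<kappa>' b = \<kappa> b" if "b \<in> B" for b using \<kappa>' that by (metis restrict_apply')
    qed (use G M B \<kappa> \<kappa>' that in \<open>auto simp: group_hom_def group_hom_axioms_def\<close>)
    then have "L = k (restrict \<kappa> B)" using \<kappa> unfolding k_def \<kappa>'_def[symmetric] by (auto simp: kernel_def)
    moreover have "restrict \<kappa> B \<in> ?E" using \<kappa> B(2) by (auto dest: hom_in_carrier)
    ultimately show "L \<in> k ` ?E" by blast
  qed
  moreover have "finite ?E" using B M by (intro finite_PiE) auto
  moreover have "card ?E = card (carrier M) ^ card B" using B by (simp add: card_PiE)
  ultimately show ?thesis
    by (metis card_image_le card_mono finite_imageI finite_subset le_trans)
qed

lemma card_sections_le:
  assumes \<phi>: "group_hom \<Gamma> G \<phi>" and Y: "finite Y" "Y \<subseteq> carrier G" "generate G Y = L"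
    and fibre: "\<And>y. y \<in> Y \<Longrightarrow> finite {x \<in> carrier \<Gamma>. \<phi> x = y} \<and> card {x \<in> carrier \<Gamma>. \<phi> x = y} \<le> a"
  shows "finite {C. subgroup C \<Gamma> \<and> \<phi> ` C = L \<and> inj_on \<phi> C} \<and>
    card {C. subgroup C \<Gamma> \<and> \<phi> ` C = L \<and> inj_on \<phi> C} \<le> a ^ card Y"
proof -
  interpret group_hom \<Gamma> G \<phi> by (rule \<phi>)
  let ?E = "Pi\<^sub>E Y (\<lambda>y. {x \<in> carrier \<Gamma>. \<phi> x = y})"
  have "{C. subgroup C \<Gamma> \<and> \<phi> ` C = L \<and> inj_on \<phi> C} \<subseteq> (\<lambda>r. generate \<Gamma> (r ` Y)) ` ?E"
  proof
    fix C assume "C \<in> {C. subgroup C \<Gamma> \<and> \<phi> ` C = L \<and> inj_on \<phi> C}"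
    then have C: "subgroup C \<Gamma>" "\<phi> ` C = L" "inj_on \<phi> C" by auto
    define \<sigma> where "\<sigma> = restrict (inv_into C \<phi>) Y"
    have YL: "Y \<subseteq> L" using Y(3) generate.incl[of _ Y G] by blast
    have \<sigma>: "\<sigma> y \<in> C \<and> \<phi> (\<sigma> y) = y" if "y \<in> Y" for y
    proof -
      have "y \<in> \<phi> ` C" using YL C(2) that by blast
      then show ?thesis using that by (simp add: \<sigma>_def inv_into_into f_inv_into_f)
    qed
    have CG: "C \<subseteq> carrier \<Gamma>" using subgroup.subset[OF C(1)] .
    have sub: "generate \<Gamma> (\<sigma> ` Y) \<subseteq> C" using \<sigma> C(1) by (intro G.generate_subgroup_incl) auto
    have "\<phi> ` generate \<Gamma> (\<sigma> ` Y) = generate G (\<phi> ` \<sigma> ` Y)"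
      by (rule generate_img[symmetric]) (use \<sigma> CG in auto)
    also have "\<phi> ` \<sigma> ` Y = Y" using \<sigma> by (force simp: image_image)
    finally have "\<phi> ` generate \<Gamma> (\<sigma> ` Y) = \<phi> ` C" using Y(3) C(2) by simp
    then have "generate \<Gamma> (\<sigma> ` Y) = C" using inj_on_image_eq_iff[OF C(3) sub order_refl] by simp
    moreover have "\<sigma> \<in> ?E" using \<sigma> CG by (auto simp: \<sigma>_def PiE_def)
    ultimately show "C \<in> (\<lambda>r. generate \<Gamma> (r ` Y)) ` ?E" by blast
  qed
  moreover have "finite ?E" using Y fibre by (intro finite_PiE) auto
  moreover have "card ?E \<le> a ^ card Y"
  proof -
    have "card ?E = (\<Prod>y\<in>Y. card {x \<in> carrier \<Gamma>. \<phi> x = y})" using Y by (simp add: card_PiE)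
    also have "\<dots> \<le> (\<Prod>y\<in>Y. a)" using fibre by (intro prod_mono) auto
    finally show ?thesis by simp
  qed
  ultimately show ?thesis
    by (meson card_image_le card_mono finite_imageI finite_subset le_trans)
qed

lemma card_Union_le_mult:
  assumes "finite I" "card I \<le> m" "\<And>i. i \<in> I \<Longrightarrow> finite (D i) \<and> card (D i) \<le> n"
  shows "finite (\<Union>i\<in>I. D i) \<and> card (\<Union>i\<in>I. D i) \<le> m * n"
proof
  show "finite (\<Union>i\<in>I. D i)" using assms by auto
  have "card (\<Union>i\<in>I. D i) \<le> (\<Sum>i\<in>I. card (D i))" using assms(1) by (rule card_UN_le)
  also have "\<dots> \<le> (\<Sum>i\<in>I. n)" using assms(3) by (intro sum_mono) auto
  also have "\<dots> \<le> m * n" using assms(2) by simp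
  finally show "card (\<Union>i\<in>I. D i) \<le> m * n" .
qed

text \<open>
  A conjugate of \<open>i(H)\<close> is a complement to \<open>A\<close> over a conjugate of \<open>H\<close>, and the latter is again the
  kernel of a surjection onto the cyclic group of order \<open>e\<close>. So the conjugates are counted by such
  kernels together with the possible values of a section on Schreier generators.
\<close>

lemma normalizer_index_bound:
  fixes A :: "('a, 'x) monoid_scheme" and \<Gamma> :: "('b, 'y) monoid_scheme" and G :: "('c, 'z) monoid_scheme"
  assumes ext: "central_extension A \<Gamma> G \<iota> \<phi>" and A: "finite (carrier A)" and N: "N \<lhd> G"
    and B: "finite B" "B \<subseteq> N" "generate (G\<lparr>carrier := N\<rparr>) B = N"
    and \<alpha>: "\<alpha> \<in> hom (G\<lparr>carrier := N\<rparr>) integer_group" "\<alpha> ` N = UNIV" and e: "0 < e"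
    and H: "H = {x \<in> N. int e dvd \<alpha> x}"
    and \<theta>: "trivialization A (\<Gamma>\<lparr>carrier := preimage_subgroup \<Gamma> \<phi> H\<rparr>) (G\<lparr>carrier := H\<rparr>) \<iota> \<phi> \<theta>"
  shows "finite (rcosets\<^bsub>\<Gamma>\<^esub> (normalizer \<Gamma> ((\<lambda>x. \<theta> (\<one>\<^bsub>A\<^esub>, x)) ` H))) \<and>
    card (rcosets\<^bsub>\<Gamma>\<^esub> (normalizer \<Gamma> ((\<lambda>x. \<theta> (\<one>\<^bsub>A\<^esub>, x)) ` H))) \<le> e ^ card B * order A ^ (e * card B)"
proof -
  note D = central_extensionD[OF ext]
  interpret A: group A by (rule D)
  interpret \<Gamma>: group \<Gamma> by (rule D)
  interpret \<phi>: group_hom \<Gamma> G \<phi> using D by (intro group_hom.intro group_hom_axioms.intro)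
  interpret N: normal N G by (rule N)
  let ?G = "G\<lparr>carrier := N\<rparr>" and ?Z = "integer_mod_group e"
  let ?\<Gamma> = "\<Gamma>\<lparr>carrier := preimage_subgroup \<Gamma> \<phi> N\<rparr>"
  have G1: "group ?G" using \<phi>.H.subgroup_imp_group[OF N.subgroup_axioms] .
  have sub\<Gamma>: "subgroup (preimage_subgroup \<Gamma> \<phi> N) \<Gamma>"
    by (rule subgroup_preimage[OF \<phi>.group_hom_axioms N.subgroup_axioms])
  have \<Gamma>1: "group ?\<Gamma>" using \<Gamma>.subgroup_imp_group[OF sub\<Gamma>] .
  have \<phi>1: "group_hom ?\<Gamma> ?G \<phi>"
    using G1 \<Gamma>1 by (intro group_hom.intro group_hom_axioms.intro homI) (auto simp: preimage_subgroup_def)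
  have cardZ: "finite (carrier ?Z)" "card (carrier ?Z) = e" using e by (auto simp: carrier_integer_mod_group)
  have oA: "1 \<le> order A" using A A.order_gt_0_iff_finite by (simp add: Suc_le_eq)
  define \<L> where "\<L> = kernel ?G ?Z ` {\<kappa> \<in> hom ?G ?Z. \<kappa> ` N = carrier ?Z}"
  define \<S> where "\<S> L = {C. subgroup C ?\<Gamma> \<and> \<phi> ` C = L \<and> inj_on \<phi> C}" for L
  have "finite (kernel ?G ?Z ` hom ?G ?Z) \<and> card (kernel ?G ?Z ` hom ?G ?Z) \<le> e ^ card B"
    using card_kernels_le[OF G1 group_integer_mod_group cardZ(1) B(1)] B cardZ by simp
  moreover have "\<L> \<subseteq> kernel ?G ?Z ` hom ?G ?Z" by (auto simp: \<L>_def)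
  ultimately have \<L>: "finite \<L>" "card \<L> \<le> e ^ card B"
    by (auto intro: finite_subset order.trans[OF card_mono])
  have \<S>: "finite (\<S> L) \<and> card (\<S> L) \<le> order A ^ (e * card B)" if L: "L \<in> \<L>" for L
  proof -
    obtain \<kappa> where \<kappa>: "\<kappa> \<in> hom ?G ?Z" "\<kappa> ` N = carrier ?Z" "L = kernel ?G ?Z \<kappa>"
      using L by (auto simp: \<L>_def)
    have gh: "group_hom ?G ?Z \<kappa>" using \<kappa> G1 by (intro group_hom.intro group_hom_axioms.intro) auto
    obtain Y where Y: "finite Y" "Y \<subseteq> L" "card Y \<le> e * card B" "generate ?G Y = L"
      using schreier[OF gh _ cardZ(1) B(1)] \<kappa> B cardZ by auto
    have YN: "Y \<subseteq> N" using Y(2) \<kappa>(3) by (auto simp: kernel_def)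
    have fibre: "finite {x \<in> carrier ?\<Gamma>. \<phi> x = y} \<and> card {x \<in> carrier ?\<Gamma>. \<phi> x = y} \<le> order A" if y: "y \<in> N" for y
    proof -
      obtain x0 where x0: "x0 \<in> carrier \<Gamma>" "\<phi> x0 = y" using D(7) N.subset y by (metis imageE subsetD)
      have "{x \<in> carrier ?\<Gamma>. \<phi> x = y} \<subseteq> (\<lambda>a. \<iota> a \<otimes>\<^bsub>\<Gamma>\<^esub> x0) ` carrier A"
      proof
        fix x assume "x \<in> {x \<in> carrier ?\<Gamma>. \<phi> x = y}"
        then have x: "x \<in> carrier \<Gamma>" "\<phi> x = y" by (auto simp: preimage_subgroup_def)
        then have "\<phi> (x \<otimes>\<^bsub>\<Gamma>\<^esub> inv\<^bsub>\<Gamma>\<^esub> x0) = \<one>\<^bsub>G\<^esub>" using x0 by (metis \<Gamma>.inv_closed \<phi>.hom_closed \<phi>.hom_inv \<phi>.hom_mult \<phi>.H.r_inv)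
        then obtain a where a: "a \<in> carrier A" "x \<otimes>\<^bsub>\<Gamma>\<^esub> inv\<^bsub>\<Gamma>\<^esub> x0 = \<iota> a"
          using D(8)[of "x \<otimes>\<^bsub>\<Gamma>\<^esub> inv\<^bsub>\<Gamma>\<^esub> x0"] x x0 by auto
        have "x = \<iota> a \<otimes>\<^bsub>\<Gamma>\<^esub> x0" using x x0 by (simp add: a(2)[symmetric] \<Gamma>.m_assoc)
        then show "x \<in> (\<lambda>a. \<iota> a \<otimes>\<^bsub>\<Gamma>\<^esub> x0) ` carrier A" using a(1) by blast
      qed
      then show ?thesis
        using A unfolding order_def by (meson card_image_le card_mono finite_imageI finite_subset le_trans)
    qed
    have "finite (\<S> L) \<and> card (\<S> L) \<le> order A ^ card Y"
      unfolding \<S>_def by (rule card_sections_le[OF \<phi>1 Y(1) _ Y(4)]) (use YN fibre in auto)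
    moreover have "order A ^ card Y \<le> order A ^ (e * card B)" using Y(3) oA by (intro power_increasing)
    ultimately show ?thesis by (meson le_trans)
  qed
  define \<C> where "\<C> = (\<Union>L\<in>\<L>. \<S> L)"
  have \<C>: "finite \<C> \<and> card \<C> \<le> e ^ card B * order A ^ (e * card B)"
    unfolding \<C>_def by (rule card_Union_le_mult[OF \<L> \<S>])
  define s where "s x = \<theta> (\<one>\<^bsub>A\<^esub>, x)" for x
  have HN: "H \<subseteq> N" using H by blast
  have "H \<lhd> ?G" using group.mod_hom_kernel(1)[OF G1 \<alpha>(1) _ e] \<alpha>(2) H by simp
  then have GH: "group (G\<lparr>carrier := H\<rparr>)"
    using group.subgroup_imp_group[OF G1 normal_imp_subgroup] by simp
  have \<theta>hom: "\<theta> \<in> hom (A \<times>\<times> G\<lparr>carrier := H\<rparr>) (\<Gamma>\<lparr>carrier := preimage_subgroup \<Gamma> \<phi> H\<rparr>)"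
    using \<theta> by (auto simp: trivialization_def iso_def)
  have s: "s x \<in> carrier \<Gamma>" "\<phi> (s x) = x" if "x \<in> H" for x
    using hom_in_carrier[OF \<theta>hom, of "(\<one>\<^bsub>A\<^esub>, x)"] \<theta> that
    by (auto simp: s_def preimage_subgroup_def trivialization_def)
  have smult: "s (x \<otimes>\<^bsub>G\<^esub> y) = s x \<otimes>\<^bsub>\<Gamma>\<^esub> s y" if "x \<in> H" "y \<in> H" for x y
    using hom_mult[OF \<theta>hom, of "(\<one>\<^bsub>A\<^esub>, x)" "(\<one>\<^bsub>A\<^esub>, y)"] that by (simp add: s_def)
  have conj: "conj_set \<Gamma> \<gamma> (s ` H) \<in> \<C>" if \<gamma>: "\<gamma> \<in> carrier \<Gamma>" for \<gamma>
  proof -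
    define t where "t = \<phi> \<gamma>"
    have t: "t \<in> carrier G" using \<gamma> by (simp add: t_def)
    define c where "c x = \<gamma> \<otimes>\<^bsub>\<Gamma>\<^esub> s x \<otimes>\<^bsub>\<Gamma>\<^esub> inv\<^bsub>\<Gamma>\<^esub> \<gamma>" for x
    have C: "conj_set \<Gamma> \<gamma> (s ` H) = c ` H" by (simp add: conj_set_def c_def image_image)
    have \<phi>c: "\<phi> (c x) = t \<otimes>\<^bsub>G\<^esub> x \<otimes>\<^bsub>G\<^esub> inv\<^bsub>G\<^esub> t" if "x \<in> H" for x
      using s[OF that] \<gamma> by (simp add: c_def t_def)
    have cc: "c x \<in> preimage_subgroup \<Gamma> \<phi> N" if "x \<in> H" for x
      using s(1)[OF that] \<gamma> \<phi>c[OF that] N.inv_op_closed2[OF t] HN that by (auto simp: preimage_subgroup_def c_def)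
    have "c \<in> hom (G\<lparr>carrier := H\<rparr>) ?\<Gamma>"
    proof (rule homI)
      fix x y assume "x \<in> carrier (G\<lparr>carrier := H\<rparr>)" "y \<in> carrier (G\<lparr>carrier := H\<rparr>)"
      then have xy: "x \<in> H" "y \<in> H" by auto
      have "(\<gamma> \<otimes>\<^bsub>\<Gamma>\<^esub> s x \<otimes>\<^bsub>\<Gamma>\<^esub> inv\<^bsub>\<Gamma>\<^esub> \<gamma>) \<otimes>\<^bsub>\<Gamma>\<^esub> (\<gamma> \<otimes>\<^bsub>\<Gamma>\<^esub> (s y \<otimes>\<^bsub>\<Gamma>\<^esub> inv\<^bsub>\<Gamma>\<^esub> \<gamma>)) = (\<gamma> \<otimes>\<^bsub>\<Gamma>\<^esub> s x) \<otimes>\<^bsub>\<Gamma>\<^esub> (s y \<otimes>\<^bsub>\<Gamma>\<^esub> inv\<^bsub>\<Gamma>\<^esub> \<gamma>)"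
        by (rule \<Gamma>.cancel_middle) (use s[OF xy(1)] s[OF xy(2)] \<gamma> in auto)
      then show "c (x \<otimes>\<^bsub>G\<lparr>carrier := H\<rparr>\<^esub> y) = c x \<otimes>\<^bsub>?\<Gamma>\<^esub> c y"
        using s[OF xy(1)] s[OF xy(2)] \<gamma> xy by (simp add: c_def smult \<Gamma>.m_assoc)
    qed (use cc in simp)
    then interpret c: group_hom "G\<lparr>carrier := H\<rparr>" ?\<Gamma> c
      using GH \<Gamma>1 by (intro group_hom.intro group_hom_axioms.intro)
    have "subgroup (c ` H) ?\<Gamma>" using c.img_is_subgroup by simp
    moreover have "inj_on \<phi> (c ` H)"
    proof (rule inj_onI)
      fix p r assume "p \<in> c ` H" "r \<in> c ` H" "\<phi> p = \<phi> r"
      then obtain x y where xy: "x \<in> H" "y \<in> H" "p = c x" "r = c y" by blast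
      have xyG: "x \<in> carrier G" "y \<in> carrier G" using xy HN N.subset by auto
      have "t \<otimes>\<^bsub>G\<^esub> x \<otimes>\<^bsub>G\<^esub> inv\<^bsub>G\<^esub> t = t \<otimes>\<^bsub>G\<^esub> y \<otimes>\<^bsub>G\<^esub> inv\<^bsub>G\<^esub> t" using \<open>\<phi> p = \<phi> r\<close> xy \<phi>c by simp
      then have "x = y" using t xyG by simp
      then show "p = r" using xy by simp
    qed
    moreover have "\<phi> ` (c ` H) \<in> \<L>"
    proof -
      define \<kappa> where "\<kappa> y = \<alpha> (inv\<^bsub>G\<^esub> t \<otimes>\<^bsub>G\<^esub> y \<otimes>\<^bsub>G\<^esub> t) mod int e" for y
      have cN: "inv\<^bsub>G\<^esub> t \<otimes>\<^bsub>G\<^esub> y \<otimes>\<^bsub>G\<^esub> t \<in> N" if "y \<in> N" for y using N.inv_op_closed1[OF t that] .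
      have cN': "t \<otimes>\<^bsub>G\<^esub> y \<otimes>\<^bsub>G\<^esub> inv\<^bsub>G\<^esub> t \<in> N" if "y \<in> N" for y using N.inv_op_closed2[OF t that] .
      have unconj: "inv\<^bsub>G\<^esub> t \<otimes>\<^bsub>G\<^esub> (t \<otimes>\<^bsub>G\<^esub> x \<otimes>\<^bsub>G\<^esub> inv\<^bsub>G\<^esub> t) \<otimes>\<^bsub>G\<^esub> t = x" if "x \<in> N" for x
        using that N.subset t by (simp add: \<phi>.H.m_assoc \<phi>.H.inv_mult_cancel subset_iff)
      have reconj: "t \<otimes>\<^bsub>G\<^esub> (inv\<^bsub>G\<^esub> t \<otimes>\<^bsub>G\<^esub> y \<otimes>\<^bsub>G\<^esub> t) \<otimes>\<^bsub>G\<^esub> inv\<^bsub>G\<^esub> t = y" if "y \<in> N" for y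
        using that N.subset t \<phi>.H.inv_mult_cancel[of "inv\<^bsub>G\<^esub> t"] by (simp add: \<phi>.H.m_assoc subset_iff)
      have "\<kappa> \<in> hom ?G ?Z"
      proof (rule homI)
        fix x y assume "x \<in> carrier ?G" "y \<in> carrier ?G"
        then have xy: "x \<in> N" "y \<in> N" "x \<in> carrier G" "y \<in> carrier G" using N.subset by auto
        have "(inv\<^bsub>G\<^esub> t \<otimes>\<^bsub>G\<^esub> x \<otimes>\<^bsub>G\<^esub> t) \<otimes>\<^bsub>G\<^esub> (inv\<^bsub>G\<^esub> t \<otimes>\<^bsub>G\<^esub> y \<otimes>\<^bsub>G\<^esub> t) = inv\<^bsub>G\<^esub> t \<otimes>\<^bsub>G\<^esub> (x \<otimes>\<^bsub>G\<^esub> y) \<otimes>\<^bsub>G\<^esub> t"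
          using \<phi>.H.cancel_middle[of "inv\<^bsub>G\<^esub> t \<otimes>\<^bsub>G\<^esub> x" "inv\<^bsub>G\<^esub> t" "y \<otimes>\<^bsub>G\<^esub> t"] xy t by (simp add: \<phi>.H.m_assoc)
        then show "\<kappa> (x \<otimes>\<^bsub>?G\<^esub> y) = \<kappa> x \<otimes>\<^bsub>?Z\<^esub> \<kappa> y"
          using hom_mult[OF \<alpha>(1), of "inv\<^bsub>G\<^esub> t \<otimes>\<^bsub>G\<^esub> x \<otimes>\<^bsub>G\<^esub> t" "inv\<^bsub>G\<^esub> t \<otimes>\<^bsub>G\<^esub> y \<otimes>\<^bsub>G\<^esub> t"] cN xy
          by (simp add: \<kappa>_def mod_simps)
      qed (use e in \<open>simp add: \<kappa>_def carrier_integer_mod_group\<close>)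
      moreover have "\<kappa> ` N = carrier ?Z"
      proof
        show "\<kappa> ` N \<subseteq> carrier ?Z" using e by (auto simp: \<kappa>_def carrier_integer_mod_group)
        show "carrier ?Z \<subseteq> \<kappa> ` N"
        proof
          fix k assume k: "k \<in> carrier ?Z"
          obtain x where x: "x \<in> N" "\<alpha> x = k" using \<alpha>(2) by (metis UNIV_I imageE)
          then have "\<kappa> (t \<otimes>\<^bsub>G\<^esub> x \<otimes>\<^bsub>G\<^esub> inv\<^bsub>G\<^esub> t) = k"
            using k e by (simp add: \<kappa>_def unconj carrier_integer_mod_group)
          then show "k \<in> \<kappa> ` N" using cN'[OF x(1)] by blast
        qed
      qed
      moreover have "\<phi> ` (c ` H) = kernel ?G ?Z \<kappa>"
      proof
        show "\<phi> ` (c ` H) \<subseteq> kernel ?G ?Z \<kappa>"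
        proof
          fix y assume "y \<in> \<phi> ` (c ` H)"
          then obtain x where x: "x \<in> H" "y = t \<otimes>\<^bsub>G\<^esub> x \<otimes>\<^bsub>G\<^esub> inv\<^bsub>G\<^esub> t" using \<phi>c by blast
          then have "x \<in> N" "int e dvd \<alpha> x" using H by auto
          then show "y \<in> kernel ?G ?Z \<kappa>" unfolding x(2) by (simp add: kernel_def \<kappa>_def unconj cN')
        qed
        show "kernel ?G ?Z \<kappa> \<subseteq> \<phi> ` (c ` H)"
        proof
          fix y assume "y \<in> kernel ?G ?Z \<kappa>"
          then have y: "y \<in> N" "int e dvd \<alpha> (inv\<^bsub>G\<^esub> t \<otimes>\<^bsub>G\<^esub> y \<otimes>\<^bsub>G\<^esub> t)" by (auto simp: kernel_def \<kappa>_def)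
          let ?x = "inv\<^bsub>G\<^esub> t \<otimes>\<^bsub>G\<^esub> y \<otimes>\<^bsub>G\<^esub> t"
          have x: "?x \<in> H" using y cN H by simp
          then have "\<phi> (c ?x) = y" using \<phi>c[OF x] reconj[OF y(1)] by simp
          then show "y \<in> \<phi> ` (c ` H)" using x by (metis imageI)
        qed
      qed
      ultimately show ?thesis unfolding \<L>_def by blast
    qed
    ultimately show ?thesis unfolding C \<C>_def \<S>_def by blast
  qed
  have "s ` H \<subseteq> carrier \<Gamma>" using s by blast
  from \<Gamma>.card_rcosets_normalizer_le[OF this conjunct1[OF \<C>] conj] \<C>
  show ?thesis unfolding s_def by (meson le_trans)
qed

lemma group_exponent:
  assumes "group A" "finite (carrier A)"
  shows "0 < group_exponent A \<and> (\<forall>x\<in>carrier A. x [^]\<^bsub>A\<^esub> group_exponent A = \<one>\<^bsub>A\<^esub>)"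
proof -
  interpret A: group A by fact
  have "0 < order A \<and> (\<forall>x\<in>carrier A. x [^]\<^bsub>A\<^esub> order A = \<one>\<^bsub>A\<^esub>)"
    using assms(2) A.order_gt_0_iff_finite A.pow_order_eq_1 by blast
  then show ?thesis unfolding group_exponent_def by (rule LeastI)
qed

lemma order_eq_1_of_exponent:
  assumes "group A" "\<forall>x\<in>carrier A. x [^]\<^bsub>A\<^esub> (1::nat) = \<one>\<^bsub>A\<^esub>"
  shows "order A = 1"
proof -
  interpret A: group A by fact
  have "carrier A = {\<one>\<^bsub>A\<^esub>}" using assms(2) by auto
  then show ?thesis by (simp add: order_def)
qed

theorem lemma3p4:
  fixes A :: "('a, 'x) monoid_scheme"
    and \<Gamma> :: "('b, 'y) monoid_scheme"
    and G :: "('c, 'z) monoid_scheme"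
    and F :: "nat \<Rightarrow> 'c set"
    and \<iota> :: "'a \<Rightarrow> 'b" and \<phi> :: "'b \<Rightarrow> 'c"
    and R :: "'a set" and n g\<^sub>1 :: nat
  assumes "comm_group A" and "finite (carrier A)"
    and "minimal_generating_set A R"
    and "1 \<le> n" and "polysurface_filtration G n F"
    and "surface_group g\<^sub>1 (G\<lparr>carrier := F 1\<rparr>)"
    and "central_extension A \<Gamma> G \<iota> \<phi>"
  shows "\<exists>H. H \<lhd> G\<lparr>carrier := F 1\<rparr> \<and>
    cyclic_group (G\<lparr>carrier := F 1\<rparr> Mod H) \<and>
    order (G\<lparr>carrier := F 1\<rparr> Mod H) = group_exponent A \<and>
    trivial_extension A (\<Gamma>\<lparr>carrier := preimage_subgroup \<Gamma> \<phi> H\<rparr>) (G\<lparr>carrier := H\<rparr>) \<iota> \<phi> \<and>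
    (\<forall>\<theta>. trivialization A (\<Gamma>\<lparr>carrier := preimage_subgroup \<Gamma> \<phi> H\<rparr>) (G\<lparr>carrier := H\<rparr>) \<iota> \<phi> \<theta> \<longrightarrow>
      (let i = (\<lambda>x. \<theta> (\<one>\<^bsub>A\<^esub>, x));
           \<Gamma>' = normalizer \<Gamma> (i ` H);
           bound = order A ^ (2 * group_exponent A * g\<^sub>1) *
             (group_exponent A * fact (group_exponent A) ^ (2 * g\<^sub>1 + card R))
       in finite (rcosets\<^bsub>\<Gamma>\<^esub> \<Gamma>') \<and>
          card (rcosets\<^bsub>\<Gamma>\<^esub> \<Gamma>') \<le> bound \<and>
          (order A \<noteq> 1 \<longrightarrow> card (rcosets\<^bsub>\<Gamma>\<^esub> \<Gamma>') < bound)))"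
proof -
  note D = central_extensionD[OF assms(7)]
  interpret A: group A by (rule D)
  interpret \<Gamma>: group \<Gamma> by (rule D)
  interpret \<iota>: group_hom A \<Gamma> \<iota> using D by (intro group_hom.intro group_hom_axioms.intro)
  interpret \<phi>: group_hom \<Gamma> G \<phi> using D by (intro group_hom.intro group_hom_axioms.intro)
  let ?N = "F 1" and ?G = "G\<lparr>carrier := F 1\<rparr>" and ?e = "group_exponent A"
  let ?\<Gamma> = "\<Gamma>\<lparr>carrier := preimage_subgroup \<Gamma> \<phi> ?N\<rparr>"
  have N: "?N \<lhd> G" using assms(4,5) by (simp add: polysurface_filtration_def)
  interpret N: normal ?N G by (rule N)
  have G1: "group ?G" using assms(6) by (simp add: surface_group_def)
  note sub\<Gamma> = subgroup_preimage[OF \<phi>.group_hom_axioms N.subgroup_axioms]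
  have e: "0 < ?e" "\<And>x. x \<in> carrier A \<Longrightarrow> x [^]\<^bsub>A\<^esub> ?e = \<one>\<^bsub>A\<^esub>"
    using group_exponent[OF D(1) assms(2)] by auto
  have "\<exists>f \<alpha>. \<alpha> \<in> hom ?G integer_group \<and> \<alpha> ` carrier ?G = UNIV \<and>
    (\<forall>x\<in>carrier ?G. f x \<in> carrier ?\<Gamma> \<and> \<phi> (f x) = x) \<and>
    (\<forall>x\<in>carrier ?G. \<forall>y\<in>carrier ?G. int ?e dvd \<alpha> x \<longrightarrow> f (x \<otimes>\<^bsub>?G\<^esub> y) = f x \<otimes>\<^bsub>?\<Gamma>\<^esub> f y)"
  proof (rule surface_central_section[OF assms(6)])
    show "group ?\<Gamma>" by (rule \<Gamma>.subgroup_imp_group[OF sub\<Gamma>])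
    show "\<phi> \<in> hom ?\<Gamma> ?G" by (rule homI) (auto simp: preimage_subgroup_def)
    show "\<phi> ` carrier ?\<Gamma> = carrier ?G"
    proof
      show "carrier ?G \<subseteq> \<phi> ` carrier ?\<Gamma>"
      proof
        fix y assume "y \<in> carrier ?G"
        then have "y \<in> ?N" "y \<in> \<phi> ` carrier \<Gamma>" using N.subset D(7) by auto
        then show "y \<in> \<phi> ` carrier ?\<Gamma>" by (auto simp: preimage_subgroup_def)
      qed
    qed (auto simp: preimage_subgroup_def)
    show "x \<otimes>\<^bsub>?\<Gamma>\<^esub> y = y \<otimes>\<^bsub>?\<Gamma>\<^esub> x"
      if "x \<in> carrier ?\<Gamma>" "\<phi> x = \<one>\<^bsub>?G\<^esub>" "y \<in> carrier ?\<Gamma>" for x y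
      using that D(8)[of x] D(9)[of _ y] by (auto simp: preimage_subgroup_def)
    show "x [^]\<^bsub>?\<Gamma>\<^esub> ?e = \<one>\<^bsub>?\<Gamma>\<^esub>" if x: "x \<in> carrier ?\<Gamma>" "\<phi> x = \<one>\<^bsub>?G\<^esub>" for x
    proof -
      obtain a where a: "a \<in> carrier A" "x = \<iota> a" using x D(8)[of x] by (auto simp: preimage_subgroup_def)
      have "x [^]\<^bsub>\<Gamma>\<^esub> ?e = \<one>\<^bsub>\<Gamma>\<^esub>"
        using \<iota>.hom_nat_pow[OF a(1), of ?e] e(2)[OF a(1)] a(2) by simp
      then show ?thesis using \<Gamma>.nat_pow_consistent[of x ?e "preimage_subgroup \<Gamma> \<phi> ?N"] by simp
    qed
  qed
  then obtain f \<alpha> where "\<alpha> \<in> hom ?G integer_group" "\<alpha> ` carrier ?G = UNIV"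
    "\<forall>x\<in>carrier ?G. f x \<in> carrier ?\<Gamma> \<and> \<phi> (f x) = x"
    "\<forall>x\<in>carrier ?G. \<forall>y\<in>carrier ?G. int ?e dvd \<alpha> x \<longrightarrow> f (x \<otimes>\<^bsub>?G\<^esub> y) = f x \<otimes>\<^bsub>?\<Gamma>\<^esub> f y"
    by blast
  then have \<alpha>: "\<alpha> \<in> hom ?G integer_group" "\<alpha> ` ?N = UNIV"
    and f: "\<And>x. x \<in> ?N \<Longrightarrow> f x \<in> carrier \<Gamma> \<and> \<phi> (f x) = x"
    and fmult: "\<And>x y. x \<in> ?N \<Longrightarrow> y \<in> ?N \<Longrightarrow> int ?e dvd \<alpha> x \<Longrightarrow> f (x \<otimes>\<^bsub>G\<^esub> y) = f x \<otimes>\<^bsub>\<Gamma>\<^esub> f y"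
    by (auto simp: preimage_subgroup_def)
  define H where "H = {x \<in> ?N. int ?e dvd \<alpha> x}"
  have H: "H \<lhd> ?G" "cyclic_group (?G Mod H)" "order (?G Mod H) = ?e"
    using group.mod_hom_kernel[OF G1 \<alpha>(1) _ e(1)] \<alpha>(2) by (simp_all add: H_def)
  have subH: "subgroup H G"
    using \<phi>.H.incl_subgroup[OF N.subgroup_axioms normal_imp_subgroup[OF H(1)]] .
  have triv: "trivial_extension A (\<Gamma>\<lparr>carrier := preimage_subgroup \<Gamma> \<phi> H\<rparr>) (G\<lparr>carrier := H\<rparr>) \<iota> \<phi>"
    by (rule trivial_extension_of_section[OF assms(7) subH, of f]) (use f fmult in \<open>auto simp: H_def\<close>)
  obtain a b where ab: "\<forall>j<g\<^sub>1. a j \<in> carrier ?G \<and> b j \<in> carrier ?G"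
    "generate ?G (a ` {..<g\<^sub>1} \<union> b ` {..<g\<^sub>1}) = carrier ?G"
    using surface_group_presentation[OF assms(6), where ?'g = nat] by blast
  define B where "B = a ` {..<g\<^sub>1} \<union> b ` {..<g\<^sub>1}"
  have B: "finite B" "B \<subseteq> ?N" "generate ?G B = ?N" using ab by (auto simp: B_def)
  have cardB: "card B \<le> 2 * g\<^sub>1"
    using card_Un_le[of "a ` {..<g\<^sub>1}" "b ` {..<g\<^sub>1}"] card_image_le[of "{..<g\<^sub>1}" a] card_image_le[of "{..<g\<^sub>1}" b]
    by (simp add: B_def)
  have oA: "1 \<le> order A" using assms(2) A.order_gt_0_iff_finite by (simp add: Suc_le_eq)
  define m where "m = ?e ^ card B * order A ^ (?e * card B)"
  have "?e * card B \<le> 2 * ?e * g\<^sub>1" using cardB by (simp add: mult.left_commute mult_le_mono2)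
  then have m1: "order A ^ (?e * card B) \<le> order A ^ (2 * ?e * g\<^sub>1)" using oA by (rule power_increasing)
  have m2: "?e ^ card B \<le> fact ?e ^ (2 * g\<^sub>1 + card R)"
  proof -
    have "?e ^ card B \<le> fact ?e ^ card B" by (intro power_mono fact_ge_self) simp
    also have "\<dots> \<le> fact ?e ^ (2 * g\<^sub>1 + card R)" using cardB by (intro power_increasing) (auto simp: fact_ge_1)
    finally show ?thesis .
  qed
  have pos: "0 < order A ^ (2 * ?e * g\<^sub>1)" "0 < (fact ?e :: nat) ^ (2 * g\<^sub>1 + card R)" using oA by auto
  have le: "m \<le> order A ^ (2 * ?e * g\<^sub>1) * fact ?e ^ (2 * g\<^sub>1 + card R)"
    unfolding m_def using mult_le_mono[OF m1 m2] by (simp add: mult.commute)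
  also have "\<dots> \<le> order A ^ (2 * ?e * g\<^sub>1) * (?e * fact ?e ^ (2 * g\<^sub>1 + card R))"
    using e(1) by simp
  finally have mle: "m \<le> order A ^ (2 * ?e * g\<^sub>1) * (?e * fact ?e ^ (2 * g\<^sub>1 + card R))" .
  have mless: "m < order A ^ (2 * ?e * g\<^sub>1) * (?e * fact ?e ^ (2 * g\<^sub>1 + card R))" if "order A \<noteq> 1"
  proof -
    have "?e \<noteq> 1" using order_eq_1_of_exponent[OF D(1)] e(2) that by auto
    then have "2 \<le> ?e" using e(1) by simp
    then have "order A ^ (2 * ?e * g\<^sub>1) * fact ?e ^ (2 * g\<^sub>1 + card R) <
        order A ^ (2 * ?e * g\<^sub>1) * (?e * fact ?e ^ (2 * g\<^sub>1 + card R))"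
      using pos by simp
    with le show ?thesis by (rule le_less_trans)
  qed
  have "finite (rcosets\<^bsub>\<Gamma>\<^esub> (normalizer \<Gamma> ((\<lambda>x. \<theta> (\<one>\<^bsub>A\<^esub>, x)) ` H))) \<and>
      card (rcosets\<^bsub>\<Gamma>\<^esub> (normalizer \<Gamma> ((\<lambda>x. \<theta> (\<one>\<^bsub>A\<^esub>, x)) ` H))) \<le> m"
    if "trivialization A (\<Gamma>\<lparr>carrier := preimage_subgroup \<Gamma> \<phi> H\<rparr>) (G\<lparr>carrier := H\<rparr>) \<iota> \<phi> \<theta>" for \<theta>
    unfolding m_def by (rule normalizer_index_bound[OF assms(7,2) N B \<alpha> e(1) H_def that])
  then show ?thesis
    unfolding Let_def using H triv mle mless by (intro exI[of _ H]) (meson le_trans le_less_trans)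
qed

end
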